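(* Let $\Omega\subset\mathbb{R}^2$ be open and connected, let $f:\Omega\to\mathbb{R}$ be a $C^2$ Morse function, and let $a<b$ be values attained by $f$ such that $f^{-1}([a,b])$ is compact. For $t\in[a,b]$ let $L(t)$ be the length of $f^{-1}(t)$, and let $\kappa$ be the signed curvature of the level curves of $f$ (see context). Then: (a) $$\iint_{f^{-1}([a,b])}(h\circ f)\cdot|\nabla f|\,dA=\int_a^b h(t)L(t)\,dt$$ for any function $h$ such that both members of the equation are meaningful. In particular, for any $t\in[a,b]$, $$\int_a^t L(\tau)\,d\tau=\iint_{f^{-1}([a,t])}|\nabla f|\,dA,$$ or equivalently $$L(t)=\frac{d}{dt}\iint_{f^{-1}([a,t])}|\nabla f|\,dA .$$ (b) For any regular value $t\in[a,b]$, $$L'(t)=\int_{f^{-1}(t)}\frac{\kappa}{|\nabla f|}\,ds,$$ or equivalently, for any $t\in[a,b]$, $$L(t)=L(a)+\iint_{f^{-1}([a,t])}\kappa\,dA .$$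
   Context: A Morse function on an open subset of $\mathbb{R}^2$ is a real-valued $C^2$ function all of whose critical points are nondegenerate (nonsingular Hessian). A regular value is a number that is not the image of a critical point; a critical value is the image of a critical point; a regular point is a noncritical point. $L(t)$ is the total length of the level set $f^{-1}(t)$; it is well defined also when $t$ is a critical value (near a nondegenerate critical point the level set looks, in suitable local coordinates, like the zero set of a nondegenerate quadratic form). Signed curvature: at each regular point let $\mathbf{N}=-\nabla f/|\nabla f|$ and let $\mathbf{T}$ be the unit tangent to the level curve of $f$ through that point such that $(\mathbf{T},\mathbf{N})$ is a positively oriented frame. Then $\kappa$ is defined by $d\mathbf{T}/ds=\kappa\mathbf{N}$, where $s$ is arc length with positive direction induced by $\mathbf{T}$. Thus $\kappa$ is a function on the set of regular points, and $\kappa=\operatorname{div}(\nabla f/|\nabla f|)=\dfrac{f_{xx}f_y^2-2f_{xy}f_xf_y+f_{yy}f_x^2}{|\nabla f|^3}$. Integrals of $\kappa$ over $f^{-1}([a,t])$ are proper Riemann integrals when this set contains no critical point, and otherwise improper Riemann integrals: the limit of the integrals over an expanding sequence of Jordan measurable closed subsets avoiding the (finitely many) critical points and exhausting the rest (every interior point of the complement of the critical points in the region is eventually interior to some member of the sequence), the limit being required to exist and to be independent of the sequence. Convergence of this improper integral is part of the assertion. Derivatives with respect to $t$ at the endpoints $a,b$ are one-sided. *)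

theory Defs
  imports "HOL-Analysis.Analysis"
begin

section \<open>Length: one-dimensional Hausdorff measure\<close>

text \<open>
  With the diameter as gauge, no normalising constant is needed in dimension one: the measure of
  a simple rectifiable curve is its arc length, and finite sets are null.  So it gives the length
  of a level set whether or not the level is critical, and integration against it restricted to
  a curve is integration with respect to arc length.
\<close>

definition hausdorff1_pre :: "real \<Rightarrow> 'a::metric_space set \<Rightarrow> ennreal" where
  "hausdorff1_pre \<delta> A =
    (INF U \<in> {U :: nat \<Rightarrow> 'a set. A \<subseteq> (\<Union>i. U i) \<and> (\<forall>i. bounded (U i) \<and> diameter (U i) \<le> \<delta>)}.
      \<Sum>i. ennreal (diameter (U i)))"

definition hausdorff1_outer :: "'a::metric_space set \<Rightarrow> ennreal" where
  "hausdorff1_outer A = (SUP \<delta> \<in> {0<..}. hausdorff1_pre \<delta> A)"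

definition hausdorff1 :: "'a::metric_space measure" where
  "hausdorff1 = measure_of UNIV (sets borel) hausdorff1_outer"

text \<open>
  The rest of this section shows that \<open>measure_of\<close> does not collapse here: the outer measure is
  countably additive on the Borel sets (see \<open>emeasure_hausdorff1\<close> below).
\<close>

lemma hausdorff1_pre_le:
  assumes "A \<subseteq> (\<Union>i. U i)" "\<And>i. bounded (U i)" "\<And>i. diameter (U i) \<le> \<delta>"
  shows "hausdorff1_pre \<delta> A \<le> (\<Sum>i. ennreal (diameter (U i)))"
  unfolding hausdorff1_pre_def using assms by (intro INF_lower) auto

lemma hausdorff1_pre_mono: "A \<subseteq> B \<Longrightarrow> hausdorff1_pre \<delta> A \<le> hausdorff1_pre \<delta> B"
  unfolding hausdorff1_pre_def by (rule INF_superset_mono) auto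

lemma hausdorff1_pre_antimono: "\<delta> \<le> \<epsilon> \<Longrightarrow> hausdorff1_pre \<epsilon> A \<le> hausdorff1_pre \<delta> A"
  unfolding hausdorff1_pre_def by (rule INF_superset_mono) (auto intro: order_trans)

lemma hausdorff1_pre_le_outer: "0 < \<delta> \<Longrightarrow> hausdorff1_pre \<delta> A \<le> hausdorff1_outer A"
  unfolding hausdorff1_outer_def by (rule SUP_upper) auto

lemma hausdorff1_outer_empty: "hausdorff1_outer {} = 0"
proof -
  have "hausdorff1_pre \<delta> ({} :: 'a set) = 0" if "0 < \<delta>" for \<delta>
    using hausdorff1_pre_le[of "{} :: 'a set" "\<lambda>_. {}" \<delta>] that by simp
  then have "hausdorff1_outer ({} :: 'a set) \<le> 0"
    unfolding hausdorff1_outer_def by (intro SUP_least) simp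
  then show ?thesis by simp
qed

lemma hausdorff1_outer_mono: "A \<subseteq> B \<Longrightarrow> hausdorff1_outer A \<le> hausdorff1_outer B"
  unfolding hausdorff1_outer_def by (intro SUP_mono) (auto intro: hausdorff1_pre_mono)

lemma hausdorff1_pre_subadditive:
  fixes A :: "nat \<Rightarrow> 'a::metric_space set"
  shows "hausdorff1_pre \<delta> (\<Union>i. A i) \<le> (\<Sum>i. hausdorff1_pre \<delta> (A i))"
proof (rule ennreal_le_epsilon)
  fix e :: real assume "0 < e" "(\<Sum>n. hausdorff1_pre \<delta> (A n)) < top"
  then have *: "hausdorff1_pre \<delta> (A n) < hausdorff1_pre \<delta> (A n) + e * (1/2)^Suc n" for n
    by (auto simp add: less_top dest!: ennreal_suminf_lessD)
  have "\<exists>B. A n \<subseteq> (\<Union>i. B i) \<and> (\<forall>i. bounded (B i) \<and> diameter (B i) \<le> \<delta>) \<and>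
      (\<Sum>i. ennreal (diameter (B i))) \<le> hausdorff1_pre \<delta> (A n) + e * (1/2)^Suc n" for n
    using *[of n] unfolding hausdorff1_pre_def[of \<delta> "A n"] INF_less_iff
    by (auto intro: less_imp_le)
  then obtain B where B: "\<And>n. A n \<subseteq> (\<Union>i. B n i)" "\<And>n i. bounded (B n i)"
      "\<And>n i. diameter (B n i) \<le> \<delta>"
      "\<And>n. (\<Sum>i. ennreal (diameter (B n i))) \<le> hausdorff1_pre \<delta> (A n) + e * (1/2)^Suc n"
    by metis
  define C where "C = case_prod B o prod_decode"
  have "(\<Union>i. A i) \<subseteq> (\<Union>i. C i)"
    using B(1) by (auto simp add: C_def subset_eq) (metis prod.case prod_encode_inverse)
  then have "hausdorff1_pre \<delta> (\<Union>i. A i) \<le> (\<Sum>i. ennreal (diameter (C i)))"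
    using B(2,3) by (intro hausdorff1_pre_le) (auto simp: C_def split: prod.split)
  also have "\<dots> = (\<Sum>n. \<Sum>i. ennreal (diameter (B n i)))"
    using suminf_ennreal_2dimen[of "\<lambda>m. \<Sum>i. ennreal (diameter (B m i))"
        "\<lambda>p. ennreal (diameter (case_prod B p))"]
    by (simp add: C_def)
  also have "\<dots> \<le> (\<Sum>n. hausdorff1_pre \<delta> (A n) + e * (1/2) ^ Suc n)"
    by (intro suminf_le allI B) auto
  also have "\<dots> = (\<Sum>n. hausdorff1_pre \<delta> (A n)) + (\<Sum>n. ennreal e * ennreal ((1/2) ^ Suc n))"
    using \<open>0 < e\<close> by (subst suminf_add[symmetric])
                     (auto simp del: ennreal_suminf_cmult simp add: ennreal_mult[symmetric])
  also have "\<dots> = (\<Sum>n. hausdorff1_pre \<delta> (A n)) + e"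
    unfolding ennreal_suminf_cmult
    by (subst suminf_ennreal_eq[OF zero_le_power power_half_series]) auto
  finally show "hausdorff1_pre \<delta> (\<Union>i. A i) \<le> (\<Sum>n. hausdorff1_pre \<delta> (A n)) + e" .
qed

lemma hausdorff1_outer_subadditive:
  fixes A :: "nat \<Rightarrow> 'a::metric_space set"
  shows "hausdorff1_outer (\<Union>i. A i) \<le> (\<Sum>i. hausdorff1_outer (A i))"
  unfolding hausdorff1_outer_def[of "\<Union>i. A i"]
proof (rule SUP_least)
  fix \<delta> :: real assume "\<delta> \<in> {0<..}"
  then have "(\<Sum>i. hausdorff1_pre \<delta> (A i)) \<le> (\<Sum>i. hausdorff1_outer (A i))"
    by (intro suminf_le hausdorff1_pre_le_outer) auto
  then show "hausdorff1_pre \<delta> (\<Union>i. A i) \<le> (\<Sum>i. hausdorff1_outer (A i))"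
    using hausdorff1_pre_subadditive[of \<delta> A] by (rule order_trans[rotated])
qed

lemma outer_measure_space_hausdorff1:
  "outer_measure_space UNIV (hausdorff1_outer :: 'a::metric_space set \<Rightarrow> ennreal)"
  by (auto simp: outer_measure_space_def positive_def increasing_def countably_subadditive_def
      hausdorff1_outer_empty hausdorff1_outer_mono hausdorff1_outer_subadditive)

lemma hausdorff1_outer_Un_le:
  "hausdorff1_outer (A \<union> B) \<le> hausdorff1_outer A + hausdorff1_outer B"
proof -
  let ?C = "\<lambda>i::nat. if i = 0 then A else if i = 1 then B else {}"
  have "A \<union> B = (\<Union>i. ?C i)" by (auto split: if_splits)
  then have "hausdorff1_outer (A \<union> B) \<le> (\<Sum>i. hausdorff1_outer (?C i))"
    using hausdorff1_outer_subadditive[of ?C] by simp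
  also have "\<dots> = (\<Sum>i\<in>{0,1}. hausdorff1_outer (?C i))"
    by (rule suminf_finite) (auto simp: hausdorff1_outer_empty)
  finally show ?thesis by simp
qed

lemma hausdorff1_outer_separated:
  fixes A B :: "'a::metric_space set"
  assumes d: "0 < d" "\<And>x y. x \<in> A \<Longrightarrow> y \<in> B \<Longrightarrow> d \<le> dist x y"
  shows "hausdorff1_outer A + hausdorff1_outer B \<le> hausdorff1_outer (A \<union> B)"
proof -
  have small: "hausdorff1_pre \<delta> A + hausdorff1_pre \<delta> B \<le> hausdorff1_pre \<delta> (A \<union> B)"
    if \<delta>: "0 < \<delta>" "\<delta> < d" for \<delta>
    unfolding hausdorff1_pre_def[of \<delta> "A \<union> B"]
  proof (rule INF_greatest, clarify)
    fix U :: "nat \<Rightarrow> 'a set"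
    assume U: "A \<union> B \<subseteq> (\<Union>i. U i)" "\<forall>i. bounded (U i) \<and> diameter (U i) \<le> \<delta>"
    define V where "V i = (if U i \<inter> A = {} then {} else U i)" for i
    define W where "W i = (if U i \<inter> B = {} then {} else U i)" for i
    have "A \<subseteq> (\<Union>i. V i)" "B \<subseteq> (\<Union>i. W i)"
      using U(1) unfolding V_def W_def by fastforce+
    then have "hausdorff1_pre \<delta> A \<le> (\<Sum>i. ennreal (diameter (V i)))"
      using U \<delta> by (intro hausdorff1_pre_le) (auto simp: V_def)
    moreover have "hausdorff1_pre \<delta> B \<le> (\<Sum>i. ennreal (diameter (W i)))"
      using U \<delta> \<open>B \<subseteq> (\<Union>i. W i)\<close> by (intro hausdorff1_pre_le) (auto simp: W_def)
    moreover have "U i \<inter> A = {} \<or> U i \<inter> B = {}" for i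
    proof (rule ccontr)
      assume "\<not> ?thesis"
      then obtain x y where "x \<in> U i" "x \<in> A" "y \<in> U i" "y \<in> B" by auto
      then have "d \<le> dist x y" "dist x y \<le> diameter (U i)"
        using d U(2) by (auto intro: diameter_bounded_bound)
      with U(2) \<delta> show False by (meson not_le order_trans)
    qed
    then have "ennreal (diameter (V i)) + ennreal (diameter (W i)) \<le> ennreal (diameter (U i))" for i
      by (auto simp: V_def W_def)
    then have "(\<Sum>i. ennreal (diameter (V i))) + (\<Sum>i. ennreal (diameter (W i)))
        \<le> (\<Sum>i. ennreal (diameter (U i)))"
      by (subst suminf_add) (auto intro!: suminf_le)
    ultimately show "hausdorff1_pre \<delta> A + hausdorff1_pre \<delta> B \<le> (\<Sum>i. ennreal (diameter (U i)))"
      by (meson add_mono order_trans)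
  qed
  have le: "hausdorff1_pre \<delta> A + hausdorff1_pre \<epsilon> B \<le> hausdorff1_outer (A \<union> B)"
    if "0 < \<delta>" "0 < \<epsilon>" for \<delta> \<epsilon>
  proof -
    define \<eta> where "\<eta> = min (min \<delta> \<epsilon>) (d / 2)"
    have \<eta>: "0 < \<eta>" "\<eta> < d" "\<eta> \<le> \<delta>" "\<eta> \<le> \<epsilon>" using that d(1) by (auto simp: \<eta>_def)
    have "hausdorff1_pre \<delta> A + hausdorff1_pre \<epsilon> B \<le> hausdorff1_pre \<eta> A + hausdorff1_pre \<eta> B"
      using \<eta> by (intro add_mono hausdorff1_pre_antimono)
    also have "\<dots> \<le> hausdorff1_pre \<eta> (A \<union> B)" using small \<eta> by blast
    also have "\<dots> \<le> hausdorff1_outer (A \<union> B)" using \<eta> by (intro hausdorff1_pre_le_outer)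
    finally show ?thesis .
  qed
  have ne: "{0::real<..} \<noteq> {}" by (simp add: gt_ex)
  have "hausdorff1_outer A + hausdorff1_pre \<epsilon> B \<le> hausdorff1_outer (A \<union> B)" if "0 < \<epsilon>" for \<epsilon>
    unfolding hausdorff1_outer_def[of A]
    using le that ne by (subst ennreal_SUP_add_left[symmetric]) (auto intro!: SUP_least)
  then show ?thesis
    unfolding hausdorff1_outer_def[of B]
    using ne by (subst ennreal_SUP_add_right) (auto intro!: SUP_least)
qed

lemma hausdorff1_outer_separated_sum:
  fixes A :: "nat \<Rightarrow> 'a::metric_space set"
  assumes "\<And>j. A j \<subseteq> T"
    and sep: "\<And>n. \<exists>d>0. \<forall>i<n. \<forall>x\<in>A i. \<forall>y\<in>A n. d \<le> dist x y"
  shows "(\<Sum>j. hausdorff1_outer (A j)) \<le> hausdorff1_outer T"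
proof -
  have "(\<Sum>j<n. hausdorff1_outer (A j)) \<le> hausdorff1_outer (\<Union>j<n. A j)" for n
  proof (induction n)
    case (Suc n)
    obtain d where "0 < d" "\<And>i x y. \<lbrakk>i < n; x \<in> A i; y \<in> A n\<rbrakk> \<Longrightarrow> d \<le> dist x y"
      using sep[of n] by blast
    then have "hausdorff1_outer (\<Union>j<n. A j) + hausdorff1_outer (A n)
        \<le> hausdorff1_outer ((\<Union>j<n. A j) \<union> A n)"
      by (intro hausdorff1_outer_separated) auto
    moreover have "(\<Union>j<n. A j) \<union> A n = (\<Union>j<Suc n. A j)"
      by (auto simp: less_Suc_eq)
    ultimately have "hausdorff1_outer (\<Union>j<n. A j) + hausdorff1_outer (A n)
        \<le> hausdorff1_outer (\<Union>j<Suc n. A j)" by (simp only:)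
    then show ?case
      unfolding sum.lessThan_Suc by (rule order_trans[OF add_right_mono[OF Suc.IH]])
  qed (simp add: hausdorff1_outer_empty)
  also have "hausdorff1_outer (\<Union>j<n. A j) \<le> hausdorff1_outer T" for n
    using assms(1) by (intro hausdorff1_outer_mono) auto
  finally show ?thesis by (intro suminf_le_const summableI)
qed

lemma closed_in_lambda_system_hausdorff1:
  fixes F :: "'a::metric_space set"
  assumes "closed F"
  shows "F \<in> lambda_system UNIV UNIV hausdorff1_outer"
proof -
  let ?H = "hausdorff1_outer :: 'a set \<Rightarrow> ennreal"
  have le: "?H (T \<inter> F) + ?H (T - F) \<le> ?H T" if fin: "?H T < top" and ne: "F \<noteq> {}" for T
  proof -
    define r :: "nat \<Rightarrow> real" where "r k = 1 / (real k + 1)" for k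
    have r_pos: "0 < r k" for k by (simp add: r_def)
    have r_dec: "r k < r j" if "j < k" for j k using that by (simp add: r_def frac_less2)
    define A where "A n = {x \<in> T. r n \<le> infdist x F}" for n
    define R where "R k = {x \<in> T. r (Suc k) \<le> infdist x F \<and> infdist x F < r k}" for k
    have gap: "r (Suc i) - r j \<le> dist x y" if "x \<in> R i" "y \<in> R j" for i j x y
    proof -
      have "infdist x F \<le> infdist y F + dist x y" by (rule infdist_triangle)
      then show ?thesis using that by (auto simp: R_def)
    qed
    have part: "(\<Sum>j. ?H (R (2 * j + c))) \<le> ?H T" for c
    proof (rule hausdorff1_outer_separated_sum)
      show "R (2 * j + c) \<subseteq> T" for j by (auto simp: R_def)
    next
      fix n
      show "\<exists>d>0. \<forall>i<n. \<forall>x\<in>R (2 * i + c). \<forall>y\<in>R (2 * n + c). d \<le> dist x y"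
      proof (cases n)
        case (Suc m)
        have "r (2 * m + c + 1) - r (2 * n + c) \<le> dist x y"
          if "i < n" "x \<in> R (2 * i + c)" "y \<in> R (2 * n + c)" for i x y
        proof -
          have "r (2 * m + c + 1) \<le> r (Suc (2 * i + c))"
            using that(1) Suc by (auto simp: r_def frac_le)
          then show ?thesis using gap[OF that(2,3)] by linarith
        qed
        moreover have "0 < r (2 * m + c + 1) - r (2 * n + c)"
          using r_dec[of "2 * m + c + 1" "2 * n + c"] Suc by simp
        ultimately show ?thesis by blast
      qed (auto intro: exI[of _ 1])
    qed
    let ?S = "\<Sum>k. ?H (R k)"
    have "(\<Sum>k<n. ?H (R k)) \<le> ?H T + ?H T" for n
    proof -
      have "(\<Sum>k<n. ?H (R k)) \<le> (\<Sum>k<2 * n. ?H (R k))" by (rule sum_mono2) auto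
      also have "\<dots> = (\<Sum>j<n. ?H (R (2 * j))) + (\<Sum>j<n. ?H (R (2 * j + 1)))"
        by (induction n) (auto simp: ac_simps)
      also have "\<dots> \<le> (\<Sum>j. ?H (R (2 * j + 0))) + (\<Sum>j. ?H (R (2 * j + 1)))"
        by (intro add_mono) (auto intro!: sum_le_suminf summableI)
      also have "\<dots> \<le> ?H T + ?H T" by (intro add_mono part)
      finally show ?thesis .
    qed
    then have "?S \<le> ?H T + ?H T" by (intro suminf_le_const summableI)
    then have S_fin: "?S < top" using fin by (simp add: le_less_trans)
    have "?H (T \<inter> F) + ?H (T - F) + (\<Sum>k<n. ?H (R k)) \<le> ?H T + ?S" for n
    proof -
      have "T - F \<subseteq> A n \<union> (\<Union>k. R (k + n))"
      proof
        fix x assume x: "x \<in> T - F"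
        then have pos: "0 < infdist x F"
          using assms ne by (simp add: infdist_pos_not_in_closed)
        then have ex: "\<exists>m. r m \<le> infdist x F"
          using reals_Archimedean[OF pos]
          by (metis r_def inverse_eq_divide less_imp_le of_nat_Suc add.commute)
        show "x \<in> A n \<union> (\<Union>k. R (k + n))"
        proof (cases "r n \<le> infdist x F")
          case False
          define m where "m = (LEAST m. r m \<le> infdist x F)"
          have m: "r m \<le> infdist x F" unfolding m_def using ex by (rule LeastI_ex)
          have "n < m" using False m r_dec[of m n] by (cases m n rule: linorder_cases) auto
          then obtain k where k: "m = Suc (k + n)" using less_iff_Suc_add by (metis add.commute)
          have "\<not> r (k + n) \<le> infdist x F"
            using not_less_Least[of "k + n" "\<lambda>m. r m \<le> infdist x F"] k by (simp add: m_def)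
          then have "x \<in> R (k + n)" using m k x by (simp add: R_def)
          then show ?thesis by blast
        qed (use x in \<open>auto simp: A_def\<close>)
      qed
      then have "?H (T - F) \<le> ?H (A n \<union> (\<Union>k. R (k + n)))" by (rule hausdorff1_outer_mono)
      also have "\<dots> \<le> ?H (A n) + ?H (\<Union>k. R (k + n))" by (rule hausdorff1_outer_Un_le)
      also have "\<dots> \<le> ?H (A n) + (\<Sum>k. ?H (R (k + n)))"
        by (intro add_left_mono hausdorff1_outer_subadditive)
      finally have 1: "?H (T - F) \<le> ?H (A n) + (\<Sum>k. ?H (R (k + n)))" .
      have "r n \<le> dist x y" if "x \<in> T \<inter> F" "y \<in> A n" for x y
        using that infdist_le[of x F y] by (auto simp: A_def dist_commute)
      then have "?H (T \<inter> F) + ?H (A n) \<le> ?H ((T \<inter> F) \<union> A n)"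
        using r_pos[of n] by (intro hausdorff1_outer_separated[where d = "r n"]) auto
      also have "\<dots> \<le> ?H T" by (intro hausdorff1_outer_mono) (auto simp: A_def)
      finally have 2: "?H (T \<inter> F) + ?H (A n) \<le> ?H T" .
      have "?S = (\<Sum>k. ?H (R (k + n))) + (\<Sum>k<n. ?H (R k))"
        by (rule suminf_offset) (rule summableI)
      then show ?thesis
        using order_trans[OF add_right_mono[OF add_left_mono[OF 1, of "?H (T \<inter> F)"], of "\<Sum>k<n. ?H (R k)"]
            order_trans[OF _ add_right_mono[OF 2, of "(\<Sum>k. ?H (R (k + n))) + (\<Sum>k<n. ?H (R k))"]]]
        by (simp add: add.assoc)
    qed
    then have "(SUP n. ?H (T \<inter> F) + ?H (T - F) + (\<Sum>k<n. ?H (R k))) \<le> ?H T + ?S"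
      by (rule SUP_least)
    then have "?H (T \<inter> F) + ?H (T - F) + ?S \<le> ?H T + ?S"
      by (subst (asm) ennreal_SUP_add_right[symmetric]) (auto simp: suminf_eq_SUP)
    then show ?thesis using S_fin by (auto simp: ennreal_add_left_cancel_le add.commute)
  qed
  have "?H (T \<inter> F) + ?H (T - F) = ?H T" for T
  proof (rule antisym)
    show "?H (T \<inter> F) + ?H (T - F) \<le> ?H T"
    proof (cases "F = {} \<or> ?H T = top")
      case False
      then show ?thesis using le[of T] by (simp add: less_top)
    qed (auto simp: hausdorff1_outer_empty)
  next
    show "?H T \<le> ?H (T \<inter> F) + ?H (T - F)"
      using hausdorff1_outer_Un_le[of "T \<inter> F" "T - F"] by (simp add: Int_Diff_Un)
  qed
  then show ?thesis by (simp add: lambda_system_def Int_commute Diff_eq)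
qed

lemma measure_space_hausdorff1:
  "measure_space UNIV (sets borel) (hausdorff1_outer :: 'a::metric_space set \<Rightarrow> ennreal)"
proof -
  interpret sigma_algebra UNIV "UNIV :: 'a set set"
    using sigma_algebra_Pow[of "UNIV :: 'a set"] by simp
  let ?L = "lambda_system UNIV UNIV (hausdorff1_outer :: 'a set \<Rightarrow> ennreal)"
  have L: "measure_space UNIV ?L hausdorff1_outer"
    by (rule caratheodory_lemma[OF outer_measure_space_hausdorff1])
  then have "sigma_sets UNIV (Collect closed) \<subseteq> ?L"
    using closed_in_lambda_system_hausdorff1
    by (intro sigma_algebra.sigma_sets_subset) (auto simp: measure_space_def)
  then have "sets borel \<subseteq> ?L" by (simp add: borel_eq_closed)
  then show ?thesis
    using L sets.sigma_algebra_axioms[of borel] by (auto intro: measure_down)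
qed

lemma sets_hausdorff1 [simp, measurable_cong]:
  "sets (hausdorff1 :: 'a::metric_space measure) = sets borel"
  using sets.sigma_sets_eq[of "borel :: 'a measure"] by (simp add: hausdorff1_def)

lemma space_hausdorff1 [simp]: "space hausdorff1 = UNIV"
  by (simp add: hausdorff1_def)

lemma emeasure_hausdorff1:
  "A \<in> sets borel \<Longrightarrow> emeasure hausdorff1 A = hausdorff1_outer A"
  using measure_space_hausdorff1
  by (auto simp: hausdorff1_def measure_space_def intro!: emeasure_measure_of_sigma)


definition level_length :: "(real^2) set \<Rightarrow> (real^2 \<Rightarrow> real) \<Rightarrow> real \<Rightarrow> real" where
  "level_length \<Omega> f t = measure hausdorff1 (\<Omega> \<inter> f -` {t})"


section \<open>Morse functions\<close>

definition gradient :: "(real^2 \<Rightarrow> real) \<Rightarrow> real^2 \<Rightarrow> real^2" where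
  "gradient f x = (THE D. GDERIV f x :> D)"

definition hessian :: "(real^2 \<Rightarrow> real) \<Rightarrow> real^2 \<Rightarrow> real^2^2" where
  "hessian f x = jacobian (gradient f) (at x)"

definition C2_on :: "(real^2) set \<Rightarrow> (real^2 \<Rightarrow> real) \<Rightarrow> bool" where
  "C2_on \<Omega> f \<longleftrightarrow>
    (\<forall>x\<in>\<Omega>. f differentiable (at x)) \<and> (\<forall>x\<in>\<Omega>. gradient f differentiable (at x)) \<and>
    continuous_on \<Omega> (hessian f)"

definition critical_points :: "(real^2) set \<Rightarrow> (real^2 \<Rightarrow> real) \<Rightarrow> (real^2) set" where
  "critical_points \<Omega> f = {x\<in>\<Omega>. gradient f x = 0}"

definition Morse_on :: "(real^2) set \<Rightarrow> (real^2 \<Rightarrow> real) \<Rightarrow> bool" where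
  "Morse_on \<Omega> f \<longleftrightarrow> C2_on \<Omega> f \<and> (\<forall>x\<in>critical_points \<Omega> f. invertible (hessian f x))"


section \<open>Signed curvature of the level curves\<close>

definition level_normal :: "(real^2 \<Rightarrow> real) \<Rightarrow> real^2 \<Rightarrow> real^2" where
  "level_normal f x = - (gradient f x /\<^sub>R norm (gradient f x))"

text \<open>The normal is the tangent rotated by \<open>+\<pi>/2\<close>, so that the frame is positively oriented.\<close>

definition level_tangent :: "(real^2 \<Rightarrow> real) \<Rightarrow> real^2 \<Rightarrow> real^2" where
  "level_tangent f x = vector [level_normal f x $ 2, - (level_normal f x $ 1)]"

text \<open>
  The curve \<open>\<gamma>\<close> parametrises the level curve through \<open>x\<close> by arc length \<open>s\<close>, in the direction of the
  tangent field; the last conjunct is \<open>d\<^bold>T/ds = \<kappa>\<^bold>N\<close> at \<open>x\<close>.  The value is meaningful at regular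
  points only.
\<close>

definition level_curvature :: "(real^2 \<Rightarrow> real) \<Rightarrow> real^2 \<Rightarrow> real" where
  "level_curvature f x = (THE k. \<exists>\<gamma> \<epsilon>. 0 < \<epsilon> \<and> \<gamma> 0 = x \<and>
    (\<forall>s\<in>{-\<epsilon><..<\<epsilon>}. f (\<gamma> s) = f x \<and> (\<gamma> has_vector_derivative level_tangent f (\<gamma> s)) (at s)) \<and>
    ((\<lambda>s. level_tangent f (\<gamma> s)) has_vector_derivative k *\<^sub>R level_normal f x) (at 0))"


section \<open>Proper and improper Riemann integrals in the plane\<close>

definition Jordan_measurable :: "(real^2) set \<Rightarrow> bool" where
  "Jordan_measurable S \<longleftrightarrow> bounded S \<and> negligible (frontier S)"

text \<open>
  Riemann integrability is expressed by Lebesgue's criterion; the value of the integral is then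
  the gauge integral of the library.
\<close>

definition has_Riemann_integral :: "(real^2 \<Rightarrow> real) \<Rightarrow> real \<Rightarrow> (real^2) set \<Rightarrow> bool" where
  "has_Riemann_integral g I S \<longleftrightarrow>
    Jordan_measurable S \<and> bounded (g ` S) \<and>
    negligible {x\<in>S. \<not> continuous (at x within S) g} \<and> (g has_integral I) S"

definition Jordan_exhaustion ::
    "(real^2) set \<Rightarrow> (real^2) set \<Rightarrow> (nat \<Rightarrow> (real^2) set) \<Rightarrow> bool" where
  "Jordan_exhaustion S C K \<longleftrightarrow>
    (\<forall>n. closed (K n) \<and> Jordan_measurable (K n) \<and> K n \<subseteq> S - C \<and> K n \<subseteq> K (Suc n)) \<and>
    (\<forall>x\<in>interior (S - C). \<exists>n. x \<in> interior (K n))"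

text \<open>
  \<open>C\<close> is the set of points to be avoided.  An exhausting sequence has to exist, so that the value
  of the improper integral is unique.
\<close>

definition has_Riemann_integral_avoiding ::
    "(real^2) set \<Rightarrow> (real^2 \<Rightarrow> real) \<Rightarrow> real \<Rightarrow> (real^2) set \<Rightarrow> bool" where
  "has_Riemann_integral_avoiding C g I S \<longleftrightarrow>
    (if S \<inter> C = {} then has_Riemann_integral g I S
     else (\<exists>K. Jordan_exhaustion S C K) \<and>
          (\<forall>K. Jordan_exhaustion S C K \<longrightarrow>
            (\<exists>J. (\<forall>n. has_Riemann_integral g (J n) (K n)) \<and> J \<longlonglongrightarrow> I)))"

end

theory Submission
  imports Defs
begin

text \<open>
  Let \<open>S\<close> be the compact set \<open>f\<^sup>-\<^sup>1([a,b])\<close>.  Two identities carry the theorem: the coarea formula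
  \<open>\<integral>\<^sub>S w |\<nabla>f| dA = \<integral>\<^sub>a\<^sup>b (\<integral>\<^bsub>f=t\<^esub> w ds) dt\<close>, and \<open>L(b) - L(a) = \<integral>\<^sub>S \<kappa> dA\<close>.  Both are applied to the
  strips over subintervals as well; what remains is the fundamental theorem of calculus.

  The coarea formula is local.  Near a regular point one partial derivative of \<open>f\<close> does not vanish,
  say \<open>f\<^sub>y\<close>, so the level sets are graphs \<open>y = g(x,t)\<close>.  On such a graph the Hausdorff measure is
  \<open>\<surd>(1 + g\<^sub>x\<^sup>2) dx = |\<nabla>f|/|f\<^sub>y| dx\<close> (\<open>hausdorff1_density_curve\<close>), and the substitution \<open>t = f(x,y)\<close> in
  the inner integral of \<open>\<integral>\<integral> w |\<nabla>f| dy dx\<close>, followed by an exchange of the integrals, gives the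
  formula in one chart (\<open>coarea_chart\<close>).  Countably many charts cover the regular points (\<open>coarea\<close>),
  and the finitely many critical points in \<open>S\<close> are null for both measures.

  The coarea formula alone determines \<open>L\<close> only almost everywhere, so it is essential that
  \<open>t \<mapsto> \<integral>\<^bsub>f=t\<^esub> w ds\<close> is continuous on \<open>[a,b]\<close> for continuous \<open>w\<close>, at critical values too
  (\<open>continuous_level_integral\<close>).  In a chart it is a parameter integral.  Near a critical point \<open>p\<close>
  the length of the level set in the disc of radius \<open>\<epsilon>\<close> is at most \<open>K \<epsilon>\<close>, uniformly in \<open>t\<close>
  (\<open>critical_level_bound\<close>): since the Hessian \<open>H\<close> is invertible, \<open>\<nabla>f(x)\<close> is close to \<open>H(x - p)\<close>, and
  the disc without \<open>p\<close> is a union of finitely many convex sectors in each of which the gradient keeps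
  to one side of a line by a definite angle; by the mean value theorem a level set in such a sector
  is a Lipschitz graph over that line.

  For the second identity, \<open>\<kappa>\<close> is the divergence of \<open>\<nabla>f/|\<nabla>f|\<close>.  If \<open>\<psi>\<close> is of class \<open>C\<^sup>1\<close> and vanishes
  off \<open>[a,b]\<close>, then \<open>\<psi>(f) \<nabla>f/\<surd>(|\<nabla>f|\<^sup>2 + \<epsilon>)\<close>, extended by zero, is a differentiable field on the plane
  with compact support, so its divergence has integral zero.  Uniformly in \<open>\<epsilon>\<close>, the divergence is bounded by a
  multiple of \<open>1 + 1/|\<nabla>f|\<close>, and \<open>1/|\<nabla>f|\<close> is integrable on \<open>S\<close> because \<open>|\<nabla>f(x)| \<ge> c |x - p|\<close> near a critical point;
  hence \<open>\<epsilon>\<close> may tend to zero.  With the coarea formula this gives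
  \<open>\<integral>\<^sub>S \<psi>(f) \<kappa> dA = - \<integral>\<^sub>a\<^sup>b \<psi>'(t) L(t) dt\<close> (\<open>curvature_flux\<close>).  When \<open>\<psi>\<close> tends to the indicator of
  \<open>]a,b[\<close>, the two halves of \<open>\<psi>'\<close> concentrate at \<open>a\<close> and \<open>b\<close>, and continuity of \<open>L\<close> yields
  \<open>L(b) - L(a) = \<integral>\<^sub>S \<kappa> dA\<close> (\<open>length_change\<close>).

  Near a regular value the coarea formula with \<open>w = \<kappa>/|\<nabla>f|\<close> turns this area integral into the integral
  of a continuous function of \<open>t\<close>, which is therefore the derivative of \<open>L\<close>.  Since \<open>\<kappa>\<close> is absolutely
  integrable on \<open>S\<close>, dominated convergence shows that the improper Riemann integral exists, with the
  same value for every exhausting sequence.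
\<close>

section \<open>Hausdorff length of Lipschitz images and of subsets of the line\<close>

lemma hausdorff1_outer_lipschitz_image:
  fixes g :: "'a::metric_space \<Rightarrow> 'b::metric_space"
  assumes c: "0 < c" and lip: "\<And>x y. x \<in> A \<Longrightarrow> y \<in> A \<Longrightarrow> dist (g x) (g y) \<le> c * dist x y"
  shows "hausdorff1_outer (g ` A) \<le> ennreal c * hausdorff1_outer A"
  unfolding hausdorff1_outer_def[of "g ` A"]
proof (rule SUP_least)
  fix \<delta> :: real assume "\<delta> \<in> {0<..}"
  then have \<delta>: "0 < \<delta>" by simp
  have cancel: "ennreal c * (ennreal (1 / c) * x) = x" "ennreal (1 / c) * (ennreal c * x) = x" for x
    using c by (simp_all add: mult.assoc[symmetric] ennreal_mult[symmetric])
  have "ennreal (1 / c) * hausdorff1_pre \<delta> (g ` A) \<le> hausdorff1_pre (\<delta> / c) A"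
    unfolding hausdorff1_pre_def[of "\<delta> / c"]
  proof (rule INF_greatest, clarify)
    fix U :: "nat \<Rightarrow> 'a set"
    assume U: "A \<subseteq> (\<Union>i. U i)" "\<forall>i. bounded (U i) \<and> diameter (U i) \<le> \<delta> / c"
    have le: "diameter (g ` (U i \<inter> A)) \<le> c * diameter (U i)" for i
    proof (cases "U i \<inter> A = {}")
      case False
      have "dist x y \<le> c * diameter (U i)" if "x \<in> g ` (U i \<inter> A)" "y \<in> g ` (U i \<inter> A)" for x y
      proof -
        from that obtain x' y' where *: "x' \<in> U i \<inter> A" "y' \<in> U i \<inter> A" "x = g x'" "y = g y'" by auto
        then have "dist x y \<le> c * dist x' y'" using lip by auto
        also have "\<dots> \<le> c * diameter (U i)"
          using * U(2) c by (intro mult_left_mono diameter_bounded_bound) auto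
        finally show ?thesis .
      qed
      then show ?thesis
        using False by (auto simp: diameter_def[of "g ` (U i \<inter> A)"] intro!: cSUP_least)
    qed (use c U(2) in \<open>auto intro!: mult_nonneg_nonneg diameter_ge_0\<close>)
    have bd: "bounded (g ` (U i \<inter> A))" for i
    proof -
      obtain M where M: "\<And>x y. x \<in> U i \<Longrightarrow> y \<in> U i \<Longrightarrow> dist x y \<le> M"
        using U(2) by (metis bounded_two_points)
      have "dist x y \<le> c * M" if "x \<in> g ` (U i \<inter> A)" "y \<in> g ` (U i \<inter> A)" for x y
      proof -
        from that obtain x' y' where *: "x' \<in> U i \<inter> A" "y' \<in> U i \<inter> A" "x = g x'" "y = g y'" by auto
        then have "dist x y \<le> c * dist x' y'" using lip by auto
        also have "\<dots> \<le> c * M" using * M c by (intro mult_left_mono) auto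
        finally show ?thesis .
      qed
      then show ?thesis by (metis bounded_two_points)
    qed
    have "hausdorff1_pre \<delta> (g ` A) \<le> (\<Sum>i. ennreal (diameter (g ` (U i \<inter> A))))"
    proof (rule hausdorff1_pre_le[OF _ bd])
      show "g ` A \<subseteq> (\<Union>i. g ` (U i \<inter> A))" using U(1) by blast
      fix i
      have "c * diameter (U i) \<le> c * (\<delta> / c)" using U(2) c by (intro mult_left_mono) auto
      then show "diameter (g ` (U i \<inter> A)) \<le> \<delta>" using le[of i] c by simp
    qed
    also have "\<dots> \<le> (\<Sum>i. ennreal c * ennreal (diameter (U i)))"
      using c by (intro suminf_le) (auto simp flip: ennreal_mult' intro!: ennreal_leI le)
    finally have "hausdorff1_pre \<delta> (g ` A) \<le> ennreal c * (\<Sum>i. ennreal (diameter (U i)))"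
      by simp
    from mult_left_mono[OF this, of "ennreal (1 / c)"]
    show "ennreal (1 / c) * hausdorff1_pre \<delta> (g ` A) \<le> (\<Sum>i. ennreal (diameter (U i)))"
      by (simp add: cancel)
  qed
  from mult_left_mono[OF this, of "ennreal c"]
  have "hausdorff1_pre \<delta> (g ` A) \<le> ennreal c * hausdorff1_pre (\<delta> / c) A"
    by (simp add: cancel)
  also have "\<dots> \<le> ennreal c * hausdorff1_outer A"
    using c \<delta> by (intro mult_left_mono hausdorff1_pre_le_outer) auto
  finally show "hausdorff1_pre \<delta> (g ` A) \<le> ennreal c * hausdorff1_outer A" .
qed

text \<open>
  A bounded set of reals lies in the closed interval between its infimum and supremum, whose
  length is the diameter of the set; so a cover with small total diameter bounds Lebesgue measure.
\<close>

lemma lborel_le_hausdorff1_outer: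
  fixes E :: "real set"
  assumes "E \<in> sets borel"
  shows "emeasure lborel E \<le> hausdorff1_outer E"
proof -
  have "emeasure lborel E \<le> hausdorff1_pre 1 E"
    unfolding hausdorff1_pre_def
  proof (rule INF_greatest, clarify)
    fix U :: "nat \<Rightarrow> real set"
    assume U: "E \<subseteq> (\<Union>i. U i)" "\<forall>i. bounded (U i) \<and> diameter (U i) \<le> 1"
    define I where "I i = (if U i = {} then {} else {Inf (U i)..Sup (U i)})" for i
    have UI: "U i \<subseteq> I i" for i
      using U(2)[rule_format, of i]
      by (auto simp: I_def intro!: cInf_lower cSup_upper dest: bounded_imp_bdd_above bounded_imp_bdd_below)
    have dI: "emeasure lborel (I i) \<le> ennreal (diameter (U i))" for i
    proof (cases "U i = {}")
      case False
      have b: "bounded (U i)" using U(2) by auto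
      have "Sup (U i) \<le> Inf (U i) + diameter (U i)"
      proof (rule cSup_least[OF False])
        fix x assume x: "x \<in> U i"
        have "x - diameter (U i) \<le> Inf (U i)"
        proof (rule cInf_greatest[OF False])
          fix y assume "y \<in> U i"
          then have "dist x y \<le> diameter (U i)" using b x by (intro diameter_bounded_bound) auto
          then show "x - diameter (U i) \<le> y" by (auto simp: dist_real_def)
        qed
        then show "x \<le> Inf (U i) + diameter (U i)" by simp
      qed
      moreover have "Inf (U i) \<le> Sup (U i)"
        using b False by (intro cInf_le_cSup bounded_imp_bdd_above bounded_imp_bdd_below)
      ultimately show ?thesis using False by (auto simp: I_def intro!: ennreal_leI)
    qed (auto simp: I_def)
    have "emeasure lborel E \<le> emeasure lborel (\<Union>i. I i)"
      using UI U(1) by (intro emeasure_mono order_trans[OF U(1)] UN_mono) (auto simp: I_def)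
    also have "\<dots> \<le> (\<Sum>i. emeasure lborel (I i))"
      by (intro emeasure_subadditive_countably) (auto simp: I_def)
    also have "\<dots> \<le> (\<Sum>i. ennreal (diameter (U i)))"
      by (intro suminf_le dI) auto
    finally show "emeasure lborel E \<le> (\<Sum>i. ennreal (diameter (U i)))" .
  qed
  also have "\<dots> \<le> hausdorff1_outer E" by (rule hausdorff1_pre_le_outer) simp
  finally show ?thesis .
qed

text \<open>
  Cutting the interval into \<open>N\<close> equal pieces gives covers of arbitrarily small mesh and constant
  total diameter.
\<close>

lemma hausdorff1_outer_interval_le:
  fixes l u :: real
  assumes "l \<le> u"
  shows "hausdorff1_outer {l..u} \<le> ennreal (u - l)"
  unfolding hausdorff1_outer_def
proof (rule SUP_least)
  fix \<delta> :: real assume "\<delta> \<in> {0<..}"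
  then have \<delta>: "0 < \<delta>" by simp
  obtain n :: nat where n: "(u - l) / \<delta> < real n" using reals_Archimedean2 by blast
  define N where "N = Suc n"
  define h where "h = (u - l) / real N"
  have h: "0 \<le> h" "h \<le> \<delta>" "real N * h = u - l"
    using assms n \<delta> by (auto simp: h_def N_def field_simps)
  define U where "U i = (if i < N then {l + real i * h .. l + real (Suc i) * h} else {})" for i
  have dU: "diameter (U i) = (if i < N then h else 0)" for i
    using h by (auto simp: U_def diameter_closed_interval algebra_simps)
  have "{l..u} \<subseteq> (\<Union>i. U i)"
  proof
    fix x assume x: "x \<in> {l..u}"
    show "x \<in> (\<Union>i. U i)"
    proof (cases "h = 0")
      case True
      then have "x = l" using h x by auto
      then have "x \<in> U 0" using True by (auto simp: U_def N_def)
      then show ?thesis by blast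
    next
      case False
      then have hp: "0 < h" using h by simp
      define k where "k = nat \<lfloor>(x - l) / h\<rfloor>"
      have q: "0 \<le> (x - l) / h" using x hp by auto
      have k1: "real k * h \<le> x - l" 
        using q hp by (auto simp: k_def pos_le_divide_eq[symmetric])
      have k2: "x - l < real (Suc k) * h"
        using q hp by (auto simp: k_def pos_divide_less_eq[symmetric]) linarith
      show ?thesis
      proof (cases "k < N")
        case True
        then have "x \<in> U k" using k1 k2 by (auto simp: U_def)
        then show ?thesis by blast
      next
        case False
        then have "real N * h \<le> real k * h" using hp by simp
        then have "x = l + real (Suc n) * h" using k1 h(3) x by (auto simp: N_def)
        then have "x \<in> U n" using hp by (auto simp: U_def N_def)
        then show ?thesis by blast
      qed
    qed
  qed
  then have "hausdorff1_pre \<delta> {l..u} \<le> (\<Sum>i. ennreal (diameter (U i)))"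
    using dU h \<delta> by (intro hausdorff1_pre_le) (auto simp: U_def)
  also have "\<dots> = (\<Sum>i<N. ennreal (diameter (U i)))"
    by (rule suminf_finite) (auto simp: dU)
  also have "\<dots> = ennreal (u - l)"
    using h by (simp add: dU ennreal_of_nat_eq_real_of_nat flip: ennreal_mult)
  finally show "hausdorff1_pre \<delta> {l..u} \<le> ennreal (u - l)" .
qed

lemma hausdorff1_eq_lborel: "(hausdorff1 :: real measure) = lborel"
proof (rule lborel_eqI[symmetric])
  fix l u :: real assume "\<And>b. b \<in> Basis \<Longrightarrow> l \<bullet> b \<le> u \<bullet> b"
  then have lu: "l \<le> u" by simp
  have "emeasure hausdorff1 (box l u) \<le> ennreal (u - l)"
    unfolding emeasure_hausdorff1[OF borel_open[OF open_box]]
    by (rule order_trans[OF hausdorff1_outer_mono hausdorff1_outer_interval_le[OF lu]]) (auto simp: box_real)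
  moreover have "ennreal (u - l) \<le> emeasure hausdorff1 (box l u)"
    using lborel_le_hausdorff1_outer[of "box l u"] lu by (simp add: emeasure_hausdorff1)
  ultimately show "emeasure hausdorff1 (box l u) = ennreal (\<Prod>b\<in>Basis. (u - l) \<bullet> b)"
    by simp
qed simp

lemma hausdorff1_outer_real: "E \<in> sets borel \<Longrightarrow> hausdorff1_outer E = emeasure lborel (E :: real set)"
  using emeasure_hausdorff1[of E] by (simp add: hausdorff1_eq_lborel)

section \<open>Arc length of curves as Hausdorff length\<close>

text \<open>
  The measure of arc length along \<open>\<gamma>\<close>.  The assumption \<open>chord\<close> says that \<open>\<gamma>\<close> is strictly
  differentiable with speed \<open>v\<close>: on short intervals near \<open>x\<close> the map \<open>\<gamma>\<close> distorts distances by a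
  factor between \<open>v x - e\<close> and \<open>v x + e\<close>.  The Lipschitz bounds for \<open>\<gamma>\<close> and for its inverse \<open>\<pi>\<close> then
  place the Hausdorff measure of a short arc between these multiples of the length of its parameter
  interval, so the length of the arc from \<open>c\<close> to \<open>x\<close> has derivative \<open>v x\<close>.  Both sides are finite
  measures that agree on half-lines after projection by \<open>\<pi>\<close>.
\<close>

lemma hausdorff1_density_curve:
  fixes \<gamma> :: "real \<Rightarrow> 'a::euclidean_space" and v :: "real \<Rightarrow> real"
  assumes cd: "c \<le> d"
    and vcont: "continuous_on {c..d} v" and vpos: "\<And>x. x \<in> {c..d} \<Longrightarrow> 0 < v x"
    and chord: "\<And>x e. x \<in> {c..d} \<Longrightarrow> 0 < e \<Longrightarrow>
      \<exists>\<delta>>0. \<forall>y\<in>{c..d}. \<forall>z\<in>{c..d}. dist y x < \<delta> \<longrightarrow> dist z x < \<delta> \<longrightarrow>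
        \<bar>dist (\<gamma> y) (\<gamma> z) - v x * \<bar>y - z\<bar>\<bar> \<le> e * \<bar>y - z\<bar>"
    and lip: "\<And>y z. y \<in> {c..d} \<Longrightarrow> z \<in> {c..d} \<Longrightarrow> dist (\<gamma> y) (\<gamma> z) \<le> C * \<bar>y - z\<bar>"
    and \<gamma>[measurable]: "\<gamma> \<in> borel_measurable borel"
    and \<pi>[measurable]: "\<pi> \<in> borel_measurable borel" and inv: "\<And>x. x \<in> {c..d} \<Longrightarrow> \<pi> (\<gamma> x) = x"
  shows "density hausdorff1 (indicator (\<gamma> ` {c..d})) =
    distr (density lborel (\<lambda>x. ennreal (v x * indicator {c..d} x))) borel \<gamma>"
proof -
  define \<Gamma> where "\<Gamma> = \<gamma> ` {c..d}"
  define M where "M = density hausdorff1 (indicator \<Gamma> :: 'a \<Rightarrow> ennreal)"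
  define \<mu> where "\<mu> = distr M borel \<pi>"
  define N where "N = density lborel (\<lambda>x. ennreal (v x * indicator {c..d} x))"
  have lip_C: "\<bar>C\<bar>-lipschitz_on {c..d} \<gamma>"
  proof (rule lipschitz_onI)
    fix y z assume "y \<in> {c..d}" "z \<in> {c..d}"
    then have "dist (\<gamma> y) (\<gamma> z) \<le> C * \<bar>y - z\<bar>" by (rule lip)
    also have "\<dots> \<le> \<bar>C\<bar> * \<bar>y - z\<bar>" by (rule mult_right_mono) auto
    finally show "dist (\<gamma> y) (\<gamma> z) \<le> \<bar>C\<bar> * dist y z" by (simp add: dist_real_def)
  qed simp
  have "continuous_on {c..d} \<gamma>" by (rule lipschitz_on_continuous_on[OF lip_C])
  then have "compact \<Gamma>" unfolding \<Gamma>_def by (intro compact_continuous_image) auto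
  then have \<Gamma>[measurable]: "\<Gamma> \<in> sets borel" by (intro borel_closed compact_imp_closed)
  have setsM[measurable_cong]: "sets M = sets borel" by (simp add: M_def)
  have M_eq: "emeasure M A = emeasure hausdorff1 (\<Gamma> \<inter> A)" if "A \<in> sets borel" for A
    using that unfolding M_def by (intro emeasure_restricted) auto
  have \<mu>_eq: "emeasure \<mu> E = hausdorff1_outer (\<gamma> ` ({c..d} \<inter> E))" if [measurable]: "E \<in> sets borel" for E
  proof -
    have "emeasure \<mu> E = emeasure M (\<pi> -` E)"
      unfolding \<mu>_def by (subst emeasure_distr) (auto simp: M_def)
    also have "\<dots> = emeasure hausdorff1 (\<Gamma> \<inter> \<pi> -` E)"
      using measurable_sets_borel[OF \<pi> that] by (simp add: M_eq)
    also have "\<Gamma> \<inter> \<pi> -` E = \<gamma> ` ({c..d} \<inter> E)"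
      using inv by (auto simp: \<Gamma>_def)
    finally show ?thesis
      using \<Gamma> measurable_sets_borel[OF \<pi> that] \<open>\<Gamma> \<inter> \<pi> -` E = \<gamma> ` ({c..d} \<inter> E)\<close>
      by (metis emeasure_hausdorff1 sets.Int)
  qed
  have setsmu[measurable_cong]: "sets \<mu> = sets borel" by (simp add: \<mu>_def)
  have upper: "hausdorff1_outer (\<gamma> ` E) \<le> ennreal K * emeasure lborel E"
    if "0 < K" "E \<in> sets borel" "\<And>y z. y \<in> E \<Longrightarrow> z \<in> E \<Longrightarrow> dist (\<gamma> y) (\<gamma> z) \<le> K * \<bar>y - z\<bar>" for K E
    using hausdorff1_outer_lipschitz_image[of K E \<gamma>] that by (simp add: hausdorff1_outer_real dist_real_def)
  have lower: "ennreal K * emeasure lborel E \<le> hausdorff1_outer (\<gamma> ` E)"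
    if K: "0 < K" and E: "E \<in> sets borel" "E \<subseteq> {c..d}"
      and ge: "\<And>y z. y \<in> E \<Longrightarrow> z \<in> E \<Longrightarrow> K * \<bar>y - z\<bar> \<le> dist (\<gamma> y) (\<gamma> z)" for K E
  proof -
    have "\<pi> ` \<gamma> ` E = E" using inv E(2) by force
    have "hausdorff1_outer (\<pi> ` \<gamma> ` E) \<le> ennreal (1 / K) * hausdorff1_outer (\<gamma> ` E)"
    proof (rule hausdorff1_outer_lipschitz_image)
      fix x y assume "x \<in> \<gamma> ` E" "y \<in> \<gamma> ` E"
      then obtain x' y' where *: "x' \<in> E" "y' \<in> E" "x = \<gamma> x'" "y = \<gamma> y'" by auto
      moreover have "\<pi> x = x'" "\<pi> y = y'" using * inv E(2) by auto
      ultimately show "dist (\<pi> x) (\<pi> y) \<le> 1 / K * dist x y"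
        using ge[of x' y'] K by (simp add: dist_real_def field_simps)
    qed (use K in auto)
    then have "emeasure lborel E \<le> ennreal (1 / K) * hausdorff1_outer (\<gamma> ` E)"
      using E by (simp add: \<open>\<pi> ` \<gamma> ` E = E\<close> hausdorff1_outer_real)
    from mult_left_mono[OF this, of "ennreal K"] show ?thesis
      using K by (simp add: mult.assoc[symmetric] ennreal_mult[symmetric])
  qed
  have fin: "finite_measure \<mu>"
  proof
    have "emeasure \<mu> (space \<mu>) = hausdorff1_outer (\<gamma> ` {c..d})"
      using \<mu>_eq[of UNIV] by (simp add: \<mu>_def)
    also have "\<dots> \<le> ennreal (\<bar>C\<bar> + 1) * emeasure lborel {c..d}"
    proof (rule upper)
      fix y z assume "y \<in> {c..d}" "z \<in> {c..d}"
      then have "dist (\<gamma> y) (\<gamma> z) \<le> C * \<bar>y - z\<bar>" by (rule lip)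
      also have "\<dots> \<le> (\<bar>C\<bar> + 1) * \<bar>y - z\<bar>" by (rule mult_right_mono) auto
      finally show "dist (\<gamma> y) (\<gamma> z) \<le> (\<bar>C\<bar> + 1) * \<bar>y - z\<bar>" .
    qed auto
    also have "\<dots> < \<infinity>" using cd by (simp add: ennreal_mult_less_top)
    finally show "emeasure \<mu> (space \<mu>) \<noteq> \<infinity>" by simp
  qed
  interpret finite_measure \<mu> by (rule fin)
  define s where "s x = measure \<mu> {..x}" for x
  have s_diff: "s y - s x = measure \<mu> {x<..y}" if "x \<le> y" for x y
  proof -
    have "{..y} - {..x} = {x<..y}" by auto
    then show ?thesis
      using that finite_measure_Diff[of "{..y}" "{..x}"] by (simp add: s_def setsmu)
  qed
  have nn: "measure \<mu> E = enn2real (hausdorff1_outer (\<gamma> ` ({c..d} \<inter> E)))" if "E \<in> sets borel" for E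
    using \<mu>_eq[OF that] by (simp add: measure_def)
  have key: "\<bar>measure \<mu> {y<..z} - v x * (z - y)\<bar> \<le> e * (z - y)"
    if e: "0 < e" "e < v x" and x: "x \<in> {c..d}" and yz: "y \<in> {c..d}" "z \<in> {c..d}" "y \<le> z"
      and ch: "\<And>p q. p \<in> {y..z} \<Longrightarrow> q \<in> {y..z} \<Longrightarrow>
        \<bar>dist (\<gamma> p) (\<gamma> q) - v x * \<bar>p - q\<bar>\<bar> \<le> e * \<bar>p - q\<bar>" for e x y z
  proof -
    have sub: "{c..d} \<inter> {y<..z} = {y<..z}" using yz by auto
    have m: "emeasure \<mu> {y<..z} = hausdorff1_outer (\<gamma> ` {y<..z})" using \<mu>_eq[of "{y<..z}"] sub by simp
    have "emeasure \<mu> {y<..z} \<le> ennreal (v x + e) * emeasure lborel {y<..z}"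
      unfolding m
    proof (rule upper)
      fix p q assume "p \<in> {y<..z}" "q \<in> {y<..z}"
      then have "\<bar>dist (\<gamma> p) (\<gamma> q) - v x * \<bar>p - q\<bar>\<bar> \<le> e * \<bar>p - q\<bar>" by (intro ch) auto
      then show "dist (\<gamma> p) (\<gamma> q) \<le> (v x + e) * \<bar>p - q\<bar>" by (simp add: distrib_right)
    qed (use e in auto)
    then have "ennreal (measure \<mu> {y<..z}) \<le> ennreal ((v x + e) * (z - y))"
      using e yz by (simp add: emeasure_eq_measure ennreal_mult)
    then have 1: "measure \<mu> {y<..z} \<le> (v x + e) * (z - y)"
      using e yz by (simp add: ennreal_le_iff)
    have "ennreal (v x - e) * emeasure lborel {y<..z} \<le> emeasure \<mu> {y<..z}"
      unfolding m
    proof (rule lower)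
      fix p q assume "p \<in> {y<..z}" "q \<in> {y<..z}"
      then have "\<bar>dist (\<gamma> p) (\<gamma> q) - v x * \<bar>p - q\<bar>\<bar> \<le> e * \<bar>p - q\<bar>" by (intro ch) auto
      then show "(v x - e) * \<bar>p - q\<bar> \<le> dist (\<gamma> p) (\<gamma> q)" by (simp add: left_diff_distrib)
    qed (use e yz in auto)
    then have "ennreal ((v x - e) * (z - y)) \<le> ennreal (measure \<mu> {y<..z})"
      using e yz by (simp add: emeasure_eq_measure ennreal_mult)
    then have 2: "(v x - e) * (z - y) \<le> measure \<mu> {y<..z}"
      by (simp add: ennreal_le_iff)
    show ?thesis using 1 2 by (simp add: algebra_simps abs_le_iff)
  qed
  have deriv: "(s has_real_derivative v x) (at x within {c..d})" if x: "x \<in> {c..d}" for x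
    unfolding has_field_derivative_def has_derivative_within_alt
  proof (intro conjI allI impI)
    fix e' :: real assume e': "0 < e'"
    define e where "e = min e' (v x / 2)"
    have e: "0 < e" "e < v x" "e \<le> e'" using e' vpos[OF x] by (auto simp: e_def)
    obtain \<delta> where \<delta>: "0 < \<delta>" and ch: "\<And>y z. y \<in> {c..d} \<Longrightarrow> z \<in> {c..d} \<Longrightarrow> dist y x < \<delta> \<Longrightarrow> dist z x < \<delta> \<Longrightarrow>
        \<bar>dist (\<gamma> y) (\<gamma> z) - v x * \<bar>y - z\<bar>\<bar> \<le> e * \<bar>y - z\<bar>"
      using chord[OF x e(1)] by blast
    have "norm (s y - s x - v x * (y - x)) \<le> e' * norm (y - x)" if y: "y \<in> {c..d}" "norm (y - x) < \<delta>" for y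
    proof (cases "x \<le> y")
      case True
      have "\<bar>measure \<mu> {x<..y} - v x * (y - x)\<bar> \<le> e * (y - x)"
        using True x y by (intro key[OF e(1,2) x] ch) (auto simp: dist_real_def)
      also have "\<dots> \<le> e' * (y - x)" using e True by (intro mult_right_mono) auto
      finally show ?thesis using s_diff[OF True] True by simp
    next
      case False
      then have le: "y \<le> x" by simp
      have "\<bar>measure \<mu> {y<..x} - v x * (x - y)\<bar> \<le> e * (x - y)"
        using le x y by (intro key[OF e(1,2) x] ch) (auto simp: dist_real_def)
      also have "\<dots> \<le> e' * (x - y)" using e le by (intro mult_right_mono) auto
      finally show ?thesis using s_diff[OF le] le by (simp add: algebra_simps abs_le_iff)
    qed
    with \<delta> show "\<exists>\<delta>>0. \<forall>y\<in>{c..d}. norm (y - x) < \<delta> \<longrightarrow> norm (s y - s x - v x * (y - x)) \<le> e' * norm (y - x)"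
      by blast
  qed (auto intro: bounded_linear_mult_right)
  have vm[measurable]: "(\<lambda>x. v x * indicator {c..d} x) \<in> borel_measurable borel"
    using borel_measurable_continuous_on_indicator[OF _ vcont] by (simp add: mult.commute)
  have FTC: "(\<integral>\<^sup>+x. ennreal (v x * indicator {c..d} x) * indicator {l..d} x \<partial>lborel) = ennreal (s d - s l)"
    if l: "l \<in> {c..d}" for l
  proof -
    have "(v has_integral s d - s l) {l..d}"
    proof (rule fundamental_theorem_of_calculus)
      fix x assume "x \<in> {l..d}"
      with l have x: "x \<in> {c..d}" by simp
      show "(s has_vector_derivative v x) (at x within {l..d})"
        using has_field_derivative_subset[OF deriv[OF x], of "{l..d}"] l
        by (simp add: has_real_derivative_iff_has_vector_derivative)
    qed (use l in auto)
    then have "(\<integral>\<^sup>+x. indicator {l..d} x * v x \<partial>lborel) = ennreal (s d - s l)"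
      using vpos l by (intro nn_integral_has_integral_lebesgue) (auto intro: less_imp_le)
    also have "(\<integral>\<^sup>+x. indicator {l..d} x * v x \<partial>lborel) =
      (\<integral>\<^sup>+x. ennreal (v x * indicator {c..d} x) * indicator {l..d} x \<partial>lborel)"
      using l by (intro nn_integral_cong) (auto simp: indicator_def)
    finally show ?thesis .
  qed
  have s0: "s c = 0"
  proof -
    have "{c..d} \<inter> {..c} = {c}" using cd by auto
    moreover have "hausdorff1_outer (\<gamma> ` {c}) \<le> ennreal 1 * emeasure lborel {c}" by (rule upper) auto
    ultimately show ?thesis by (simp add: s_def nn)
  qed
  have "\<mu> = N"
  proof (rule measure_eqI_lessThan)
    show "sets \<mu> = sets borel" "sets N = sets borel" by (simp_all add: setsmu N_def)
    fix x
    show "emeasure \<mu> {x<..} < \<infinity>" by (simp add: emeasure_eq_measure)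
    define l where "l = max x c"
    show "emeasure \<mu> {x<..} = emeasure N {x<..}"
    proof (cases "d < l")
      case True
      then have "{c..d} \<inter> {x<..} = {}" using cd by (auto simp: l_def max_def split: if_splits)
      moreover have zero: "(\<lambda>y. ennreal (v y * indicator {c..d} y) * indicator {x<..} y) = (\<lambda>_. 0)"
        using \<open>{c..d} \<inter> {x<..} = {}\<close> by (auto simp: indicator_def fun_eq_iff)
      have "emeasure N {x<..} = 0"
        unfolding N_def by (subst emeasure_density) (simp_all only: zero, simp_all)
      ultimately show ?thesis using \<mu>_eq[of "{x<..}"] by (simp add: hausdorff1_outer_empty)
    next
      case False
      then have l: "l \<in> {c..d}" by (auto simp: l_def)
      have "emeasure N {x<..} = (\<integral>\<^sup>+y. ennreal (v y * indicator {c..d} y) * indicator {x<..} y \<partial>lborel)"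
        unfolding N_def by (subst emeasure_density) simp_all
      also have "\<dots> = (\<integral>\<^sup>+y. ennreal (v y * indicator {c..d} y) * indicator {l..d} y \<partial>lborel)"
      proof (rule nn_integral_cong_AE)
        show "AE y in lborel. ennreal (v y * indicator {c..d} y) * indicator {x<..} y =
            ennreal (v y * indicator {c..d} y) * indicator {l..d} y"
          using AE_lborel_singleton[of x] by eventually_elim (auto simp: indicator_def l_def)
      qed
      also have "\<dots> = ennreal (s d - s l)" by (rule FTC[OF l])
      also have "s d - s l = measure \<mu> {x<..}"
      proof (cases "x < c")
        case True
        then have *: "{c..d} \<inter> {..d} = {c..d} \<inter> {x<..}" by auto
        have "s d = measure \<mu> {x<..}" unfolding s_def by (simp only: nn borel_closed closed_atMost borel_open open_greaterThan *)
        then show ?thesis using True s0 by (simp add: l_def)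
      next
        case False
        then have "l = x" by (simp add: l_def)
        have *: "{c..d} \<inter> {x<..d} = {c..d} \<inter> {x<..}" by auto
        have "{x<..d} \<in> sets borel" "{x<..} \<in> sets borel" by simp_all
        then have "measure \<mu> {x<..d} = measure \<mu> {x<..}" by (simp only: nn *)
        then show ?thesis using s_diff[of x d] l \<open>l = x\<close> by simp
      qed
      finally show ?thesis by (simp add: emeasure_eq_measure)
    qed
  qed
  have "M = distr \<mu> borel \<gamma>"
  proof (rule measure_eqI)
    fix A assume "A \<in> sets M"
    then have A[measurable]: "A \<in> sets borel" by (simp add: setsM)
    have "emeasure (distr \<mu> borel \<gamma>) A = emeasure \<mu> (\<gamma> -` A)"
      by (subst emeasure_distr) (auto simp: \<mu>_def)
    also have "\<dots> = hausdorff1_outer (\<gamma> ` ({c..d} \<inter> \<gamma> -` A))"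
      by (rule \<mu>_eq) (rule measurable_sets_borel[OF \<gamma> A])
    also have "\<gamma> ` ({c..d} \<inter> \<gamma> -` A) = \<Gamma> \<inter> A" by (auto simp: \<Gamma>_def)
    also have "hausdorff1_outer (\<Gamma> \<inter> A) = emeasure M A"
      using M_eq[OF A] emeasure_hausdorff1[of "\<Gamma> \<inter> A"] by simp
    finally show "emeasure M A = emeasure (distr \<mu> borel \<gamma>) A" by simp
  qed (simp add: setsM)
  then show ?thesis unfolding \<open>\<mu> = N\<close> by (simp add: M_def N_def \<Gamma>_def)
qed

section \<open>Coordinates in the plane and functions of class \<open>C\<^sup>2\<close>\<close>

text \<open>
  The variable in place \<open>i\<close> will parametrise level curves and the one in place \<open>j\<close> will be solved for.
  The sign \<open>\<sigma>\<close> makes \<open>f\<close> increase in the second variable, so that a single chart construction serves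
  for all four signs and positions of a nonzero partial derivative.
\<close>

definition coord :: "2 \<Rightarrow> 2 \<Rightarrow> real \<Rightarrow> real \<times> real \<Rightarrow> real^2" where
  "coord i j \<sigma> z = axis i (fst z) + axis j (\<sigma> * snd z)"

lemma UNIV_2_distinct: "i \<noteq> j \<Longrightarrow> (UNIV :: 2 set) = {i, j}"
proof -
  assume "i \<noteq> j"
  then have "card {i, j} = card (UNIV :: 2 set)" by simp
  then have "{i, j} = (UNIV :: 2 set)" by (intro card_subset_eq) auto
  then show ?thesis by simp
qed

lemma vec2_eq_distinct:
  fixes u v :: "real^2"
  assumes "i \<noteq> j"
  shows "u = v \<longleftrightarrow> u $ i = v $ i \<and> u $ j = v $ j"
  using UNIV_2_distinct[OF assms] by (auto simp: vec_eq_iff)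

lemma norm_vec2_distinct:
  fixes v :: "real^2"
  assumes "i \<noteq> j"
  shows "norm v = sqrt ((v $ i)\<^sup>2 + (v $ j)\<^sup>2)"
  using assms by (simp add: norm_vec_def L2_set_def UNIV_2_distinct[OF assms])

lemma inner_vec2_distinct:
  fixes u v :: "real^2"
  assumes "i \<noteq> j"
  shows "u \<bullet> v = u $ i * v $ i + u $ j * v $ j"
  using assms by (simp add: inner_vec_def UNIV_2_distinct[OF assms])

locale coordinates =
  fixes i j :: 2 and \<sigma> :: real
  assumes ij: "i \<noteq> j" and \<sigma>: "\<sigma> = 1 \<or> \<sigma> = -1"
begin

abbreviation P :: "real \<times> real \<Rightarrow> real^2" where "P \<equiv> coord i j \<sigma>"

lemma \<sigma>_square: "\<sigma> * \<sigma> = 1" "\<sigma>\<^sup>2 = 1" "\<bar>\<sigma>\<bar> = 1" "\<sigma> * (\<sigma> * x) = x"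
  using \<sigma> by (auto simp: power2_eq_square)

lemma P_nth [simp]: "P z $ i = fst z" "P z $ j = \<sigma> * snd z"
  using ij by (auto simp: coord_def axis_def)

lemma P_inverse: "P (v $ i, \<sigma> * v $ j) = v"
  by (simp add: vec2_eq_distinct[OF ij] \<sigma>_square)

lemma linear_P: "linear P"
  by (rule linearI) (auto simp: vec2_eq_distinct[OF ij] algebra_simps)

lemma continuous_on_P [continuous_intros]: "continuous_on A g \<Longrightarrow> continuous_on A (\<lambda>x. P (g x))"
  using linear_P continuous_on_compose2[of UNIV P A g]
  by (simp add: linear_conv_bounded_linear linear_continuous_on)

lemma borel_measurable_P [measurable]: "P \<in> borel_measurable borel"
  by (intro borel_measurable_continuous_onI continuous_on_P continuous_on_id)

lemma norm_P: "norm (P z) = sqrt ((fst z)\<^sup>2 + (snd z)\<^sup>2)"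
  by (simp add: norm_vec2_distinct[OF ij] power_mult_distrib \<sigma>_square)

lemma distr_P: "distr lborel borel P = lborel"
proof (rule lborel_eqI[symmetric])
  fix l u :: "real^2" assume "\<And>b. b \<in> Basis \<Longrightarrow> l \<bullet> b \<le> u \<bullet> b"
  then have lu: "l $ k \<le> u $ k" for k
    by (metis axis_in_Basis_iff cart_eq_inner_axis real_inner_class.inner_commute Basis_real_def insertI1)
  define lo where "lo = (if \<sigma> = 1 then l $ j else - u $ j)"
  define hi where "hi = (if \<sigma> = 1 then u $ j else - l $ j)"
  have hl: "lo \<le> hi" "hi - lo = u $ j - l $ j" using lu[of j] by (auto simp: lo_def hi_def)
  have "P -` box l u = {l $ i<..<u $ i} \<times> {lo<..<hi}"
  proof (rule set_eqI)
    fix z :: "real \<times> real"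
    have "P z \<in> box l u \<longleftrightarrow> (\<forall>k\<in>{i,j}. l $ k < P z $ k \<and> P z $ k < u $ k)"
      using UNIV_2_distinct[OF ij] by (auto simp: mem_box_cart)
    then show "z \<in> P -` box l u \<longleftrightarrow> z \<in> {l $ i<..<u $ i} \<times> {lo<..<hi}"
      using \<sigma> by (cases z) (auto simp: lo_def hi_def)
  qed
  then have "emeasure (distr lborel borel P) (box l u) = emeasure (lborel \<Otimes>\<^sub>M lborel) ({l $ i<..<u $ i} \<times> {lo<..<hi})"
    by (subst emeasure_distr) (auto simp: lborel_prod)
  also have "\<dots> = ennreal ((u $ i - l $ i) * (u $ j - l $ j))"
    using lu hl by (subst lborel.emeasure_pair_measure_Times) (auto simp: ennreal_mult)
  also have "(u $ i - l $ i) * (u $ j - l $ j) = (\<Prod>k\<in>UNIV. (u - l) $ k)"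
    using ij by (simp add: UNIV_2_distinct[OF ij])
  also have "\<dots> = (\<Prod>b\<in>Basis. (u - l) \<bullet> b)"
    by (simp add: Basis_vec_def prod.UNION_disjoint axis_eq_axis cart_eq_inner_axis UNION_singleton_eq_range prod.reindex inj_on_def)
  finally show "emeasure (distr lborel borel P) (box l u) = ennreal (\<Prod>b\<in>Basis. (u - l) \<bullet> b)" .
qed simp

lemma nn_integral_P:
  fixes \<phi> :: "real^2 \<Rightarrow> ennreal"
  assumes [measurable]: "\<phi> \<in> borel_measurable borel"
  shows "(\<integral>\<^sup>+z. \<phi> z \<partial>lborel) = (\<integral>\<^sup>+x. \<integral>\<^sup>+y. \<phi> (P (x, y)) \<partial>lborel \<partial>lborel)"
proof -
  have "(\<integral>\<^sup>+z. \<phi> z \<partial>lborel) = (\<integral>\<^sup>+z. \<phi> (P z) \<partial>lborel)"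
    by (subst distr_P[symmetric], subst nn_integral_distr) auto
  also have "\<dots> = (\<integral>\<^sup>+z. \<phi> (P z) \<partial>(lborel \<Otimes>\<^sub>M lborel))" by (simp add: lborel_prod)
  also have "\<dots> = (\<integral>\<^sup>+x. \<integral>\<^sup>+y. \<phi> (P (x, y)) \<partial>lborel \<partial>lborel)"
    by (subst lborel.nn_integral_fst[symmetric]) (auto simp: lborel_prod)
  finally show ?thesis .
qed

end

locale C2_function =
  fixes \<Omega> :: "(real^2) set" and f :: "real^2 \<Rightarrow> real"
  assumes open_\<Omega>: "open \<Omega>" and C2: "C2_on \<Omega> f"
begin

abbreviation G :: "real^2 \<Rightarrow> real^2" where "G \<equiv> gradient f"

lemma has_derivative_f:
  assumes "x \<in> \<Omega>"
  shows "(f has_derivative (\<lambda>h. h \<bullet> G x)) (at x)"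
proof -
  obtain f' where f': "(f has_derivative f') (at x)"
    using C2 assms by (auto simp: C2_on_def differentiable_def)
  have "f' h = h \<bullet> adjoint f' 1" for h
    using adjoint_works[OF has_derivative_linear[OF f'], of h 1] by simp
  then have "GDERIV f x :> adjoint f' 1"
    using has_derivative_eq_rhs[OF f'] by (simp add: gderiv_def fun_eq_iff)
  moreover have "D = D'" if "GDERIV f x :> D" "GDERIV f x :> D'" for D D'
    using has_derivative_unique[of f _ x] that unfolding gderiv_def
    by (metis inner_commute vector_eq_rdot)
  ultimately have "GDERIV f x :> G x"
    unfolding gradient_def by (metis (mono_tags, lifting) theI)
  then show ?thesis by (simp add: gderiv_def)
qed

lemma has_derivative_G:
  assumes "x \<in> \<Omega>"
  shows "(G has_derivative (\<lambda>h. hessian f x *v h)) (at x)"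
  using C2 assms by (auto simp: C2_on_def hessian_def jacobian_works)

lemma continuous_on_hessian: "continuous_on \<Omega> (hessian f)"
  using C2 by (simp add: C2_on_def)

lemma continuous_on_f: "continuous_on \<Omega> f"
  using has_derivative_f by (meson continuous_at_imp_continuous_on has_derivative_continuous)

lemma continuous_on_G: "continuous_on \<Omega> G"
  using has_derivative_G by (meson continuous_at_imp_continuous_on has_derivative_continuous)

lemma has_derivative_G_nth:
  "x \<in> \<Omega> \<Longrightarrow> ((\<lambda>x. G x $ k) has_derivative (\<lambda>h. (hessian f x *v h) $ k)) (at x)"
  using bounded_linear.has_derivative[OF bounded_linear_vec_nth has_derivative_G] .

lemma mean_value:
  assumes "closed_segment x y \<subseteq> \<Omega>"
  shows "\<exists>\<xi>\<in>closed_segment x y. f y - f x = (y - x) \<bullet> G \<xi>"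
proof -
  define l where "l t = x + t *\<^sub>R (y - x)" for t :: real
  have l: "l t \<in> closed_segment x y" if "t \<in> {0..1}" for t
    using that by (auto simp: l_def closed_segment_def algebra_simps intro!: exI[of _ t])
  have "\<exists>t\<in>{0..1}. f (l 1) - f (l 0) = (\<lambda>h. (h *\<^sub>R (y - x)) \<bullet> G (l t)) (1 - 0)"
  proof (rule mvt_very_simple)
    fix t :: real assume "0 \<le> t" "t \<le> 1"
    then have "l t \<in> \<Omega>" using l assms by auto
    moreover have "(l has_derivative (\<lambda>h. h *\<^sub>R (y - x))) (at t within {0..1})"
      unfolding l_def by (auto intro!: derivative_eq_intros)
    ultimately show "((\<lambda>t. f (l t)) has_derivative (\<lambda>h. (h *\<^sub>R (y - x)) \<bullet> G (l t))) (at t within {0..1})"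
      using has_derivative_compose[OF _ has_derivative_f] by blast
  qed simp
  then obtain t where "t \<in> {0..1}" "f (l 1) - f (l 0) = (y - x) \<bullet> G (l t)" by auto
  then show ?thesis using l by (auto simp: l_def)
qed

lemma borel_measurable_indicator_continuous:
  fixes w :: "real^2 \<Rightarrow> 'b::euclidean_space"
  assumes "continuous_on \<Omega> w" "A \<in> sets borel" "A \<subseteq> \<Omega>"
  shows "(\<lambda>x. indicator A x *\<^sub>R w x) \<in> borel_measurable borel"
proof -
  have "(\<lambda>x. indicator \<Omega> x *\<^sub>R w x) \<in> borel_measurable borel"
    using open_\<Omega> assms(1) by (intro borel_measurable_continuous_on_indicator) auto
  then have "(\<lambda>x. indicator A x *\<^sub>R (indicator \<Omega> x *\<^sub>R w x)) \<in> borel_measurable borel"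
    by (rule borel_measurable_scaleR[rotated]) (use assms(2) in measurable)
  moreover have "indicator A x *\<^sub>R (indicator \<Omega> x *\<^sub>R w x) = indicator A x *\<^sub>R w x" for x
    using assms(3) by (auto simp: indicator_def)
  ultimately show ?thesis by (simp only:)
qed

lemma sets_level: "\<Omega> \<inter> f -` T \<in> sets borel" if "T \<in> sets borel"
proof -
  have "f \<in> borel_measurable (restrict_space borel \<Omega>)"
    by (rule borel_measurable_continuous_on_restrict[OF continuous_on_f])
  from measurable_sets[OF this that] show ?thesis
    using open_\<Omega> by (auto simp: sets_restrict_space_iff space_restrict_space Int_commute)
qed

end

section \<open>Level curves as graphs near a regular point\<close>

locale monotone_box = C2_function \<Omega> f + coordinates i j \<sigma>
  for \<Omega> :: "(real^2) set" and f :: "real^2 \<Rightarrow> real" and i j :: 2 and \<sigma> :: real +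
  fixes c d e1 e2 :: real
  assumes cd: "c < d" and e12: "e1 < e2"
    and box_subset: "P ` ({c..d} \<times> {e1..e2}) \<subseteq> \<Omega>"
    and vertical_pos: "\<And>z. z \<in> {c..d} \<times> {e1..e2} \<Longrightarrow> 0 < \<sigma> * G (P z) $ j"
begin

definition Fx :: "real \<times> real \<Rightarrow> real" where "Fx z = G (P z) $ i"
definition Fy :: "real \<times> real \<Rightarrow> real" where "Fy z = \<sigma> * G (P z) $ j"
text \<open>
  The speed \<open>\<surd>(1 + g'\<^sup>2)\<close> of the graph \<open>x \<mapsto> (x, g x)\<close> of a level curve, as \<open>g' = - F\<^sub>x/F\<^sub>y\<close>.
\<close>

definition stretch :: "real \<times> real \<Rightarrow> real" where "stretch z = sqrt (1 + (Fx z / Fy z)\<^sup>2)"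

abbreviation box where "box \<equiv> {c..d} \<times> {e1..e2}"

lemma continuous_on_FxFy: "continuous_on box Fx" "continuous_on box Fy"
proof -
  have "continuous_on box (\<lambda>z. G (P z))"
    by (rule continuous_on_compose2[OF continuous_on_G]) (use box_subset in \<open>auto intro!: continuous_intros\<close>)
  then show "continuous_on box Fx" "continuous_on box Fy"
    unfolding Fx_def[abs_def] Fy_def[abs_def] by (auto intro!: continuous_intros continuous_on_component)
qed

lemma Fy_pos: "z \<in> box \<Longrightarrow> 0 < Fy z"
  using vertical_pos by (simp add: Fy_def)

lemma continuous_on_stretch: "continuous_on box stretch"
  unfolding stretch_def[abs_def] using Fy_pos
  by (intro continuous_intros continuous_on_FxFy) force

lemma stretch_pos: "1 \<le> stretch z" by (simp add: stretch_def)

lemma norm_G_P: "norm (G (P z)) = stretch z * Fy z" if "z \<in> box"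
proof -
  have "norm (G (P z)) = sqrt ((Fx z)\<^sup>2 + (Fy z)\<^sup>2)"
    by (simp add: norm_vec2_distinct[OF ij] Fx_def Fy_def power_mult_distrib \<sigma>_square)
  also have "(Fx z)\<^sup>2 + (Fy z)\<^sup>2 = (1 + (Fx z / Fy z)\<^sup>2) * (Fy z)\<^sup>2"
    using Fy_pos[OF that] by (simp add: field_simps)
  also have "sqrt \<dots> = stretch z * Fy z"
    using Fy_pos[OF that] by (simp add: stretch_def real_sqrt_mult)
  finally show ?thesis .
qed

lemma convex_box: "convex box" by (intro convex_Times convex_real_interval)

lemma mean_value_box:
  assumes "z \<in> box" "z' \<in> box"
  shows "\<exists>\<xi>\<in>closed_segment z z'. \<xi> \<in> box \<and>
    f (P z') - f (P z) = Fx \<xi> * (fst z' - fst z) + Fy \<xi> * (snd z' - snd z)"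
proof -
  have seg: "closed_segment z z' \<subseteq> box" using assms convex_box by (rule closed_segment_subset)
  have img: "closed_segment (P z) (P z') = P ` closed_segment z z'"
    by (rule closed_segment_linear_image[OF linear_P])
  then have "closed_segment (P z) (P z') \<subseteq> \<Omega>" using seg box_subset by (metis image_mono order_trans)
  from mean_value[OF this] obtain \<xi> where \<xi>: "\<xi> \<in> closed_segment z z'"
    "f (P z') - f (P z) = (P z' - P z) \<bullet> G (P \<xi>)" using img by auto
  moreover have "(P z' - P z) \<bullet> G (P \<xi>) = Fx \<xi> * (fst z' - fst z) + Fy \<xi> * (snd z' - snd z)"
    by (simp add: inner_vec2_distinct[OF ij] Fx_def Fy_def algebra_simps)
  ultimately show ?thesis using seg by auto
qed

lemma vertical_mono:
  assumes "x \<in> {c..d}" "y \<in> {e1..e2}" "y' \<in> {e1..e2}" "y < y'"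
  shows "f (P (x, y)) < f (P (x, y'))"
proof -
  obtain \<xi> where "\<xi> \<in> box" "f (P (x, y')) - f (P (x, y)) = Fy \<xi> * (y' - y)"
    using mean_value_box[of "(x, y)" "(x, y')"] assms by auto
  then show ?thesis using Fy_pos assms(4) by (smt (verit) mult_pos_pos)
qed

end

text \<open>
  The bounds at the bottom and top edges put every level between \<open>t1\<close> and \<open>t2\<close> strictly inside the
  rectangle, so that each vertical segment meets it exactly once.
\<close>

locale level_chart = monotone_box \<Omega> f i j \<sigma> c d e1 e2
  for \<Omega> :: "(real^2) set" and f :: "real^2 \<Rightarrow> real" and i j :: 2 and \<sigma> c d e1 e2 :: real +
  fixes t1 t2 :: real
  assumes t12: "t1 < t2"
    and bottom: "\<And>x. x \<in> {c..d} \<Longrightarrow> f (P (x, e1)) < t1"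
    and top: "\<And>x. x \<in> {c..d} \<Longrightarrow> t2 < f (P (x, e2))"
begin

definition height :: "real \<Rightarrow> real \<Rightarrow> real" where
  "height x t = (THE y. y \<in> {e1..e2} \<and> f (P (x, y)) = t)"

lemma height_eqI:
  assumes "x \<in> {c..d}" "y \<in> {e1..e2}" "f (P (x, y)) = t"
  shows "height x t = y"
  unfolding height_def
proof (rule the_equality)
  fix y' assume "y' \<in> {e1..e2} \<and> f (P (x, y')) = t"
  then show "y' = y"
    using vertical_mono[of x y y'] vertical_mono[of x y' y] assms by (cases y y' rule: linorder_cases) auto
qed (use assms in auto)

lemma height:
  assumes x: "x \<in> {c..d}" and t: "t \<in> {t1..t2}"
  shows "height x t \<in> {e1<..<e2}" "f (P (x, height x t)) = t"
proof -
  have "continuous_on {e1..e2} (\<lambda>y. f (P (x, y)))"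
    by (rule continuous_on_compose2[OF continuous_on_f])
      (use box_subset x in \<open>auto intro!: continuous_intros\<close>)
  then obtain y where y: "y \<in> {e1..e2}" "f (P (x, y)) = t"
    using IVT'[of "\<lambda>y. f (P (x, y))" e1 t e2] bottom[OF x] top[OF x] t e12 by auto
  have "y \<noteq> e1" "y \<noteq> e2" using y bottom[OF x] top[OF x] t by auto
  then show "height x t \<in> {e1<..<e2}" "f (P (x, height x t)) = t"
    using height_eqI[OF x y] y by auto
qed

lemma height_in_box: "x \<in> {c..d} \<Longrightarrow> t \<in> {t1..t2} \<Longrightarrow> (x, height x t) \<in> box"
  using height(1)[of x t] by auto

text \<open>
  Joint Lipschitz continuity comes from the mean value identity
  \<open>t' - t = F\<^sub>x (x' - x) + F\<^sub>y (g(x',t') - g(x,t))\<close>, in which \<open>F\<^sub>y\<close> is bounded below on the compact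
  rectangle.
\<close>

lemma height_lipschitz:
  obtains K where "0 < K"
    "\<And>x t x' t'. x \<in> {c..d} \<Longrightarrow> x' \<in> {c..d} \<Longrightarrow> t \<in> {t1..t2} \<Longrightarrow> t' \<in> {t1..t2} \<Longrightarrow>
      \<bar>height x' t' - height x t\<bar> \<le> K * (\<bar>x' - x\<bar> + \<bar>t' - t\<bar>)"
proof -
  have comp: "compact box" by (intro compact_Times compact_Icc)
  have ne: "box \<noteq> {}" using cd e12 by auto
  obtain z0 where z0: "z0 \<in> box" "\<And>z. z \<in> box \<Longrightarrow> Fy z0 \<le> Fy z"
    using continuous_attains_inf[OF comp ne continuous_on_FxFy(2)] by blast
  obtain M where M: "\<And>z. z \<in> box \<Longrightarrow> \<bar>Fx z\<bar> \<le> M"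
    using compact_imp_bounded[OF compact_continuous_image[OF continuous_on_FxFy(1) comp]]
    by (auto simp: bounded_iff)
  define m where "m = Fy z0"
  have m: "0 < m" using Fy_pos z0(1) by (simp add: m_def)
  have M0: "0 \<le> M" using M[OF z0(1)] by simp
  show thesis
  proof (rule that[of "(M + 1) / m"])
    fix x t x' t' assume a: "x \<in> {c..d}" "x' \<in> {c..d}" "t \<in> {t1..t2}" "t' \<in> {t1..t2}"
    obtain \<xi> where \<xi>: "\<xi> \<in> box" "t' - t = Fx \<xi> * (x' - x) + Fy \<xi> * (height x' t' - height x t)"
      using mean_value_box[OF height_in_box[OF a(1,3)] height_in_box[OF a(2,4)]] height a by auto
    have "m * \<bar>height x' t' - height x t\<bar> \<le> Fy \<xi> * \<bar>height x' t' - height x t\<bar>"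
      using z0(2)[OF \<xi>(1)] by (intro mult_right_mono) (auto simp: m_def)
    also have "\<dots> = \<bar>(t' - t) - Fx \<xi> * (x' - x)\<bar>"
      using \<xi>(2) Fy_pos[OF \<xi>(1)] by (simp add: abs_mult)
    also have "\<dots> \<le> \<bar>t' - t\<bar> + \<bar>Fx \<xi>\<bar> * \<bar>x' - x\<bar>" by (simp add: abs_mult[symmetric])
    also have "\<dots> \<le> \<bar>t' - t\<bar> + M * \<bar>x' - x\<bar>" using M[OF \<xi>(1)] by (simp add: mult_right_mono)
    also have "\<dots> \<le> (M + 1) * (\<bar>x' - x\<bar> + \<bar>t' - t\<bar>)" using M0 by (simp add: algebra_simps)
    finally show "\<bar>height x' t' - height x t\<bar> \<le> (M + 1) / m * (\<bar>x' - x\<bar> + \<bar>t' - t\<bar>)"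
      using m by (simp add: field_simps)
  qed (use m M0 in auto)
qed

text \<open>
  Clamping both arguments makes the parametrisation of the level curves total and continuous on the
  whole plane, which reduces every measurability question to continuity.
\<close>

definition clamp_x where "clamp_x x = max c (min d x)"
definition clamp_t where "clamp_t t = max t1 (min t2 t)"

lemma clamp: "clamp_x x \<in> {c..d}" "clamp_t t \<in> {t1..t2}"
  "x \<in> {c..d} \<Longrightarrow> clamp_x x = x" "t \<in> {t1..t2} \<Longrightarrow> clamp_t t = t"
  using cd t12 by (auto simp: clamp_x_def clamp_t_def)

definition graph_pt :: "real \<Rightarrow> real \<Rightarrow> real \<times> real" where
  "graph_pt t x = (clamp_x x, height (clamp_x x) (clamp_t t))"

lemma graph_pt: "graph_pt t x \<in> box" "f (P (graph_pt t x)) = clamp_t t" "fst (graph_pt t x) = clamp_x x"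
  using height_in_box height clamp by (auto simp: graph_pt_def)

lemma P_graph_in: "P (graph_pt t x) \<in> \<Omega>"
  using graph_pt(1) box_subset by blast

lemma continuous_on_graph_pt: "continuous_on UNIV (\<lambda>(t, x). graph_pt t x)"
proof -
  obtain K where K: "0 < K"
    "\<And>x t x' t'. x \<in> {c..d} \<Longrightarrow> x' \<in> {c..d} \<Longrightarrow> t \<in> {t1..t2} \<Longrightarrow> t' \<in> {t1..t2} \<Longrightarrow>
      \<bar>height x' t' - height x t\<bar> \<le> K * (\<bar>x' - x\<bar> + \<bar>t' - t\<bar>)" using height_lipschitz by blast
  have 1: "continuous_on ({t1..t2} \<times> {c..d}) (\<lambda>z. height (snd z) (fst z))"
  proof (rule lipschitz_on_continuous_on, rule lipschitz_onI)
    fix z z' :: "real \<times> real" assume "z \<in> {t1..t2} \<times> {c..d}" "z' \<in> {t1..t2} \<times> {c..d}"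
    then have "dist (height (snd z) (fst z)) (height (snd z') (fst z')) \<le> K * (\<bar>snd z - snd z'\<bar> + \<bar>fst z - fst z'\<bar>)"
      by (auto simp: dist_real_def intro!: K(2))
    also have "\<bar>snd z - snd z'\<bar> + \<bar>fst z - fst z'\<bar> \<le> dist z z' + dist z z'"
      using dist_fst_le[of z z'] dist_snd_le[of z z'] by (intro add_mono) (auto simp: dist_real_def)
    finally show "dist (height (snd z) (fst z)) (height (snd z') (fst z')) \<le> (2 * K) * dist z z'"
      using K(1) by (simp add: algebra_simps)
  qed (use K in auto)
  have 2: "continuous_on UNIV (\<lambda>z. (clamp_t (fst z), clamp_x (snd z)))"
    unfolding clamp_x_def clamp_t_def by (intro continuous_intros)
  have "continuous_on UNIV (\<lambda>z. height (clamp_x (snd z)) (clamp_t (fst z)))"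
    by (rule continuous_on_compose2[OF 1 2, unfolded fst_conv snd_conv]) (use clamp(1,2) in auto)
  then show ?thesis
    unfolding graph_pt_def case_prod_unfold by (auto simp: clamp_x_def intro!: continuous_intros)
qed

lemma continuous_on_stretch_graph: "continuous_on UNIV (\<lambda>(t, x). stretch (graph_pt t x))"
  using continuous_on_compose2[OF continuous_on_stretch continuous_on_graph_pt] graph_pt(1)
  by (auto simp: case_prod_unfold)

lemma continuous_on_graph_curve:
  "continuous_on A (graph_pt t)" "continuous_on A (\<lambda>x. stretch (graph_pt t x))"
proof -
  have *: "continuous_on A (Pair t)" by (intro continuous_intros)
  show "continuous_on A (graph_pt t)" "continuous_on A (\<lambda>x. stretch (graph_pt t x))"
    using continuous_on_compose2[OF continuous_on_graph_pt *] continuous_on_compose2[OF continuous_on_stretch_graph *]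
    by auto
qed

lemma borel_measurable_graph [measurable]:
  "(\<lambda>(t, x). graph_pt t x) \<in> borel_measurable borel"
  "(\<lambda>(t, x). stretch (graph_pt t x)) \<in> borel_measurable borel"
  "graph_pt t \<in> borel_measurable borel"
  "(\<lambda>x. stretch (graph_pt t x)) \<in> borel_measurable borel"
  "(\<lambda>t. graph_pt t x) \<in> borel_measurable borel"
  "(\<lambda>t. stretch (graph_pt t x)) \<in> borel_measurable borel"
proof -
  show "(\<lambda>(t, x). graph_pt t x) \<in> borel_measurable borel"
    "(\<lambda>(t, x). stretch (graph_pt t x)) \<in> borel_measurable borel"
    using continuous_on_graph_pt continuous_on_stretch_graph by (auto intro: borel_measurable_continuous_onI)
  have *: "continuous_on UNIV (Pair t)" "continuous_on UNIV (\<lambda>t. (t, x))" by (intro continuous_intros)+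
  show "graph_pt t \<in> borel_measurable borel"
    "(\<lambda>x. stretch (graph_pt t x)) \<in> borel_measurable borel"
    "(\<lambda>t. graph_pt t x) \<in> borel_measurable borel"
    "(\<lambda>t. stretch (graph_pt t x)) \<in> borel_measurable borel"
    using continuous_on_compose2[OF continuous_on_graph_pt *(1)] continuous_on_compose2[OF continuous_on_graph_pt *(2)]
      continuous_on_compose2[OF continuous_on_stretch_graph *(1)] continuous_on_compose2[OF continuous_on_stretch_graph *(2)]
    by (auto intro: borel_measurable_continuous_onI)
qed

text \<open>
  Two points of a level curve have equal values of \<open>f\<close>; so the chord between them is orthogonal to the
  gradient at an intermediate point, which determines its slope and its length.
\<close>

lemma dist_graph:
  assumes "y \<in> {c..d}" "z \<in> {c..d}"
  shows "\<exists>\<xi>\<in>closed_segment (graph_pt t y) (graph_pt t z). \<xi> \<in> box \<and>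
    dist (P (graph_pt t y)) (P (graph_pt t z)) = stretch \<xi> * \<bar>y - z\<bar> \<and>
    snd (graph_pt t z) - snd (graph_pt t y) = - (Fx \<xi> / Fy \<xi>) * (z - y)"
proof -
  obtain \<xi> where \<xi>: "\<xi> \<in> closed_segment (graph_pt t y) (graph_pt t z)" "\<xi> \<in> box"
    "f (P (graph_pt t z)) - f (P (graph_pt t y)) =
      Fx \<xi> * (fst (graph_pt t z) - fst (graph_pt t y)) + Fy \<xi> * (snd (graph_pt t z) - snd (graph_pt t y))"
    using mean_value_box[OF graph_pt(1) graph_pt(1)] by blast
  then have "Fx \<xi> * (z - y) + Fy \<xi> * (snd (graph_pt t z) - snd (graph_pt t y)) = 0"
    using assms by (simp add: graph_pt clamp)
  then have s: "snd (graph_pt t z) - snd (graph_pt t y) = - (Fx \<xi> / Fy \<xi>) * (z - y)"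
    using Fy_pos[OF \<xi>(2)] by (simp add: field_simps)
  have "dist (P (graph_pt t y)) (P (graph_pt t z)) = norm (P (graph_pt t z - graph_pt t y))"
    by (simp add: dist_norm norm_minus_commute linear_diff[OF linear_P])
  also have "\<dots> = sqrt ((z - y)\<^sup>2 + (snd (graph_pt t z) - snd (graph_pt t y))\<^sup>2)"
    using assms by (simp add: norm_P graph_pt clamp)
  also have "(z - y)\<^sup>2 + (snd (graph_pt t z) - snd (graph_pt t y))\<^sup>2 = (1 + (Fx \<xi> / Fy \<xi>)\<^sup>2) * (z - y)\<^sup>2"
    unfolding s by (simp add: algebra_simps power2_eq_square)
  also have "sqrt \<dots> = stretch \<xi> * \<bar>y - z\<bar>"
    by (simp add: real_sqrt_mult stretch_def abs_minus_commute)
  finally show ?thesis using \<xi> s by blast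
qed

lemma near_graph:
  assumes "continuous_on box h" "x \<in> {c..d}" "0 < e"
  shows "\<exists>\<delta>>0. \<forall>y\<in>{c..d}. \<forall>z\<in>{c..d}. dist y x < \<delta> \<longrightarrow> dist z x < \<delta> \<longrightarrow>
    (\<forall>\<xi>\<in>closed_segment (graph_pt t y) (graph_pt t z). \<xi> \<in> box \<longrightarrow> dist (h \<xi>) (h (graph_pt t x)) \<le> (e::real))"
proof -
  obtain r where r: "0 < r" "\<And>\<xi>. \<xi> \<in> box \<Longrightarrow> dist \<xi> (graph_pt t x) < r \<Longrightarrow> dist (h \<xi>) (h (graph_pt t x)) < e"
    using assms graph_pt(1) unfolding continuous_on_iff by metis
  have "continuous_on UNIV (graph_pt t)" by (rule continuous_on_graph_curve)
  then obtain \<delta> where \<delta>: "0 < \<delta>" "\<And>y. dist y x < \<delta> \<Longrightarrow> dist (graph_pt t y) (graph_pt t x) < r"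
    using r(1) unfolding continuous_on_iff by (metis UNIV_I)
  show ?thesis
  proof (intro exI[of _ \<delta>] conjI ballI impI)
    fix y z \<xi> assume a: "dist y x < \<delta>" "dist z x < \<delta>" "\<xi> \<in> closed_segment (graph_pt t y) (graph_pt t z)" "\<xi> \<in> box"
    have "closed_segment (graph_pt t y) (graph_pt t z) \<subseteq> ball (graph_pt t x) r"
      using \<delta>(2)[OF a(1)] \<delta>(2)[OF a(2)] by (intro closed_segment_subset) (auto simp: dist_commute)
    then show "dist (h \<xi>) (h (graph_pt t x)) \<le> e" using a r(2)[of \<xi>] by (force simp: dist_commute)
  qed (rule \<delta>(1))
qed

lemma hausdorff1_density_graph:
  "density hausdorff1 (indicator ((\<lambda>x. P (graph_pt t x)) ` {c..d})) =
    distr (density lborel (\<lambda>x. ennreal (stretch (graph_pt t x) * indicator {c..d} x))) borel (\<lambda>x. P (graph_pt t x))"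
proof -
  have comp: "compact box" by (intro compact_Times compact_Icc)
  obtain M where M: "\<And>z. z \<in> box \<Longrightarrow> \<bar>stretch z\<bar> \<le> M"
    using compact_imp_bounded[OF compact_continuous_image[OF continuous_on_stretch comp]]
    by (auto simp: bounded_iff)
  show ?thesis
  proof (rule hausdorff1_density_curve[where \<pi> = "\<lambda>v. v $ i" and C = M])
    show "continuous_on {c..d} (\<lambda>x. stretch (graph_pt t x))" by (rule continuous_on_graph_curve)
    show "0 < stretch (graph_pt t x)" for x using stretch_pos[of "graph_pt t x"] by linarith
    show "dist (P (graph_pt t y)) (P (graph_pt t z)) \<le> M * \<bar>y - z\<bar>"
      if yz: "y \<in> {c..d}" "z \<in> {c..d}" for y z
    proof -
      obtain \<xi> where "\<xi> \<in> box" "dist (P (graph_pt t y)) (P (graph_pt t z)) = stretch \<xi> * \<bar>y - z\<bar>"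
        using dist_graph[OF yz] by blast
      then show ?thesis using M[of \<xi>] by (simp add: mult_right_mono)
    qed
    show "\<exists>\<delta>>0. \<forall>y\<in>{c..d}. \<forall>z\<in>{c..d}. dist y x < \<delta> \<longrightarrow> dist z x < \<delta> \<longrightarrow>
      \<bar>dist (P (graph_pt t y)) (P (graph_pt t z)) - stretch (graph_pt t x) * \<bar>y - z\<bar>\<bar> \<le> e * \<bar>y - z\<bar>"
      if x: "x \<in> {c..d}" "0 < e" for x e
    proof -
      obtain \<delta> where \<delta>: "0 < \<delta>" "\<And>y z \<xi>. y \<in> {c..d} \<Longrightarrow> z \<in> {c..d} \<Longrightarrow> dist y x < \<delta> \<Longrightarrow> dist z x < \<delta> \<Longrightarrow>
        \<xi> \<in> closed_segment (graph_pt t y) (graph_pt t z) \<Longrightarrow> \<xi> \<in> box \<Longrightarrow>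
        dist (stretch \<xi>) (stretch (graph_pt t x)) \<le> e"
        using near_graph[OF continuous_on_stretch x, of t] by blast
      show ?thesis
      proof (intro exI[of _ \<delta>] conjI ballI impI)
        fix y z assume a: "y \<in> {c..d}" "z \<in> {c..d}" "dist y x < \<delta>" "dist z x < \<delta>"
        obtain \<xi> where \<xi>: "\<xi> \<in> closed_segment (graph_pt t y) (graph_pt t z)" "\<xi> \<in> box"
          "dist (P (graph_pt t y)) (P (graph_pt t z)) = stretch \<xi> * \<bar>y - z\<bar>"
          using dist_graph[OF a(1,2)] by blast
        have "\<bar>stretch \<xi> * \<bar>y - z\<bar> - stretch (graph_pt t x) * \<bar>y - z\<bar>\<bar> = \<bar>stretch \<xi> - stretch (graph_pt t x)\<bar> * \<bar>y - z\<bar>"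
          by (simp add: left_diff_distrib[symmetric] abs_mult)
        also have "\<dots> \<le> e * \<bar>y - z\<bar>"
          using \<delta>(2)[OF a \<xi>(1,2)] by (intro mult_right_mono) (auto simp: dist_real_def)
        finally show "\<bar>dist (P (graph_pt t y)) (P (graph_pt t z)) - stretch (graph_pt t x) * \<bar>y - z\<bar>\<bar> \<le> e * \<bar>y - z\<bar>"
          using \<xi>(3) by simp
      qed (rule \<delta>(1))
    qed
    show "(\<lambda>x. P (graph_pt t x)) \<in> borel_measurable borel" by measurable
    show "(\<lambda>v. v $ i) \<in> borel_measurable borel"
      by (intro borel_measurable_continuous_onI continuous_on_component continuous_on_id)
  qed (use cd in \<open>auto simp: graph_pt clamp\<close>)
qed

definition chart_dom :: "(real^2) set" where
  "chart_dom = {p \<in> \<Omega>. c < p $ i \<and> p $ i < d \<and> e1 < \<sigma> * p $ j \<and> \<sigma> * p $ j < e2 \<and> t1 < f p \<and> f p < t2}"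

lemma open_chart_dom: "open chart_dom"
proof -
  have "continuous_on \<Omega> (\<lambda>p. (p $ i, \<sigma> * p $ j, f p))"
    by (intro continuous_intros continuous_on_component continuous_on_f)
  from continuous_open_preimage[OF this open_\<Omega>, of "{c<..<d} \<times> {e1<..<e2} \<times> {t1<..<t2}"]
  have "open (\<Omega> \<inter> (\<lambda>p. (p $ i, \<sigma> * p $ j, f p)) -` ({c<..<d} \<times> {e1<..<e2} \<times> {t1<..<t2}))"
    by (simp add: open_Times)
  also have "\<dots> = chart_dom" by (auto simp: chart_dom_def)
  finally show ?thesis .
qed

lemma sets_chart_dom [measurable]: "chart_dom \<in> sets borel"
  using open_chart_dom by simp

lemma chart_dom_subset: "chart_dom \<subseteq> \<Omega>" by (auto simp: chart_dom_def)

lemma chart_dom_regular: "p \<in> chart_dom \<Longrightarrow> G p \<noteq> 0"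
proof
  assume p: "p \<in> chart_dom" "G p = 0"
  then have "(p $ i, \<sigma> * p $ j) \<in> box" by (auto simp: chart_dom_def)
  from vertical_pos[OF this] show False using p P_inverse[of p] by simp
qed

lemma level_in_chart:
  assumes t: "t \<in> {t1..t2}" and p: "p \<in> chart_dom"
  shows "f p = t \<longleftrightarrow> p \<in> (\<lambda>x. P (graph_pt t x)) ` {c..d}"
proof
  assume ft: "f p = t"
  have x: "p $ i \<in> {c..d}" "\<sigma> * p $ j \<in> {e1..e2}" using p by (auto simp: chart_dom_def)
  then have "height (p $ i) t = \<sigma> * p $ j" using ft P_inverse[of p] by (intro height_eqI) auto
  then have "p = P (graph_pt t (p $ i))" using x t P_inverse[of p] by (simp add: graph_pt_def clamp)
  then show "p \<in> (\<lambda>x. P (graph_pt t x)) ` {c..d}" using x by blast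
qed (use t in \<open>auto simp: graph_pt clamp\<close>)

lemma nn_integral_level:
  assumes t: "t \<in> {t1..t2}" and [measurable]: "\<phi> \<in> borel_measurable borel"
  shows "(\<integral>\<^sup>+z. \<phi> z * indicator (chart_dom \<inter> f -` {t}) z \<partial>hausdorff1) =
    (\<integral>\<^sup>+x. \<phi> (P (graph_pt t x)) * indicator chart_dom (P (graph_pt t x)) *
      ennreal (stretch (graph_pt t x)) * indicator {c..d} x \<partial>lborel)"
proof -
  let ?\<Gamma> = "(\<lambda>x. P (graph_pt t x)) ` {c..d}"
  have "compact ?\<Gamma>"
    by (intro compact_continuous_image continuous_on_P continuous_on_graph_curve) auto
  then have [measurable]: "?\<Gamma> \<in> sets borel" by (intro borel_closed compact_imp_closed)
  have "(\<integral>\<^sup>+z. \<phi> z * indicator (chart_dom \<inter> f -` {t}) z \<partial>hausdorff1) =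
    (\<integral>\<^sup>+z. indicator ?\<Gamma> z * (\<phi> z * indicator chart_dom z) \<partial>hausdorff1)"
    using level_in_chart[OF t] by (intro nn_integral_cong) (auto simp: indicator_def)
  also have "\<dots> = (\<integral>\<^sup>+z. \<phi> z * indicator chart_dom z \<partial>density hausdorff1 (indicator ?\<Gamma>))"
    by (subst nn_integral_density) auto
  also have "\<dots> = (\<integral>\<^sup>+x. \<phi> (P (graph_pt t x)) * indicator chart_dom (P (graph_pt t x))
      \<partial>density lborel (\<lambda>x. ennreal (stretch (graph_pt t x) * indicator {c..d} x)))"
    unfolding hausdorff1_density_graph by (subst nn_integral_distr) simp_all
  also have "\<dots> = (\<integral>\<^sup>+x. ennreal (stretch (graph_pt t x) * indicator {c..d} x) *
      (\<phi> (P (graph_pt t x)) * indicator chart_dom (P (graph_pt t x))) \<partial>lborel)"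
    by (subst nn_integral_density) simp_all
  also have "\<dots> = (\<integral>\<^sup>+x. \<phi> (P (graph_pt t x)) * indicator chart_dom (P (graph_pt t x)) *
      ennreal (stretch (graph_pt t x)) * indicator {c..d} x \<partial>lborel)"
    by (intro nn_integral_cong) (auto simp: indicator_def mult_ac)
  finally show ?thesis .
qed

lemma integral_level:
  fixes w :: "real^2 \<Rightarrow> real"
  assumes t: "t \<in> {t1..t2}" and w: "(\<lambda>z. indicator chart_dom z *\<^sub>R w z) \<in> borel_measurable borel"
  shows "(\<integral>z. indicator (chart_dom \<inter> f -` {t}) z *\<^sub>R w z \<partial>hausdorff1) =
    (\<integral>x. indicator {c..d} x *\<^sub>R (stretch (graph_pt t x) * (indicator chart_dom (P (graph_pt t x)) * w (P (graph_pt t x)))) \<partial>lborel)"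
proof -
  note w[measurable]
  let ?\<Gamma> = "(\<lambda>x. P (graph_pt t x)) ` {c..d}"
  have "compact ?\<Gamma>"
    by (intro compact_continuous_image continuous_on_P continuous_on_graph_curve) auto
  then have [measurable]: "?\<Gamma> \<in> sets borel" by (intro borel_closed compact_imp_closed)
  have "(\<integral>z. indicator (chart_dom \<inter> f -` {t}) z *\<^sub>R w z \<partial>hausdorff1) =
    (\<integral>z. indicator ?\<Gamma> z *\<^sub>R (indicator chart_dom z *\<^sub>R w z) \<partial>hausdorff1)"
    using level_in_chart[OF t] by (intro Bochner_Integration.integral_cong) (auto simp: indicator_def)
  also have "\<dots> = (\<integral>z. indicator chart_dom z *\<^sub>R w z \<partial>density hausdorff1 (\<lambda>z. ennreal (indicator ?\<Gamma> z)))"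
  proof (subst integral_density)
    show "(\<lambda>z. indicator chart_dom z *\<^sub>R w z) \<in> borel_measurable hausdorff1"
      using w by (simp only: measurable_cong_sets[OF sets_hausdorff1 refl])
  qed auto
  also have "\<dots> = (\<integral>x. indicator chart_dom (P (graph_pt t x)) *\<^sub>R w (P (graph_pt t x))
      \<partial>density lborel (\<lambda>x. ennreal (stretch (graph_pt t x) * indicator {c..d} x)))"
    unfolding ennreal_indicator hausdorff1_density_graph
  proof (subst integral_distr)
    show "(\<lambda>z. indicator chart_dom z *\<^sub>R w z) \<in> borel_measurable borel" by (rule w)
  qed simp_all
  also have "\<dots> = (\<integral>x. (stretch (graph_pt t x) * indicator {c..d} x) *\<^sub>R
      (indicator chart_dom (P (graph_pt t x)) *\<^sub>R w (P (graph_pt t x))) \<partial>lborel)"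
  proof (subst integral_density)
    show "(\<lambda>x. indicator chart_dom (P (graph_pt t x)) *\<^sub>R w (P (graph_pt t x))) \<in> borel_measurable lborel"
      using measurable_compose[of "\<lambda>x. P (graph_pt t x)" borel borel, OF _ w] by simp
    show "AE x in lborel. 0 \<le> stretch (graph_pt t x) * indicator {c..d} x"
      by (intro AE_I2 mult_nonneg_nonneg order_trans[OF zero_le_one stretch_pos]) auto
  qed simp_all
  also have "\<dots> = (\<integral>x. indicator {c..d} x *\<^sub>R (stretch (graph_pt t x) * (indicator chart_dom (P (graph_pt t x)) * w (P (graph_pt t x)))) \<partial>lborel)"
    by (intro Bochner_Integration.integral_cong) (auto simp: indicator_def mult_ac)
  finally show ?thesis .
qed

text \<open>
  In the coordinates \<open>(x,y)\<close> the area integral is iterated, with inner variable \<open>y\<close>.  The substitution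
  \<open>t = f(x,y)\<close> costs the factor \<open>F\<^sub>y\<close>, and \<open>|\<nabla>f| = stretch \<cdot> F\<^sub>y\<close> leaves exactly the arc length density
  of the level curves; exchanging the integrals produces the integral over \<open>t\<close> of the level integrals.
\<close>

lemma coarea_chart:
  assumes \<phi>[measurable]: "\<phi> \<in> borel_measurable borel"
  shows "(\<lambda>t. \<integral>\<^sup>+z. \<phi> z * indicator (chart_dom \<inter> f -` {t}) z \<partial>hausdorff1) \<in> borel_measurable borel"
    and "(\<integral>\<^sup>+z. \<phi> z * ennreal (norm (G z)) * indicator chart_dom z \<partial>lborel) =
      (\<integral>\<^sup>+t. \<integral>\<^sup>+z. \<phi> z * indicator (chart_dom \<inter> f -` {t}) z \<partial>hausdorff1 \<partial>lborel)"
proof -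
  define \<psi> where "\<psi> z = \<phi> z * indicator chart_dom z" for z
  have \<psi>[measurable]: "\<psi> \<in> borel_measurable borel" unfolding \<psi>_def by measurable
  define k where "k x t = \<psi> (P (graph_pt t x)) * ennreal (stretch (graph_pt t x)) *
    indicator {t1<..<t2} t * indicator {c..d} x" for x t
  have graph_swap: "(\<lambda>(x, t). graph_pt t x) \<in> borel_measurable borel"
    "(\<lambda>(x, t). stretch (graph_pt t x)) \<in> borel_measurable borel"
  proof -
    have *: "continuous_on UNIV (\<lambda>z :: real \<times> real. (snd z, fst z))" by (intro continuous_intros)
    show "(\<lambda>(x, t). graph_pt t x) \<in> borel_measurable borel"
      "(\<lambda>(x, t). stretch (graph_pt t x)) \<in> borel_measurable borel"
      using continuous_on_compose2[OF continuous_on_graph_pt *] continuous_on_compose2[OF continuous_on_stretch_graph *]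
      by (auto intro!: borel_measurable_continuous_onI simp: case_prod_unfold)
  qed
  have k[measurable]: "case_prod k \<in> borel_measurable (lborel \<Otimes>\<^sub>M lborel)"
  proof -
    have [measurable]: "(\<lambda>z. graph_pt (snd z) (fst z)) \<in> borel_measurable (lborel \<Otimes>\<^sub>M lborel)"
      "(\<lambda>z. stretch (graph_pt (snd z) (fst z))) \<in> borel_measurable (lborel \<Otimes>\<^sub>M lborel)"
      using graph_swap by (simp_all add: lborel_prod case_prod_unfold)
    show ?thesis unfolding k_def case_prod_unfold by measurable
  qed
  have inner: "(\<integral>\<^sup>+z. \<phi> z * indicator (chart_dom \<inter> f -` {t}) z \<partial>hausdorff1) = (\<integral>\<^sup>+x. k x t \<partial>lborel)" for t
  proof (cases "t \<in> {t1<..<t2}")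
    case True
    then have "t \<in> {t1..t2}" by simp
    from nn_integral_level[OF this \<phi>] show ?thesis
      using True by (simp add: k_def \<psi>_def)
  next
    case False
    then have "chart_dom \<inter> f -` {t} = {}" by (auto simp: chart_dom_def)
    then show ?thesis using False by (simp add: k_def)
  qed
  show "(\<lambda>t. \<integral>\<^sup>+z. \<phi> z * indicator (chart_dom \<inter> f -` {t}) z \<partial>hausdorff1) \<in> borel_measurable borel"
  proof -
    have "case_prod (\<lambda>t x. k x t) \<in> borel_measurable (lborel \<Otimes>\<^sub>M lborel)"
      using measurable_compose[OF measurable_pair_swap' k] by (simp add: case_prod_unfold)
    from lborel.borel_measurable_nn_integral[OF this] show ?thesis
      unfolding inner by simp
  qed
  have [measurable]: "(\<lambda>z. indicator chart_dom z *\<^sub>R norm (G z)) \<in> borel_measurable borel"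
    using chart_dom_subset
    by (intro borel_measurable_indicator_continuous continuous_on_norm continuous_on_G) auto
  (* the inner integral for fixed x, by substitution in one variable *)
  have slice: "(\<integral>\<^sup>+y. \<psi> (P (x, y)) * ennreal (indicator chart_dom (P (x, y)) *\<^sub>R norm (G (P (x, y)))) \<partial>lborel)
      = (\<integral>\<^sup>+t. k x t \<partial>lborel)" for x
  proof (cases "x \<in> {c..d}")
    case False
    have "\<psi> (P (x, y)) = 0" for y using False by (auto simp: \<psi>_def chart_dom_def)
    then show ?thesis using False by (simp add: k_def)
  next
    case x: True
    define g where "g y = f (P (x, y))" for y
    have gT: "g e1 < t1" "t2 < g e2" using bottom[OF x] top[OF x] by (auto simp: g_def)
    have kx: "k x \<in> borel_measurable borel" unfolding k_def[abs_def] by measurable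
    have "(\<integral>\<^sup>+t. k x t \<partial>lborel) = (\<integral>\<^sup>+t. k x t * indicator {g e1..g e2} t \<partial>lborel)"
      using gT by (intro nn_integral_cong) (auto simp: k_def indicator_def)
    also have "\<dots> = (\<integral>\<^sup>+y. k x (g y) * ennreal (Fy (x, y)) * indicator {e1..e2} y \<partial>lborel)"
    proof (rule nn_integral_substitution_aux[OF kx _ _ _ _ e12])
      fix y assume y: "y \<in> {e1..e2}"
      then have "P (x, y) \<in> \<Omega>" using x box_subset by auto
      moreover have "((\<lambda>y. P (x, y)) has_derivative (\<lambda>h. P (0, h))) (at y)"
        using linear_P by (intro bounded_linear.has_derivative[of P])
          (auto simp: linear_conv_bounded_linear intro!: derivative_eq_intros)
      ultimately have "(g has_derivative (\<lambda>h. P (0, h) \<bullet> G (P (x, y)))) (at y)"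
        unfolding g_def using has_derivative_compose[OF _ has_derivative_f] by blast
      also have "(\<lambda>h. P (0, h) \<bullet> G (P (x, y))) = (*) (Fy (x, y))"
        by (auto simp: inner_vec2_distinct[OF ij] Fy_def)
      finally show "(g has_real_derivative Fy (x, y)) (at y)"
        by (simp add: has_field_derivative_def)
      show "0 \<le> Fy (x, y)" using Fy_pos[of "(x, y)"] x y by auto
    next
      show "continuous_on {e1..e2} (\<lambda>y. Fy (x, y))"
        by (rule continuous_on_compose2[OF continuous_on_FxFy(2)]) (use x in \<open>auto intro!: continuous_intros\<close>)
    qed simp
    also have "\<dots> = (\<integral>\<^sup>+y. \<psi> (P (x, y)) * ennreal (indicator chart_dom (P (x, y)) *\<^sub>R norm (G (P (x, y)))) \<partial>lborel)"
    proof (rule nn_integral_cong)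
      fix y
      show "k x (g y) * ennreal (Fy (x, y)) * indicator {e1..e2} y =
        \<psi> (P (x, y)) * ennreal (indicator chart_dom (P (x, y)) *\<^sub>R norm (G (P (x, y))))"
      proof (cases "P (x, y) \<in> chart_dom")
        case True
        then have y: "y \<in> {e1..e2}" and gy: "g y \<in> {t1<..<t2}"
          by (auto simp: chart_dom_def g_def \<sigma>_square)
        have h: "height x (g y) = y" using height_eqI[OF x y] by (simp add: g_def)
        have "graph_pt (g y) x = (x, y)" using x gy h by (simp add: graph_pt_def clamp)
        moreover have "ennreal (stretch (x, y)) * ennreal (Fy (x, y)) = ennreal (norm (G (P (x, y))))"
          using norm_G_P[of "(x, y)"] x y Fy_pos[of "(x, y)"] stretch_pos[of "(x, y)"]
          by (simp add: ennreal_mult)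
        ultimately show ?thesis using True x y gy by (simp add: k_def mult.assoc)
      next
        case False
        have "k x (g y) = 0" if y: "y \<in> {e1..e2}"
        proof (cases "g y \<in> {t1<..<t2}")
          case True
          have h: "height x (g y) = y" using height_eqI[OF x y] by (simp add: g_def)
          have "graph_pt (g y) x = (x, y)" using x True h by (simp add: graph_pt_def clamp)
          then show ?thesis using False by (simp add: k_def \<psi>_def)
        qed (simp add: k_def)
        then show ?thesis using False by (auto simp: indicator_def)
      qed
    qed
    finally show ?thesis by simp
  qed
  have "(\<integral>\<^sup>+z. \<phi> z * ennreal (norm (G z)) * indicator chart_dom z \<partial>lborel) =
      (\<integral>\<^sup>+z. \<psi> z * ennreal (indicator chart_dom z *\<^sub>R norm (G z)) \<partial>lborel)"
    by (intro nn_integral_cong) (auto simp: \<psi>_def indicator_def)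
  also have "\<dots> = (\<integral>\<^sup>+x. \<integral>\<^sup>+t. k x t \<partial>lborel \<partial>lborel)"
    by (subst nn_integral_P) (simp_all only: slice, measurable)
  also have "\<dots> = (\<integral>\<^sup>+t. \<integral>\<^sup>+x. k x t \<partial>lborel \<partial>lborel)"
    by (rule lborel_pair.Fubini'[symmetric, OF k])
  finally show "(\<integral>\<^sup>+z. \<phi> z * ennreal (norm (G z)) * indicator chart_dom z \<partial>lborel) =
      (\<integral>\<^sup>+t. \<integral>\<^sup>+z. \<phi> z * indicator (chart_dom \<inter> f -` {t}) z \<partial>hausdorff1 \<partial>lborel)"
    by (simp only: inner)
qed

text \<open>
  Between \<open>t1\<close> and \<open>t2\<close> this is a parameter integral with jointly continuous integrand.  A level at or
  beyond these bounds misses the chart domain, so the function vanishes there, and the pieces match.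
\<close>

lemma continuous_level_integral_chart:
  fixes w :: "real^2 \<Rightarrow> real"
  assumes w: "continuous_on \<Omega> w" and zero: "\<And>z. z \<in> \<Omega> \<Longrightarrow> z \<notin> chart_dom \<Longrightarrow> w z = 0"
  shows "continuous_on UNIV (\<lambda>t. LINT z:\<Omega> \<inter> f -` {t}|hausdorff1. w z)"
proof -
  define A where "A t = (LINT z:\<Omega> \<inter> f -` {t}|hausdorff1. w z)" for t
  have Aeq: "A t = (\<integral>z. indicator (chart_dom \<inter> f -` {t}) z *\<^sub>R w z \<partial>hausdorff1)" for t
    unfolding A_def set_lebesgue_integral_def
    using zero chart_dom_subset by (intro Bochner_Integration.integral_cong) (auto simp: indicator_def)
  have wP: "continuous_on ({t1..t2} \<times> cbox c d) (\<lambda>(t, x). stretch (graph_pt t x) * w (P (graph_pt t x)))"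
  proof -
    have 1: "continuous_on ({t1..t2} \<times> cbox c d) (\<lambda>(t, x). stretch (graph_pt t x))"
      "continuous_on ({t1..t2} \<times> cbox c d) (\<lambda>(t, x). graph_pt t x)"
      using continuous_on_stretch_graph continuous_on_graph_pt by (auto intro: continuous_on_subset)
    have "continuous_on ({t1..t2} \<times> cbox c d) (\<lambda>z. w (P ((\<lambda>(t, x). graph_pt t x) z)))"
      by (rule continuous_on_compose2[OF w continuous_on_P[OF 1(2)]])
        (auto simp: P_graph_in)
    from continuous_on_mult[OF 1(1) this] show ?thesis by (simp add: case_prod_unfold)
  qed
  have At: "A t = integral (cbox c d) (\<lambda>x. stretch (graph_pt t x) * w (P (graph_pt t x)))"
    if t: "t \<in> {t1..t2}" for t
  proof -
    have c1: "continuous_on {c..d} (\<lambda>x. stretch (graph_pt t x) * w (P (graph_pt t x)))"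
      by (rule continuous_on_compose2[OF wP, of "{c..d}" "Pair t", unfolded prod.case])
        (use t in \<open>auto intro!: continuous_intros\<close>)
    have "A t = (\<integral>x. indicator {c..d} x *\<^sub>R (stretch (graph_pt t x) * (indicator chart_dom (P (graph_pt t x)) * w (P (graph_pt t x)))) \<partial>lborel)"
      unfolding Aeq using chart_dom_subset
      by (intro integral_level[OF t] borel_measurable_indicator_continuous w) auto
    also have "\<dots> = (LINT x:{c..d}|lborel. stretch (graph_pt t x) * w (P (graph_pt t x)))"
      unfolding set_lebesgue_integral_def
      using zero P_graph_in
      by (intro Bochner_Integration.integral_cong) (auto simp: indicator_def)
    also have "\<dots> = integral {c..d} (\<lambda>x. stretch (graph_pt t x) * w (P (graph_pt t x)))"
      by (rule set_borel_integral_eq_integral(2)[OF borel_integrable_atLeastAtMost'[OF c1]])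
    finally show ?thesis by simp
  qed
  have cA: "continuous_on {t1..t2} A"
    using integral_continuous_on_param[OF wP] by (rule continuous_on_eq) (simp add: At)
  have zero_out: "A t = 0" if "t \<notin> {t1<..<t2}" for t
  proof -
    have "chart_dom \<inter> f -` {t} = {}" using that by (auto simp: chart_dom_def)
    then show ?thesis by (simp add: Aeq)
  qed
  have "A (clamp_t t) = A t" for t
    using zero_out t12 by (cases "t \<in> {t1..t2}") (auto simp: clamp_t_def max_def min_def)
  moreover have "continuous_on UNIV (\<lambda>t. A (clamp_t t))"
    by (rule continuous_on_compose2[OF cA]) (use clamp in \<open>auto simp: clamp_t_def intro!: continuous_intros\<close>)
  ultimately show ?thesis by (simp add: A_def)
qed

end

section \<open>The coarea formula on the set of regular points\<close>

context C2_function
begin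

definition regular :: "(real^2) set" where "regular = {x \<in> \<Omega>. G x \<noteq> 0}"

lemma regular_subset: "regular \<subseteq> \<Omega>" by (auto simp: regular_def)

lemma open_regular: "open regular"
proof -
  have "open (\<Omega> \<inter> G -` (- {0}))"
    by (rule continuous_open_preimage[OF continuous_on_G open_\<Omega>]) auto
  moreover have "\<Omega> \<inter> G -` (- {0}) = regular" by (auto simp: regular_def)
  ultimately show ?thesis by simp
qed

text \<open>
  Around a point where the partial derivative in place \<open>j\<close> is nonzero, choose a square on which it keeps
  its sign.  The values of \<open>f\<close> at the midpoints of the horizontal edges lie on either side of \<open>f p\<close>, and
  by continuity they stay separated along the edges once the square is made narrow enough.
\<close>

lemma chart_exists:
  assumes "p \<in> regular"
  shows "\<exists>i j \<sigma> c d e1 e2 t1 t2. level_chart \<Omega> f i j \<sigma> c d e1 e2 t1 t2 \<and>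
    p \<in> level_chart.chart_dom \<Omega> f i j \<sigma> c d e1 e2 t1 t2"
proof -
  have p: "p \<in> \<Omega>" "G p \<noteq> 0" using assms by (auto simp: regular_def)
  then obtain j where j: "G p $ j \<noteq> 0" by (auto simp: vec_eq_iff)
  obtain i :: 2 where ij: "i \<noteq> j" by (metis zero_neq_one)
  define \<sigma> :: real where "\<sigma> = (if G p $ j > 0 then 1 else -1)"
  interpret coordinates i j \<sigma> using ij by unfold_locales (simp_all add: \<sigma>_def)
  define W where "W = {z \<in> \<Omega>. 0 < \<sigma> * G z $ j}"
  have "open (\<Omega> \<inter> (\<lambda>z. \<sigma> * G z $ j) -` {0<..})"
    by (intro continuous_open_preimage open_\<Omega> continuous_intros continuous_on_component continuous_on_G)
  moreover have "\<Omega> \<inter> (\<lambda>z. \<sigma> * G z $ j) -` {0<..} = W" by (auto simp: W_def)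
  ultimately have "open W" by simp
  then have "open (P -` W)"
    by (rule open_vimage) (rule continuous_on_P[OF continuous_on_id])
  define x0 where "x0 = p $ i" define y0 where "y0 = \<sigma> * p $ j"
  have p0: "P (x0, y0) = p" by (simp add: x0_def y0_def P_inverse)
  have "p \<in> W" using p j by (auto simp: W_def \<sigma>_def)
  then have "(x0, y0) \<in> P -` W" by (simp add: p0)
  then obtain r where r: "0 < r" "ball (x0, y0) r \<subseteq> P -` W"
    using \<open>open (P -` W)\<close> open_contains_ball by blast
  define \<rho> where "\<rho> = r / 3"
  have \<rho>: "0 < \<rho>" using r by (simp add: \<rho>_def)
  have boxW: "P z \<in> W" if "z \<in> {x0 - \<rho>..x0 + \<rho>} \<times> {y0 - \<rho>..y0 + \<rho>}" for z
  proof -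
    have "dist (x0, y0) z \<le> \<bar>x0 - fst z\<bar> + \<bar>y0 - snd z\<bar>"
      by (cases z) (simp add: dist_Pair_Pair dist_real_def sqrt_sum_squares_le_sum_abs)
    also have "\<dots> < r" using that r(1) by (auto simp: \<rho>_def abs_le_iff)
    finally show ?thesis using r(2) by auto
  qed
  interpret B: monotone_box \<Omega> f i j \<sigma> "x0 - \<rho>" "x0 + \<rho>" "y0 - \<rho>" "y0 + \<rho>"
    using \<rho> boxW by unfold_locales (auto simp: W_def)
  define t1 where "t1 = (f (P (x0, y0 - \<rho>)) + f p) / 2"
  define t2 where "t2 = (f (P (x0, y0 + \<rho>)) + f p) / 2"
  have t: "f (P (x0, y0 - \<rho>)) < t1" "t1 < f p" "f p < t2" "t2 < f (P (x0, y0 + \<rho>))"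
    using B.vertical_mono[of x0 "y0 - \<rho>" y0] B.vertical_mono[of x0 y0 "y0 + \<rho>"] \<rho>
    by (auto simp: t1_def t2_def p0)
  have cont: "continuous_on {x0 - \<rho>..x0 + \<rho>} (\<lambda>x. f (P (x, y)))" if "y \<in> {y0 - \<rho>..y0 + \<rho>}" for y
    by (rule continuous_on_compose2[OF continuous_on_f]) (use B.box_subset that in \<open>auto intro!: continuous_intros\<close>)
  have near: "\<exists>\<delta>>0. \<forall>x\<in>{x0 - \<rho>..x0 + \<rho>}. dist x x0 < \<delta> \<longrightarrow> dist (f (P (x, y))) (f (P (x0, y))) < e"
    if "y \<in> {y0 - \<rho>..y0 + \<rho>}" "0 < e" for y e
  proof -
    have "x0 \<in> {x0 - \<rho>..x0 + \<rho>}" using \<rho> by simp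
    then show ?thesis using cont[OF that(1)] that(2) unfolding continuous_on_iff by blast
  qed
  obtain \<delta>1 where \<delta>1: "0 < \<delta>1" "\<And>x. x \<in> {x0 - \<rho>..x0 + \<rho>} \<Longrightarrow> dist x x0 < \<delta>1 \<Longrightarrow>
      dist (f (P (x, y0 - \<rho>))) (f (P (x0, y0 - \<rho>))) < t1 - f (P (x0, y0 - \<rho>))"
    using near[of "y0 - \<rho>" "t1 - f (P (x0, y0 - \<rho>))"] \<rho> t(1) by auto
  obtain \<delta>2 where \<delta>2: "0 < \<delta>2" "\<And>x. x \<in> {x0 - \<rho>..x0 + \<rho>} \<Longrightarrow> dist x x0 < \<delta>2 \<Longrightarrow>
      dist (f (P (x, y0 + \<rho>))) (f (P (x0, y0 + \<rho>))) < f (P (x0, y0 + \<rho>)) - t2"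
    using near[of "y0 + \<rho>" "f (P (x0, y0 + \<rho>)) - t2"] \<rho> t(4) by auto
  define \<delta> where "\<delta> = min \<rho> (min \<delta>1 \<delta>2) / 2"
  have \<delta>: "0 < \<delta>" "\<delta> < \<rho>" "\<delta> < \<delta>1" "\<delta> < \<delta>2" using \<rho> \<delta>1 \<delta>2 by (auto simp: \<delta>_def)
  have "level_chart \<Omega> f i j \<sigma> (x0 - \<delta>) (x0 + \<delta>) (y0 - \<rho>) (y0 + \<rho>) t1 t2"
  proof unfold_locales
    show "P ` ({x0 - \<delta>..x0 + \<delta>} \<times> {y0 - \<rho>..y0 + \<rho>}) \<subseteq> \<Omega>"
      using boxW \<delta> by (force simp: W_def)
    show "0 < \<sigma> * G (P z) $ j" if "z \<in> {x0 - \<delta>..x0 + \<delta>} \<times> {y0 - \<rho>..y0 + \<rho>}" for z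
      using boxW[of z] that \<delta> by (cases z) (auto simp: W_def)
    fix x assume "x \<in> {x0 - \<delta>..x0 + \<delta>}"
    then have x: "x \<in> {x0 - \<rho>..x0 + \<rho>}" "dist x x0 < \<delta>1" "dist x x0 < \<delta>2"
      using \<delta> by (auto simp: dist_real_def)
    show "f (P (x, y0 - \<rho>)) < t1" using \<delta>1(2)[OF x(1,2)] by (auto simp: dist_real_def)
    show "t2 < f (P (x, y0 + \<rho>))" using \<delta>2(2)[OF x(1,3)] by (auto simp: dist_real_def)
  qed (use \<delta> \<rho> t in auto)
  moreover from this interpret L: level_chart \<Omega> f i j \<sigma> "x0 - \<delta>" "x0 + \<delta>" "y0 - \<rho>" "y0 + \<rho>" t1 t2 .
  have "p \<in> L.chart_dom"
    unfolding L.chart_dom_def using p t \<delta> \<rho> by (auto simp: x0_def y0_def)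
  ultimately show ?thesis by blast
qed

text \<open>
  Charts cover the regular points, countably many suffice by Lindelof's theorem, and the domains can be
  made disjoint because the formula in a chart allows an arbitrary measurable weight.
\<close>

theorem coarea:
  assumes \<phi>[measurable]: "\<phi> \<in> borel_measurable borel"
  shows "(\<lambda>t. \<integral>\<^sup>+z. \<phi> z * indicator (regular \<inter> f -` {t}) z \<partial>hausdorff1) \<in> borel_measurable borel"
    and "(\<integral>\<^sup>+z. \<phi> z * ennreal (norm (G z)) * indicator regular z \<partial>lborel) =
      (\<integral>\<^sup>+t. \<integral>\<^sup>+z. \<phi> z * indicator (regular \<inter> f -` {t}) z \<partial>hausdorff1 \<partial>lborel)"
proof -
  define coarea_on where "coarea_on U \<longleftrightarrow> open U \<and> U \<subseteq> regular \<and> (\<forall>\<phi>\<in>borel_measurable borel.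
    (\<lambda>t. \<integral>\<^sup>+z. \<phi> z * indicator (U \<inter> f -` {t}) z \<partial>hausdorff1) \<in> borel_measurable borel \<and>
    (\<integral>\<^sup>+z. \<phi> z * ennreal (norm (G z)) * indicator U z \<partial>lborel) =
      (\<integral>\<^sup>+t. \<integral>\<^sup>+z. \<phi> z * indicator (U \<inter> f -` {t}) z \<partial>hausdorff1 \<partial>lborel))" for U
  have charts: "\<exists>U. coarea_on U \<and> p \<in> U" if p: "p \<in> regular" for p
  proof -
    obtain i j \<sigma> c d e1 e2 t1 t2 where L: "level_chart \<Omega> f i j \<sigma> c d e1 e2 t1 t2"
      "p \<in> level_chart.chart_dom \<Omega> f i j \<sigma> c d e1 e2 t1 t2" using chart_exists[OF p] by blast
    interpret level_chart \<Omega> f i j \<sigma> c d e1 e2 t1 t2 by (rule L)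
    have "coarea_on chart_dom"
      using coarea_chart open_chart_dom chart_dom_regular chart_dom_subset by (auto simp: coarea_on_def regular_def)
    then show ?thesis using L(2) by blast
  qed
  obtain \<F> where \<F>: "\<F> \<subseteq> Collect coarea_on" "countable \<F>" "\<Union>\<F> = \<Union>(Collect coarea_on)"
    using Lindelof[of "Collect coarea_on"] by (auto simp: coarea_on_def)
  have cover: "\<Union>\<F> = regular"
    using charts unfolding \<F>(3) by (auto simp: coarea_on_def)
  define U where "U = from_nat_into (insert {} \<F>)"
  have "coarea_on {}" by (auto simp: coarea_on_def)
  then have Uc: "coarea_on (U n)" for n
    using from_nat_into[of "insert {} \<F>" n] \<F>(1) by (auto simp: U_def)
  have "range U = insert {} \<F>"
    using \<F>(2) by (simp add: U_def range_from_nat_into)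
  then have UN: "(\<Union>n. U n) = regular" using cover by auto
  have Us[measurable]: "U n \<in> sets borel" for n using Uc by (auto simp: coarea_on_def)
  define V where "V = disjointed U"
  have "range U \<subseteq> sets borel" using Us by auto
  then have Vs[measurable]: "V n \<in> sets borel" for n
    using sets.range_disjointed_sets[of U borel] by (auto simp: V_def)
  have VU: "V n \<subseteq> U n" for n by (simp add: V_def disjointed_subset)
  have VN: "(\<Union>n. V n) = regular" by (simp add: V_def UN_disjointed_eq UN)
  have Vd: "disjoint_family V" by (simp add: V_def disjoint_family_disjointed)
  have ind: "indicator regular z = (\<Sum>n. indicator (V n) z :: ennreal)" for z
    using suminf_indicator[OF Vd] by (simp add: VN fun_eq_iff)
  have coV: "(\<lambda>t. \<integral>\<^sup>+z. \<phi> z * indicator (V n \<inter> f -` {t}) z \<partial>hausdorff1) \<in> borel_measurable borel"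
    "(\<integral>\<^sup>+z. \<phi> z * ennreal (norm (G z)) * indicator (V n) z \<partial>lborel) =
      (\<integral>\<^sup>+t. \<integral>\<^sup>+z. \<phi> z * indicator (V n \<inter> f -` {t}) z \<partial>hausdorff1 \<partial>lborel)" for n
  proof -
    have m: "(\<lambda>z. \<phi> z * indicator (V n) z) \<in> borel_measurable borel" by measurable
    have 1: "\<phi> z * indicator (V n) z * indicator (U n \<inter> f -` {t}) z = \<phi> z * indicator (V n \<inter> f -` {t}) z" for z t
      using VU[of n] by (auto simp: indicator_def)
    have 2: "\<phi> z * indicator (V n) z * ennreal (norm (G z)) * indicator (U n) z
      = \<phi> z * ennreal (norm (G z)) * indicator (V n) z" for z
      using VU[of n] by (auto simp: indicator_def)
    show "(\<lambda>t. \<integral>\<^sup>+z. \<phi> z * indicator (V n \<inter> f -` {t}) z \<partial>hausdorff1) \<in> borel_measurable borel"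
      "(\<integral>\<^sup>+z. \<phi> z * ennreal (norm (G z)) * indicator (V n) z \<partial>lborel) =
      (\<integral>\<^sup>+t. \<integral>\<^sup>+z. \<phi> z * indicator (V n \<inter> f -` {t}) z \<partial>hausdorff1 \<partial>lborel)"
      using Uc[of n] m unfolding coarea_on_def by (auto dest!: bspec[where x = "\<lambda>z. \<phi> z * indicator (V n) z"] simp only: 1 2)
  qed
  have Vlev[measurable]: "V n \<inter> f -` {t} \<in> sets borel" for n t
  proof -
    have "V n \<inter> f -` {t} = V n \<inter> (\<Omega> \<inter> f -` {t})" using VN regular_subset by auto
    then show ?thesis using sets_level[of "{t}"] by simp
  qed
  have lev: "(\<integral>\<^sup>+z. \<phi> z * indicator (regular \<inter> f -` {t}) z \<partial>hausdorff1) =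
      (\<Sum>n. \<integral>\<^sup>+z. \<phi> z * indicator (V n \<inter> f -` {t}) z \<partial>hausdorff1)" for t
  proof -
    have "\<phi> z * indicator (regular \<inter> f -` {t}) z = (\<Sum>n. \<phi> z * indicator (V n \<inter> f -` {t}) z)" for z
      by (cases "f z = t") (simp_all add: ind indicator_inter_arith)
    then have "(\<integral>\<^sup>+z. \<phi> z * indicator (regular \<inter> f -` {t}) z \<partial>hausdorff1) =
        (\<integral>\<^sup>+z. (\<Sum>n. \<phi> z * indicator (V n \<inter> f -` {t}) z) \<partial>hausdorff1)" by (simp only:)
    also have "\<dots> = (\<Sum>n. \<integral>\<^sup>+z. \<phi> z * indicator (V n \<inter> f -` {t}) z \<partial>hausdorff1)"
      by (rule nn_integral_suminf) measurable
    finally show ?thesis .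
  qed
  show "(\<lambda>t. \<integral>\<^sup>+z. \<phi> z * indicator (regular \<inter> f -` {t}) z \<partial>hausdorff1) \<in> borel_measurable borel"
    unfolding lev using coV(1) by measurable
  have GV: "(\<lambda>z. \<phi> z * ennreal (norm (G z)) * indicator (V n) z) \<in> borel_measurable borel" for n
  proof -
    have [measurable]: "(\<lambda>z. indicator (V n) z *\<^sub>R norm (G z)) \<in> borel_measurable borel"
      using VN regular_subset by (intro borel_measurable_indicator_continuous continuous_on_norm continuous_on_G) auto
    have "(\<lambda>z. \<phi> z * ennreal (indicator (V n) z *\<^sub>R norm (G z))) \<in> borel_measurable borel" by measurable
    moreover have "\<phi> z * ennreal (indicator (V n) z *\<^sub>R norm (G z)) = \<phi> z * ennreal (norm (G z)) * indicator (V n) z" for z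
      by (simp add: indicator_def)
    ultimately show ?thesis by simp
  qed
  have "(\<integral>\<^sup>+z. \<phi> z * ennreal (norm (G z)) * indicator regular z \<partial>lborel) =
      (\<Sum>n. \<integral>\<^sup>+z. \<phi> z * ennreal (norm (G z)) * indicator (V n) z \<partial>lborel)"
    using GV by (subst nn_integral_suminf[symmetric]) (simp_all add: ind)
  also have "\<dots> = (\<Sum>n. \<integral>\<^sup>+t. \<integral>\<^sup>+z. \<phi> z * indicator (V n \<inter> f -` {t}) z \<partial>hausdorff1 \<partial>lborel)"
    by (simp only: coV(2))
  also have "\<dots> = (\<integral>\<^sup>+t. (\<Sum>n. \<integral>\<^sup>+z. \<phi> z * indicator (V n \<inter> f -` {t}) z \<partial>hausdorff1) \<partial>lborel)"
    using coV(1) by (subst nn_integral_suminf) simp_all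
  finally show "(\<integral>\<^sup>+z. \<phi> z * ennreal (norm (G z)) * indicator regular z \<partial>lborel) =
      (\<integral>\<^sup>+t. \<integral>\<^sup>+z. \<phi> z * indicator (regular \<inter> f -` {t}) z \<partial>hausdorff1 \<partial>lborel)"
    by (simp only: lev)
qed

text \<open>
  The area integral of \<open>|\<nabla>f|\<close> over the preimage is an integral over the null set \<open>N\<close>, hence zero; as
  \<open>|\<nabla>f|\<close> is positive there, the preimage is null.
\<close>

lemma null_preimage_regular:
  assumes N: "N \<in> null_sets lborel"
  shows "regular \<inter> f -` N \<in> null_sets lborel"
proof -
  have Nb: "N \<in> sets borel" using N by auto
  have E: "regular \<inter> f -` N \<in> sets borel"
  proof -
    have "regular \<inter> f -` N = regular \<inter> (\<Omega> \<inter> f -` N)" using regular_subset by auto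
    then show ?thesis using sets_level[OF Nb] open_regular by simp
  qed
  let ?\<phi> = "indicator (regular \<inter> f -` N) :: real^2 \<Rightarrow> ennreal"
  have "(\<integral>\<^sup>+z. ?\<phi> z * ennreal (norm (G z)) * indicator regular z \<partial>lborel) =
      (\<integral>\<^sup>+t. \<integral>\<^sup>+z. ?\<phi> z * indicator (regular \<inter> f -` {t}) z \<partial>hausdorff1 \<partial>lborel)"
    using E by (intro coarea) simp
  also have "\<dots> = (\<integral>\<^sup>+t. 0 \<partial>(lborel :: real measure))"
  proof (rule nn_integral_cong_AE)
    show "AE t in lborel. (\<integral>\<^sup>+z. ?\<phi> z * indicator (regular \<inter> f -` {t}) z \<partial>hausdorff1) = 0"
      using AE_not_in[OF N]
    proof eventually_elim
      case (elim t)
      have "?\<phi> z * indicator (regular \<inter> f -` {t}) z = 0" for z using elim by (auto simp: indicator_def)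
      then show ?case by (simp only: nn_integral_0_iff_AE nn_integral_const) simp
    qed
  qed
  finally have z: "(\<integral>\<^sup>+z. ?\<phi> z * ennreal (norm (G z)) * indicator regular z \<partial>lborel) = 0" by simp
  have "(\<lambda>z. indicator (regular \<inter> f -` N) z *\<^sub>R norm (G z)) \<in> borel_measurable borel"
    using regular_subset E by (intro borel_measurable_indicator_continuous continuous_on_norm continuous_on_G) auto
  then have "(\<lambda>z. ennreal (indicator (regular \<inter> f -` N) z *\<^sub>R norm (G z))) \<in> borel_measurable lborel" by simp
  moreover have "(\<integral>\<^sup>+z. ennreal (indicator (regular \<inter> f -` N) z *\<^sub>R norm (G z)) \<partial>lborel) = 0"
    unfolding z[symmetric] by (intro nn_integral_cong) (auto simp: indicator_def)
  ultimately have "AE z in lborel. ennreal (indicator (regular \<inter> f -` N) z *\<^sub>R norm (G z)) = 0"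
    by (simp add: nn_integral_0_iff_AE)
  then have "AE z in lborel. z \<notin> regular \<inter> f -` N"
    by eventually_elim (auto simp: indicator_def regular_def split: if_splits)
  then show ?thesis using E by (subst AE_iff_null_sets) auto
qed

end

section \<open>Length of level sets in small discs\<close>

lemma hausdorff1_outer_singleton: "hausdorff1_outer {p :: 'a::metric_space} = 0"
proof -
  have "hausdorff1_outer ((\<lambda>_. p) ` {0::real}) \<le> ennreal 1 * hausdorff1_outer {0::real}"
    by (rule hausdorff1_outer_lipschitz_image) auto
  also have "hausdorff1_outer {0::real} = 0" by (subst hausdorff1_outer_real) auto
  finally show ?thesis by simp
qed

lemma hausdorff1_outer_finite_Union:
  assumes "finite D"
  shows "hausdorff1_outer (\<Union>u\<in>D. A u) \<le> (\<Sum>u\<in>D. hausdorff1_outer (A u))"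
  using assms
proof induction
  case (insert u D)
  have "hausdorff1_outer (\<Union>u\<in>insert u D. A u) \<le> hausdorff1_outer (A u) + hausdorff1_outer (\<Union>u\<in>D. A u)"
    using hausdorff1_outer_Un_le[of "A u" "\<Union>u\<in>D. A u"] by simp
  also have "\<dots> \<le> hausdorff1_outer (A u) + (\<Sum>u\<in>D. hausdorff1_outer (A u))"
    by (rule add_left_mono) (rule insert.IH)
  finally show ?case using insert.hyps by simp
qed (simp add: hausdorff1_outer_empty)

lemma convex_cone_around: "convex {x :: 'a::real_inner. \<theta> * norm x < x \<bullet> u}" if "0 \<le> \<theta>"
proof (rule convexI)
  fix x y :: 'a and a b :: real
  assume xy: "x \<in> {x. \<theta> * norm x < x \<bullet> u}" "y \<in> {x. \<theta> * norm x < x \<bullet> u}" and ab: "0 \<le> a" "0 \<le> b" "a + b = 1"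
  have "\<theta> * norm (a *\<^sub>R x + b *\<^sub>R y) \<le> \<theta> * (a * norm x + b * norm y)"
    using ab that norm_triangle_ineq[of "a *\<^sub>R x" "b *\<^sub>R y"] by (intro mult_left_mono) auto
  also have "\<dots> = a * (\<theta> * norm x) + b * (\<theta> * norm y)" by (simp add: algebra_simps)
  also have "\<dots> < a * (x \<bullet> u) + b * (y \<bullet> u)"
  proof (cases "a = 0")
    case True
    then show ?thesis using xy ab by simp
  next
    case False
    then have "a * (\<theta> * norm x) < a * (x \<bullet> u)" using xy ab by simp
    moreover have "b * (\<theta> * norm y) \<le> b * (y \<bullet> u)" using xy ab by (intro mult_left_mono) auto
    ultimately show ?thesis by linarith
  qed
  finally show "a *\<^sub>R x + b *\<^sub>R y \<in> {x. \<theta> * norm x < x \<bullet> u}"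
    by (simp add: inner_add_left)
qed

context C2_function
begin

text \<open>
  If the gradient makes a definite angle with the line orthogonal to \<open>e\<close> throughout a convex set, then a
  chord of a level set, being orthogonal to the gradient at an intermediate point, is controlled by its
  projection \<open>e'\<close> to that line.  The level set is then the image of a subset of an interval of length
  \<open>2 \<epsilon>\<close> under a Lipschitz map.
\<close>

lemma hausdorff1_outer_level_le:
  assumes A: "convex A" "A \<subseteq> \<Omega>" "A \<subseteq> ball p \<epsilon>" and m: "0 < m" and e: "norm e = 1"
    and dir: "\<And>x. x \<in> A \<Longrightarrow> G x \<noteq> 0 \<and> m * norm (G x) \<le> G x \<bullet> e"
    and \<epsilon>: "0 \<le> \<epsilon>"
  shows "hausdorff1_outer (A \<inter> f -` {t}) \<le> ennreal ((1 + 1 / m) * (2 * \<epsilon>))"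
proof -
  define e' :: "real^2" where "e' = vector [- e $ 2, e $ 1]"
  have e': "e' $ 1 = - e $ 2" "e' $ 2 = e $ 1" by (simp_all add: e'_def)
  have ee: "(e $ 1)\<^sup>2 + (e $ 2)\<^sup>2 = 1"
    using e by (simp add: norm_eq_1 inner_vec_def sum_2 power2_eq_square)
  have decomp: "u \<bullet> v = (u \<bullet> e) * (v \<bullet> e) + (u \<bullet> e') * (v \<bullet> e')" for u v :: "real^2"
  proof -
    have "(u \<bullet> e) * (v \<bullet> e) + (u \<bullet> e') * (v \<bullet> e') = (u \<bullet> v) * ((e $ 1)\<^sup>2 + (e $ 2)\<^sup>2)"
      by (simp add: inner_vec_def sum_2 e' algebra_simps power2_eq_square)
    then show ?thesis by (simp add: ee)
  qed
  have norm_e': "norm e' = 1" using ee by (simp add: norm_eq_1 inner_vec_def sum_2 e' power2_eq_square)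
  have norm_le: "norm v \<le> \<bar>v \<bullet> e\<bar> + \<bar>v \<bullet> e'\<bar>" for v :: "real^2"
  proof -
    have "norm v = sqrt ((v \<bullet> e)\<^sup>2 + (v \<bullet> e')\<^sup>2)"
      using decomp[of v v] by (simp add: norm_eq_sqrt_inner power2_eq_square)
    then show ?thesis by (simp add: sqrt_sum_squares_le_sum_abs)
  qed
  define B where "B = A \<inter> f -` {t}"
  define K where "K = 1 + 1 / m"
  have K: "0 < K" using m by (simp add: K_def add_pos_pos)
  have chord: "norm (z - y) \<le> K * \<bar>z \<bullet> e' - y \<bullet> e'\<bar>" if "y \<in> B" "z \<in> B" for y z
  proof -
    have "closed_segment y z \<subseteq> A" using that A by (intro closed_segment_subset) (auto simp: B_def)
    then obtain \<xi> where \<xi>: "\<xi> \<in> A" "f z - f y = (z - y) \<bullet> G \<xi>"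
      using mean_value[of y z] A(2) by blast
    define v where "v = z - y"
    have "v \<bullet> G \<xi> = 0" using \<xi>(2) that by (simp add: B_def v_def)
    then have "(v \<bullet> e) * (G \<xi> \<bullet> e) = - ((v \<bullet> e') * (G \<xi> \<bullet> e'))" using decomp[of v "G \<xi>"] by linarith
    then have "\<bar>v \<bullet> e\<bar> * \<bar>G \<xi> \<bullet> e\<bar> = \<bar>v \<bullet> e'\<bar> * \<bar>G \<xi> \<bullet> e'\<bar>" by (simp add: abs_mult[symmetric])
    moreover have "\<bar>G \<xi> \<bullet> e'\<bar> \<le> norm (G \<xi>)" using Cauchy_Schwarz_ineq2[of "G \<xi>" e'] norm_e' by simp
    moreover have "m * norm (G \<xi>) \<le> \<bar>G \<xi> \<bullet> e\<bar>" using dir[OF \<xi>(1)] by linarith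
    ultimately have "\<bar>v \<bullet> e\<bar> * (m * norm (G \<xi>)) \<le> \<bar>v \<bullet> e'\<bar> * norm (G \<xi>)"
      using mult_left_mono[of "m * norm (G \<xi>)" "\<bar>G \<xi> \<bullet> e\<bar>" "\<bar>v \<bullet> e\<bar>"]
        mult_left_mono[of "\<bar>G \<xi> \<bullet> e'\<bar>" "norm (G \<xi>)" "\<bar>v \<bullet> e'\<bar>"] by linarith
    then have "(\<bar>v \<bullet> e\<bar> * m) * norm (G \<xi>) \<le> \<bar>v \<bullet> e'\<bar> * norm (G \<xi>)" by (simp add: mult.assoc)
    then have "\<bar>v \<bullet> e\<bar> * m \<le> \<bar>v \<bullet> e'\<bar>" using dir[OF \<xi>(1)] by simp
    then have "\<bar>v \<bullet> e\<bar> \<le> \<bar>v \<bullet> e'\<bar> / m" using m by (simp add: field_simps)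
    then have "norm v \<le> K * \<bar>v \<bullet> e'\<bar>" using norm_le[of v] by (simp add: K_def algebra_simps)
    then show ?thesis by (simp add: v_def inner_diff_left)
  qed
  define s where "s z = z \<bullet> e'" for z
  have inj: "inj_on s B"
  proof (rule inj_onI)
    fix y z assume "y \<in> B" "z \<in> B" "s y = s z"
    then have "norm (z - y) \<le> 0" using chord[of y z] by (simp add: s_def)
    then show "y = z" by simp
  qed
  define g where "g = inv_into B s"
  have gs: "g (s z) = z" if "z \<in> B" for z using that inj by (simp add: g_def)
  then have "g ` s ` B = B" by force
  have "hausdorff1_outer (g ` s ` B) \<le> ennreal K * hausdorff1_outer (s ` B)"
  proof (rule hausdorff1_outer_lipschitz_image[OF K])
    fix x y assume "x \<in> s ` B" "y \<in> s ` B"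
    then obtain x' y' where "x' \<in> B" "y' \<in> B" "x = s x'" "y = s y'" by auto
    then show "dist (g x) (g y) \<le> K * dist x y"
      using chord[of x' y'] gs by (simp add: s_def dist_norm norm_minus_commute abs_minus_commute)
  qed
  also have "\<dots> \<le> ennreal K * ennreal (2 * \<epsilon>)"
  proof (rule mult_left_mono)
    have "s ` B \<subseteq> {p \<bullet> e' - \<epsilon>..p \<bullet> e' + \<epsilon>}"
    proof clarify
      fix z assume "z \<in> B"
      then have "norm (z - p) \<le> \<epsilon>" using A(3) by (auto simp: B_def dist_norm norm_minus_commute)
      then have "\<bar>(z - p) \<bullet> e'\<bar> \<le> \<epsilon>" using Cauchy_Schwarz_ineq2[of "z - p" e'] norm_e' by simp
      then show "s z \<in> {p \<bullet> e' - \<epsilon>..p \<bullet> e' + \<epsilon>}" by (auto simp: s_def inner_diff_left)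
    qed
    then have "hausdorff1_outer (s ` B) \<le> hausdorff1_outer {p \<bullet> e' - \<epsilon>..p \<bullet> e' + \<epsilon>}"
      by (rule hausdorff1_outer_mono)
    also have "\<dots> \<le> ennreal (2 * \<epsilon>)"
      using hausdorff1_outer_interval_le[of "p \<bullet> e' - \<epsilon>" "p \<bullet> e' + \<epsilon>"] \<epsilon> by simp
    finally show "hausdorff1_outer (s ` B) \<le> ennreal (2 * \<epsilon>)" .
  qed simp
  also have "\<dots> = ennreal (K * (2 * \<epsilon>))" using K \<epsilon> by (simp add: ennreal_mult)
  finally have "hausdorff1_outer B \<le> ennreal (K * (2 * \<epsilon>))" by (simp only: \<open>g ` s ` B = B\<close>)
  then show ?thesis by (simp only: B_def K_def)
qed

lemma regular_level_bound:
  assumes "p \<in> regular"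
  shows "\<exists>r>0. \<exists>K. ball p r \<subseteq> \<Omega> \<and> (\<forall>t. hausdorff1_outer (ball p r \<inter> f -` {t}) \<le> ennreal K)"
proof -
  have p: "p \<in> \<Omega>" "G p \<noteq> 0" using assms by (auto simp: regular_def)
  define e where "e = G p /\<^sub>R norm (G p)"
  have e: "norm e = 1" using p by (simp add: e_def)
  have "open (\<Omega> \<inter> (\<lambda>x. G x \<bullet> e - norm (G x) / 2) -` {0<..})"
    by (intro continuous_open_preimage open_\<Omega> continuous_intros continuous_on_G) auto
  moreover have "G p \<bullet> e = norm (G p)"
    using p by (simp add: e_def dot_square_norm power2_eq_square)
  then have "p \<in> \<Omega> \<inter> (\<lambda>x. G x \<bullet> e - norm (G x) / 2) -` {0<..}" using p by simp
  ultimately obtain r where r: "0 < r" "ball p r \<subseteq> \<Omega> \<inter> (\<lambda>x. G x \<bullet> e - norm (G x) / 2) -` {0<..}"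
    using open_contains_ball by blast
  have "hausdorff1_outer (ball p r \<inter> f -` {t}) \<le> ennreal ((1 + 1 / (1/2)) * (2 * r))" for t
  proof (rule hausdorff1_outer_level_le[OF convex_ball _ order_refl _ e])
    show "G x \<noteq> 0 \<and> 1 / 2 * norm (G x) \<le> G x \<bullet> e" if "x \<in> ball p r" for x
      using r(2) that by force
  qed (use r in auto)
  then show ?thesis using r by blast
qed

text \<open>
  Let \<open>H\<close> be the Hessian, with \<open>B |v| \<le> |H v| \<le> M |v|\<close>.  Near \<open>p\<close> the gradient differs from \<open>H(x - p)\<close>
  by at most \<open>B/4 \<cdot> |x - p|\<close>.  In a thin convex cone around the unit vector \<open>u\<close> the vector \<open>H(x - p)\<close> is
  within the same error of \<open>|x - p| H u\<close>, so there the gradient has a component at least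
  \<open>B/2 \<cdot> |x - p|\<close> in the direction of \<open>H u\<close>, while its norm is at most \<open>2 M |x - p|\<close>.  Compactness of the
  unit circle leaves finitely many cones, and the number of cones does not depend on \<open>\<epsilon>\<close> or \<open>t\<close>.
\<close>

lemma critical_level_bound:
  assumes p: "p \<in> \<Omega>" "G p = 0" "invertible (hessian f p)"
  shows "\<exists>r>0. \<exists>c>0. \<exists>K\<ge>0. ball p r \<subseteq> \<Omega> \<and> (\<forall>x\<in>ball p r. c * norm (x - p) \<le> norm (G x)) \<and>
    (\<forall>\<epsilon> t. 0 < \<epsilon> \<longrightarrow> \<epsilon> \<le> r \<longrightarrow> hausdorff1_outer (ball p \<epsilon> \<inter> f -` {t}) \<le> ennreal (K * \<epsilon>))"
proof -
  define H where "H v = hessian f p *v v" for v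
  have lin: "linear H" unfolding H_def by (rule matrix_vector_mul_linear)
  have "inj H" unfolding H_def using p(3) by (simp add: inj_matrix_vector_mult)
  obtain B where B: "0 < B" "\<And>v. B * norm v \<le> norm (H v)"
    using linear_inj_bounded_below_pos[OF lin \<open>inj H\<close>] by blast
  obtain M where M: "0 < M" "\<And>v. norm (H v) \<le> M * norm v"
    using linear_bounded_pos[OF lin] by blast
  have BM: "B \<le> M"
  proof -
    have "B * norm (axis 1 1 :: real^2) \<le> M * norm (axis 1 1 :: real^2)"
      using B(2) M(2) order_trans by blast
    then show ?thesis by (simp add: norm_axis_1)
  qed
  (* a quarter of the lower bound: two such errors still leave half of it *)
  define \<eta> where "\<eta> = B / 4"
  have \<eta>: "0 < \<eta>" using B by (simp add: \<eta>_def)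
  have "(G has_derivative H) (at p)" using has_derivative_G[OF p(1)] by (simp add: H_def[abs_def])
  then obtain r1 where r1: "0 < r1" "\<And>x. norm (x - p) < r1 \<Longrightarrow> norm (G x - H (x - p)) \<le> \<eta> * norm (x - p)"
    using \<eta> p(2) unfolding has_derivative_at_alt by fastforce
  obtain r2 where r2: "0 < r2" "ball p r2 \<subseteq> \<Omega>" using open_\<Omega> p(1) open_contains_ball by blast
  define r where "r = min r1 r2"
  have r: "0 < r" "ball p r \<subseteq> \<Omega>" using r1 r2 by (auto simp: r_def)
  have approx: "norm (G x - H (x - p)) \<le> \<eta> * norm (x - p)" if "x \<in> ball p r" for x
    using r1(2)[of x] that by (auto simp: r_def dist_norm norm_minus_commute)
  have lower: "\<eta> * norm (x - p) \<le> norm (G x)" if "x \<in> ball p r" for x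
  proof -
    have "norm (H (x - p)) - norm (G x - H (x - p)) \<le> norm (G x)"
      by (smt (verit) norm_triangle_ineq4 norm_minus_commute norm_triangle_sub)
    then have "4 * (\<eta> * norm (x - p)) - \<eta> * norm (x - p) \<le> norm (G x)"
      using approx[OF that] B(2)[of "x - p"] by (simp add: \<eta>_def)
    moreover have "0 \<le> \<eta> * norm (x - p)" using \<eta> by simp
    ultimately show ?thesis by linarith
  qed
  define \<delta> where "\<delta> = B / (4 * M)"
  have \<delta>: "0 < \<delta>" "\<delta> \<le> 1 / 4" "M * \<delta> = \<eta>" using B M BM by (auto simp: \<delta>_def \<eta>_def field_simps)
  (* the cone x \<bullet> u > \<theta> |x| consists of the x with |x - |x| u| < \<delta> |x| *)
  define \<theta> where "\<theta> = 1 - \<delta>\<^sup>2 / 2"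
  have \<theta>: "0 \<le> \<theta>" "\<theta> < 1"
  proof -
    have "\<delta>\<^sup>2 \<le> 1\<^sup>2" using \<delta> by (intro power_mono) auto
    then show "0 \<le> \<theta>" "\<theta> < 1" using \<delta> by (auto simp: \<theta>_def)
  qed
  define cone where "cone u = {x :: real^2. \<theta> * norm x < x \<bullet> u}" for u
  have near_u: "norm (x - norm x *\<^sub>R u) \<le> \<delta> * norm x" if "norm u = 1" "x \<in> cone u" for x u
  proof -
    have uu: "u \<bullet> u = 1" using that(1) by (simp add: norm_eq_1)
    have "(norm (x - norm x *\<^sub>R u))\<^sup>2 = (x - norm x *\<^sub>R u) \<bullet> (x - norm x *\<^sub>R u)"
      by (rule power2_norm_eq_inner)
    also have "\<dots> = x \<bullet> x - 2 * norm x * (x \<bullet> u) + norm x * norm x * (u \<bullet> u)"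
      by (simp add: inner_diff_left inner_diff_right inner_commute algebra_simps)
    also have "\<dots> = 2 * (norm x)\<^sup>2 - 2 * norm x * (x \<bullet> u)"
      unfolding uu by (simp add: dot_square_norm power2_eq_square)
    also have "\<dots> \<le> 2 * (norm x)\<^sup>2 - 2 * norm x * (\<theta> * norm x)"
      using that(2) by (auto simp: cone_def intro!: mult_left_mono)
    also have "\<dots> = (\<delta> * norm x)\<^sup>2" by (simp add: \<theta>_def algebra_simps power2_eq_square)
    finally show ?thesis using \<delta> by (auto intro: power2_le_imp_le)
  qed
  define m where "m = B / (4 * M)"
  have m: "0 < m" using B M by (simp add: m_def)
  have sector: "hausdorff1_outer (((+) p ` cone u \<inter> ball p \<epsilon>) \<inter> f -` {t}) \<le> ennreal ((1 + 1 / m) * (2 * \<epsilon>))"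
    if u: "norm u = 1" and \<epsilon>: "0 < \<epsilon>" "\<epsilon> \<le> r" for u \<epsilon> t
  proof (rule hausdorff1_outer_level_le[where e = "H u /\<^sub>R norm (H u)"])
    have Hu: "B \<le> norm (H u)" using B(2)[of u] u by simp
    then have Hu0: "H u \<noteq> 0" using B(1) by auto
    show "convex ((+) p ` cone u \<inter> ball p \<epsilon>)"
      unfolding cone_def by (intro convex_Int convex_translation convex_cone_around \<theta> convex_ball)
    show "(+) p ` cone u \<inter> ball p \<epsilon> \<subseteq> \<Omega>" using r \<epsilon> by auto
    show "norm (H u /\<^sub>R norm (H u)) = 1" using Hu0 by simp
    fix y assume "y \<in> (+) p ` cone u \<inter> ball p \<epsilon>"
    then obtain x where x: "y = p + x" "x \<in> cone u" and y: "y \<in> ball p r" using \<epsilon> by auto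
    have x0: "0 < norm x"
      using x(2) by (auto simp: cone_def)
    define w where "w = H u /\<^sub>R norm (H u)"
    have w: "norm w = 1" "H u \<bullet> w = norm (H u)"
      using Hu0 by (auto simp: w_def dot_square_norm power2_eq_square)
    define q where "q = G y - H x"
    have q: "norm q \<le> \<eta> * norm x" using approx[OF y] x by (simp add: q_def)
    have Hx: "G y = norm x *\<^sub>R H u + H (x - norm x *\<^sub>R u) + q"
      by (simp add: q_def linear_diff[OF lin] linear_scale[OF lin])
    have "norm (H (x - norm x *\<^sub>R u)) \<le> M * (\<delta> * norm x)"
      using M near_u[OF u x(2)] by (meson M(2) mult_left_mono less_imp_le order_trans)
    also have "\<dots> = \<eta> * norm x" using \<delta>(3) by (metis mult.assoc)
    finally have R: "norm (H (x - norm x *\<^sub>R u)) \<le> \<eta> * norm x" .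
    have cs: "- norm a \<le> a \<bullet> w" for a using Cauchy_Schwarz_ineq2[of a w] w(1) by (simp add: abs_le_iff)
    have "G y \<bullet> w = norm x * norm (H u) + H (x - norm x *\<^sub>R u) \<bullet> w + q \<bullet> w"
      by (subst Hx) (simp only: inner_add_left inner_scaleR_left w(2))
    moreover have "norm x * B \<le> norm x * norm (H u)" using Hu by (intro mult_left_mono) auto
    ultimately have "norm x * B - \<eta> * norm x - \<eta> * norm x \<le> G y \<bullet> w"
      using cs[of q] cs[of "H (x - norm x *\<^sub>R u)"] q R by linarith
    then have 1: "B / 2 * norm x \<le> G y \<bullet> w" by (simp add: \<eta>_def algebra_simps)
    have "norm (G y) \<le> norm (H x) + norm q" unfolding q_def by (metis add.commute diff_add_cancel norm_triangle_ineq)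
    also have "\<dots> \<le> M * norm x + \<eta> * norm x" using M(2) q by (intro add_mono) auto
    also have "\<dots> \<le> 2 * M * norm x" using BM B(1) x0 by (simp add: \<eta>_def)
    finally have "m * norm (G y) \<le> m * (2 * M * norm x)" using m by (intro mult_left_mono) auto
    also have "\<dots> = B / 2 * norm x" using M by (simp add: m_def)
    finally have 2: "m * norm (G y) \<le> B / 2 * norm x" .
    have "0 < B / 2 * norm x" using B x0 by simp
    then show "G y \<noteq> 0 \<and> m * norm (G y) \<le> G y \<bullet> (H u /\<^sub>R norm (H u))"
      using 1 2 by (auto simp: w_def[symmetric])
  qed (use m \<epsilon> in auto)
  have "sphere (0::real^2) 1 \<subseteq> (\<Union>u\<in>sphere 0 1. cone u)"
  proof
    fix u :: "real^2" assume "u \<in> sphere 0 1"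
    then have "u \<in> cone u" using \<theta> by (simp add: cone_def dot_square_norm)
    then show "u \<in> (\<Union>u\<in>sphere 0 1. cone u)" using \<open>u \<in> sphere 0 1\<close> by blast
  qed
  moreover have "open (cone u)" for u
    unfolding cone_def by (intro open_Collect_less continuous_intros)
  ultimately obtain D where D: "D \<subseteq> sphere 0 1" "finite D" "sphere 0 1 \<subseteq> (\<Union>u\<in>D. cone u)"
    using compactE_image[OF compact_sphere, of "sphere 0 1" cone] by metis
  define K where "K = real (card D) * ((1 + 1 / m) * 2)"
  have bound: "hausdorff1_outer (ball p \<epsilon> \<inter> f -` {t}) \<le> ennreal (K * \<epsilon>)" if \<epsilon>: "0 < \<epsilon>" "\<epsilon> \<le> r" for \<epsilon> t
  proof -
    have "ball p \<epsilon> \<inter> f -` {t} \<subseteq> {p} \<union> (\<Union>u\<in>D. ((+) p ` cone u \<inter> ball p \<epsilon>) \<inter> f -` {t})"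
    proof
      fix y assume y: "y \<in> ball p \<epsilon> \<inter> f -` {t}"
      show "y \<in> {p} \<union> (\<Union>u\<in>D. ((+) p ` cone u \<inter> ball p \<epsilon>) \<inter> f -` {t})"
      proof (cases "y = p")
        case False
        define x where "x = y - p"
        have x: "x \<noteq> 0" using False by (simp add: x_def)
        then have "x /\<^sub>R norm x \<in> sphere 0 1" by simp
        then obtain u where u: "u \<in> D" "x /\<^sub>R norm x \<in> cone u" using D(3) by blast
        then have "\<theta> < inverse (norm x) * (x \<bullet> u)" using x by (simp add: cone_def)
        then have "\<theta> * norm x < x \<bullet> u" using x by (simp add: field_simps)
        then have "y \<in> (+) p ` cone u" by (auto simp: cone_def x_def image_iff intro!: bexI[of _ x])
        then show ?thesis using u y by auto
      qed simp
    qed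
    then have "hausdorff1_outer (ball p \<epsilon> \<inter> f -` {t}) \<le>
        hausdorff1_outer ({p} \<union> (\<Union>u\<in>D. ((+) p ` cone u \<inter> ball p \<epsilon>) \<inter> f -` {t}))"
      by (rule hausdorff1_outer_mono)
    also have "\<dots> \<le> hausdorff1_outer {p} + hausdorff1_outer (\<Union>u\<in>D. ((+) p ` cone u \<inter> ball p \<epsilon>) \<inter> f -` {t})"
      by (rule hausdorff1_outer_Un_le)
    also have "\<dots> \<le> (\<Sum>u\<in>D. hausdorff1_outer (((+) p ` cone u \<inter> ball p \<epsilon>) \<inter> f -` {t}))"
      unfolding hausdorff1_outer_singleton add_0 by (rule hausdorff1_outer_finite_Union[OF D(2)])
    also have "\<dots> \<le> (\<Sum>u\<in>D. ennreal ((1 + 1 / m) * (2 * \<epsilon>)))"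
      using D(1) \<epsilon> by (intro sum_mono sector) auto
    also have "\<dots> = ennreal (K * \<epsilon>)"
      using m \<epsilon> by (simp add: K_def ennreal_of_nat_eq_real_of_nat mult_ac flip: ennreal_mult)
    finally show ?thesis .
  qed
  have "0 \<le> K" using m by (simp add: K_def)
  then show ?thesis using r \<eta> lower bound by blast
qed

end

section \<open>Continuity of integrals over level sets\<close>

lemma continuous_on_uniform_approx:
  fixes A :: "'a::metric_space \<Rightarrow> real"
  assumes "\<And>e. 0 < e \<Longrightarrow> \<exists>A'. continuous_on T A' \<and> (\<forall>t\<in>T. \<bar>A t - A' t\<bar> \<le> e)"
  shows "continuous_on T A"
  unfolding continuous_on_iff
proof (intro ballI allI impI)
  fix x e assume x: "x \<in> T" and e: "0 < (e::real)"
  then obtain A' where A': "continuous_on T A'" "\<And>t. t \<in> T \<Longrightarrow> \<bar>A t - A' t\<bar> \<le> e / 3"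
    using assms[of "e / 3"] by auto
  then obtain d where d: "0 < d" "\<And>y. y \<in> T \<Longrightarrow> dist y x < d \<Longrightarrow> dist (A' y) (A' x) < e / 3"
    using x e unfolding continuous_on_iff by (metis divide_pos_pos zero_less_numeral)
  have "dist (A y) (A x) < e" if "y \<in> T" "dist y x < d" for y
    using A'(2)[OF that(1)] A'(2)[OF x] d(2)[OF that] unfolding dist_real_def by linarith
  then show "\<exists>d>0. \<forall>x'\<in>T. dist x' x < d \<longrightarrow> dist (A x') (A x) < e" using d(1) by blast
qed

context C2_function
begin

text \<open>
  Intersecting the chart domain with a disc makes the neighbourhood bounded, so that its complement is
  nonempty and the distance to the complement can serve as a partition function.
\<close>

lemma continuous_level_integral_near_regular:
  assumes "p \<in> regular"
  shows "\<exists>U. open U \<and> p \<in> U \<and> bounded U \<and> (\<forall>w :: real^2 \<Rightarrow> real. continuous_on \<Omega> w \<longrightarrow>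
    (\<forall>z\<in>\<Omega> - U. w z = 0) \<longrightarrow> continuous_on UNIV (\<lambda>t. LINT z:\<Omega> \<inter> f -` {t}|hausdorff1. w z))"
proof -
  obtain i j \<sigma> c d e1 e2 t1 t2 where L: "level_chart \<Omega> f i j \<sigma> c d e1 e2 t1 t2"
    "p \<in> level_chart.chart_dom \<Omega> f i j \<sigma> c d e1 e2 t1 t2" using chart_exists[OF assms] by blast
  interpret level_chart \<Omega> f i j \<sigma> c d e1 e2 t1 t2 by (rule L)
  show ?thesis
    using L(2) open_chart_dom continuous_level_integral_chart
    by (intro exI[of _ "chart_dom \<inter> ball p 1"]) (auto intro: bounded_Int)
qed

end

locale strip = C2_function \<Omega> f for \<Omega> :: "(real^2) set" and f :: "real^2 \<Rightarrow> real" +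
  fixes a b :: real
  assumes nondegenerate: "\<And>x. x \<in> \<Omega> \<Longrightarrow> G x = 0 \<Longrightarrow> invertible (hessian f x)"
    and ab: "a \<le> b" and compact_strip: "compact (\<Omega> \<inter> f -` {a..b})"
begin

abbreviation S :: "(real^2) set" where "S \<equiv> \<Omega> \<inter> f -` {a..b}"
abbreviation lev :: "real \<Rightarrow> (real^2) set" where "lev t \<equiv> \<Omega> \<inter> f -` {t}"
definition Crit :: "(real^2) set" where "Crit = {x \<in> S. G x = 0}"

lemma Crit_eq: "Crit = S \<inter> critical_points \<Omega> f"
  by (auto simp: Crit_def critical_points_def)

lemma S_diff_Crit: "S - Crit \<subseteq> regular" by (auto simp: Crit_def regular_def)

lemma sets_S [measurable]: "S \<in> sets borel" by (rule sets_level) simp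
lemma sets_lev [measurable]: "lev t \<in> sets borel" by (rule sets_level) simp
lemma lev_subset: "t \<in> {a..b} \<Longrightarrow> lev t \<subseteq> S" by auto

text \<open>
  A nondegenerate critical point is isolated, because the gradient grows at least linearly around it.
\<close>

lemma finite_Crit: "finite Crit"
proof (rule ccontr)
  assume inf: "infinite Crit"
  have "closedin (top_of_set S) (S \<inter> G -` {0})"
    by (rule continuous_closedin_preimage) (auto intro: continuous_on_subset[OF continuous_on_G])
  moreover have "S \<inter> G -` {0} = Crit" by (auto simp: Crit_def)
  ultimately have "compact Crit" using compact_strip closedin_compact by metis
  from Heine_Borel_imp_Bolzano_Weierstrass[OF this inf] obtain p where p: "p \<in> Crit" "p islimpt Crit" by blast
  then have "p \<in> \<Omega>" "G p = 0" by (auto simp: Crit_def)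
  from critical_level_bound[OF this nondegenerate[OF this]] obtain r c where
    r: "0 < r" "0 < c" "\<And>x. x \<in> ball p r \<Longrightarrow> c * norm (x - p) \<le> norm (G x)" by blast
  obtain x where "x \<in> Crit" "x \<noteq> p" "dist x p < r"
    using p(2) r(1) by (auto simp: islimpt_approachable)
  then show False using r(2) r(3)[of x] by (auto simp: Crit_def dist_commute mult_le_0_iff)
qed

lemma hausdorff1_level_bounded: "\<exists>K\<ge>0. \<forall>t\<in>{a..b}. hausdorff1_outer (lev t) \<le> ennreal K"
proof -
  have loc: "\<exists>r>0. \<exists>K\<ge>0. \<forall>t. hausdorff1_outer (ball p r \<inter> f -` {t}) \<le> ennreal K" if "p \<in> S" for p
  proof (cases "p \<in> Crit")
    case True
    then have "p \<in> \<Omega>" "G p = 0" by (auto simp: Crit_def)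
    from critical_level_bound[OF this nondegenerate[OF this]] obtain r K where
      "0 < r" "0 \<le> K" "\<And>\<epsilon> t. 0 < \<epsilon> \<Longrightarrow> \<epsilon> \<le> r \<Longrightarrow> hausdorff1_outer (ball p \<epsilon> \<inter> f -` {t}) \<le> ennreal (K * \<epsilon>)" by blast
    then have "0 \<le> K * r" "\<forall>t. hausdorff1_outer (ball p r \<inter> f -` {t}) \<le> ennreal (K * r)" by auto
    then show ?thesis using \<open>0 < r\<close> by blast
  next
    case False
    then have "p \<in> regular" using that S_diff_Crit by blast
    then obtain r K where *: "0 < r" "\<And>t. hausdorff1_outer (ball p r \<inter> f -` {t}) \<le> ennreal K"
      using regular_level_bound by blast
    have "ennreal K \<le> ennreal \<bar>K\<bar>" by (intro ennreal_leI) auto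
    then have "\<forall>t. hausdorff1_outer (ball p r \<inter> f -` {t}) \<le> ennreal \<bar>K\<bar>" using *(2) order_trans by blast
    then show ?thesis using *(1) abs_ge_zero by blast
  qed
  then obtain r K where rK: "\<And>p. p \<in> S \<Longrightarrow> 0 < r p" "\<And>p. p \<in> S \<Longrightarrow> 0 \<le> K p"
    "\<And>p t. p \<in> S \<Longrightarrow> hausdorff1_outer (ball p (r p) \<inter> f -` {t}) \<le> ennreal (K p)" by metis
  have cover: "S \<subseteq> (\<Union>p\<in>S. ball p (r p))" using rK(1) by force
  obtain D where D: "D \<subseteq> S" "finite D" "S \<subseteq> (\<Union>p\<in>D. ball p (r p))"
    by (rule compactE_image[OF compact_strip open_ball cover])
  have "hausdorff1_outer (lev t) \<le> ennreal (\<Sum>p\<in>D. K p)" if "t \<in> {a..b}" for t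
  proof -
    have "lev t \<subseteq> (\<Union>p\<in>D. ball p (r p) \<inter> f -` {t})" using D(3) lev_subset[OF that] by blast
    then have "hausdorff1_outer (lev t) \<le> hausdorff1_outer (\<Union>p\<in>D. ball p (r p) \<inter> f -` {t})"
      by (rule hausdorff1_outer_mono)
    also have "\<dots> \<le> (\<Sum>p\<in>D. hausdorff1_outer (ball p (r p) \<inter> f -` {t}))"
      by (rule hausdorff1_outer_finite_Union[OF D(2)])
    also have "\<dots> \<le> (\<Sum>p\<in>D. ennreal (K p))" by (intro sum_mono rK(3) subsetD[OF D(1)])
    also have "\<dots> = ennreal (\<Sum>p\<in>D. K p)" by (intro sum_ennreal rK(2) subsetD[OF D(1)])
    finally show ?thesis .
  qed
  moreover have "0 \<le> (\<Sum>p\<in>D. K p)" by (intro sum_nonneg rK(2) subsetD[OF D(1)])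
  ultimately show ?thesis by blast
qed

lemma emeasure_lev_finite: "t \<in> {a..b} \<Longrightarrow> emeasure hausdorff1 (lev t) < \<infinity>"
  using hausdorff1_level_bounded by (auto simp: emeasure_hausdorff1 intro: le_less_trans[OF _ ennreal_less_top])

lemma bounded_on_S:
  fixes w :: "real^2 \<Rightarrow> real"
  assumes "continuous_on \<Omega> w"
  obtains B where "0 \<le> B" "\<And>z. z \<in> S \<Longrightarrow> \<bar>w z\<bar> \<le> B"
proof -
  have "compact (w ` S)"
    by (rule compact_continuous_image[OF continuous_on_subset[OF assms] compact_strip]) auto
  then obtain B where "\<And>z. z \<in> S \<Longrightarrow> \<bar>w z\<bar> \<le> B"
    using compact_imp_bounded by (force simp: bounded_iff)
  then show ?thesis by (intro that[of "\<bar>B\<bar>"]) (auto intro: order_trans[OF _ abs_ge_self])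
qed

lemma set_integrable_lev:
  fixes w :: "real^2 \<Rightarrow> real"
  assumes w: "continuous_on \<Omega> w" and t: "t \<in> {a..b}"
  shows "set_integrable hausdorff1 (lev t) w"
proof -
  obtain B where B: "0 \<le> B" "\<And>z. z \<in> S \<Longrightarrow> \<bar>w z\<bar> \<le> B" using bounded_on_S[OF w] by blast
  show ?thesis
    unfolding set_integrable_def
  proof (rule integrableI_bounded_set[where A = "lev t" and B = B])
    show "(\<lambda>x. indicator (lev t) x *\<^sub>R w x) \<in> borel_measurable hausdorff1"
      using borel_measurable_indicator_continuous[OF w sets_lev]
      by (simp only: measurable_cong_sets[OF sets_hausdorff1 refl]) auto
  qed (use emeasure_lev_finite[OF t] B t in \<open>auto simp: indicator_def\<close>)
qed

text \<open>
  A partition of unity splits \<open>w\<close> into pieces supported in charts, whose level integrals are continuous,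
  and pieces supported in discs of radius \<open>\<epsilon>\<close> around the critical points, whose level integrals are
  at most \<open>B K \<epsilon>\<close> in absolute value.  So the level integral of \<open>w\<close> is a uniform limit of continuous
  functions.
\<close>

theorem continuous_level_integral:
  fixes w :: "real^2 \<Rightarrow> real"
  assumes w: "continuous_on \<Omega> w"
  shows "continuous_on {a..b} (\<lambda>t. LINT z:lev t|hausdorff1. w z)"
proof (cases "S = {}")
  case True
  then have "lev t = {}" if "t \<in> {a..b}" for t using that by auto
  then show ?thesis by (intro continuous_on_eq[OF continuous_on_const[of _ 0]]) (auto simp: set_lebesgue_integral_def)
next
  case False
  obtain B where B: "0 \<le> B" "\<And>z. z \<in> S \<Longrightarrow> \<bar>w z\<bar> \<le> B" using bounded_on_S[OF w] by blast
  have crit: "\<exists>r>0. \<exists>K\<ge>0. \<forall>\<epsilon> t. 0 < \<epsilon> \<longrightarrow> \<epsilon> \<le> r \<longrightarrow> hausdorff1_outer (ball p \<epsilon> \<inter> f -` {t}) \<le> ennreal (K * \<epsilon>)"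
    if "p \<in> Crit" for p
  proof -
    from that have "p \<in> \<Omega>" "G p = 0" by (auto simp: Crit_def)
    from critical_level_bound[OF this nondegenerate[OF this]] show ?thesis by blast
  qed
  then obtain r K where rK: "\<And>p. p \<in> Crit \<Longrightarrow> 0 < r p" "\<And>p. p \<in> Crit \<Longrightarrow> 0 \<le> K p"
    "\<And>p t \<epsilon>. p \<in> Crit \<Longrightarrow> 0 < \<epsilon> \<Longrightarrow> \<epsilon> \<le> r p \<Longrightarrow> hausdorff1_outer (ball p \<epsilon> \<inter> f -` {t}) \<le> ennreal (K p * \<epsilon>)"
    by metis
  define good where "good p U \<longleftrightarrow> open U \<and> p \<in> U \<and> bounded U \<and> (\<forall>w :: real^2 \<Rightarrow> real. continuous_on \<Omega> w \<longrightarrow>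
    (\<forall>z\<in>\<Omega> - U. w z = 0) \<longrightarrow> continuous_on UNIV (\<lambda>t. LINT z:\<Omega> \<inter> f -` {t}|hausdorff1. w z))" for p U
  have "\<exists>U. good p U" if "p \<in> S - Crit" for p
    unfolding good_def by (rule continuous_level_integral_near_regular) (use S_diff_Crit that in blast)
  then obtain U0 where U0_good: "\<And>p. p \<in> S - Crit \<Longrightarrow> good p (U0 p)" by metis
  have U0: "open (U0 p)" "p \<in> U0 p" "bounded (U0 p)" if "p \<in> S - Crit" for p
    using U0_good[OF that] by (auto simp: good_def)
  have U0_cont: "continuous_on UNIV (\<lambda>t. LINT z:lev t|hausdorff1. w z)"
    if "p \<in> S - Crit" "continuous_on \<Omega> w" "\<And>z. z \<in> \<Omega> - U0 p \<Longrightarrow> w z = 0" for p and w :: "real^2 \<Rightarrow> real"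
    using U0_good[OF that(1)] that(2,3) by (auto simp: good_def)
  show ?thesis
  proof (rule continuous_on_uniform_approx)
    fix e :: real assume e: "0 < e"
    define N where "N = real (card Crit) + 1"
    have N: "0 < N" by (simp add: N_def add_nonneg_pos)
    (* radii so small that all critical discs together contribute at most e *)
    define \<epsilon> where "\<epsilon> p = min (r p) (e / (N * (B * K p + 1)))" for p
    have BK: "0 < B * K p + 1" if "p \<in> Crit" for p using B(1) rK(2)[OF that] by (simp add: add_nonneg_pos)
    have \<epsilon>: "0 < \<epsilon> p" "\<epsilon> p \<le> r p" "B * (K p * \<epsilon> p) \<le> e / N" if p: "p \<in> Crit" for p
    proof -
      have pos: "0 < N * (B * K p + 1)" using N BK[OF p] by simp
      show "0 < \<epsilon> p" "\<epsilon> p \<le> r p" using pos e rK(1)[OF p] by (auto simp: \<epsilon>_def)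
      then have "B * (K p * \<epsilon> p) \<le> (B * K p + 1) * \<epsilon> p" by (simp add: algebra_simps)
      also have "\<dots> \<le> (B * K p + 1) * (e / (N * (B * K p + 1)))"
        using BK[OF p] by (intro mult_left_mono) (auto simp: \<epsilon>_def)
      also have "\<dots> = e / N" using BK[OF p] by simp
      finally show "B * (K p * \<epsilon> p) \<le> e / N" .
    qed
    define U where "U p = (if p \<in> Crit then ball p (\<epsilon> p) else U0 p)" for p
    have U: "open (U p)" "p \<in> U p" "- U p \<noteq> {}" if "p \<in> S" for p
    proof -
      have "bounded (U p)" using that U0(3) by (auto simp: U_def)
      then have "U p \<noteq> UNIV" using not_bounded_UNIV by metis
      then show "- U p \<noteq> {}" by auto
    qed (use that U0(1,2) \<epsilon>(1) in \<open>auto simp: U_def\<close>)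
    have cover: "S \<subseteq> (\<Union>p\<in>S. U p)" using U(2) by blast
    obtain D where D: "D \<subseteq> S" "finite D" "S \<subseteq> (\<Union>p\<in>D. U p)"
      by (rule compactE_image[OF compact_strip U(1) cover])
    define \<rho> where "\<rho> p x = infdist x (- U p)" for p x
    have \<rho>_pos: "0 < \<rho> p x \<longleftrightarrow> x \<in> U p" if "p \<in> D" for p x
    proof -
      have "closed (- U p)" "- U p \<noteq> {}" using U[OF subsetD[OF D(1) that]] by auto
      then show ?thesis using in_closed_iff_infdist_zero[of "- U p" x] infdist_nonneg[of x "- U p"]
        by (auto simp: \<rho>_def less_le)
    qed
    have \<rho>_nonneg: "0 \<le> \<rho> p x" for p x by (simp add: \<rho>_def infdist_nonneg)
    define \<tau> where "\<tau> x = (\<Sum>p\<in>D. \<rho> p x)" for x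
    have \<tau>c: "continuous_on UNIV \<tau>" unfolding \<tau>_def \<rho>_def by (intro continuous_intros)
    have \<tau>_pos: "0 < \<tau> x" if x: "x \<in> S" for x
    proof -
      obtain p where "p \<in> D" "x \<in> U p" using subsetD[OF D(3) x] by blast
      then show ?thesis unfolding \<tau>_def using D(2) \<rho>_nonneg \<rho>_pos by (intro sum_pos2[of D p]) auto
    qed
    obtain x0 where x0: "x0 \<in> S" "\<And>x. x \<in> S \<Longrightarrow> \<tau> x0 \<le> \<tau> x"
      using continuous_attains_inf[OF compact_strip False continuous_on_subset[OF \<tau>c]] by blast
    (* \<tau> is bounded below only on S; away from S the maximum keeps the quotient continuous *)
    define \<tau>' where "\<tau>' x = max (\<tau> x) (\<tau> x0)" for x
    have \<tau>': "0 < \<tau>' x" for x using \<tau>_pos[OF x0(1)] by (simp add: \<tau>'_def less_max_iff_disj)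
    have \<tau>'S: "\<tau>' x = \<tau> x" if "x \<in> S" for x using x0(2)[OF that] by (simp add: \<tau>'_def)
    define v where "v p x = w x * \<rho> p x / \<tau>' x" for p x
    have vc: "continuous_on \<Omega> (v p)" for p
      unfolding v_def[abs_def] \<tau>'_def \<rho>_def
      by (intro continuous_intros w continuous_on_subset[OF \<tau>c])
        (use \<tau>_pos[OF x0(1)] in \<open>auto simp: max_def split: if_splits\<close>)
    have v_sum: "w x = (\<Sum>p\<in>D. v p x)" if "x \<in> S" for x
    proof -
      have "(\<Sum>p\<in>D. v p x) = w x * \<tau> x / \<tau>' x"
        unfolding v_def \<tau>_def by (simp add: sum_distrib_left sum_divide_distrib)
      then show ?thesis using \<tau>'S[OF that] \<tau>_pos[OF that] by simp
    qed
    have v_bound: "\<bar>v p x\<bar> \<le> B * indicator (U p) x" if "x \<in> S" "p \<in> D" for x p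
    proof (cases "x \<in> U p")
      case True
      have "\<rho> p x \<le> \<tau> x" unfolding \<tau>_def using D(2) that \<rho>_nonneg by (intro member_le_sum) auto
      then have "\<rho> p x / \<tau>' x \<le> 1" using \<tau>'S[OF that(1)] \<tau>_pos[OF that(1)] by simp
      then have "\<bar>w x\<bar> * (\<rho> p x / \<tau>' x) \<le> B * 1"
        using B(2)[OF that(1)] B(1) \<tau>'[of x] \<rho>_nonneg[of p x] by (intro mult_mono) auto
      then show ?thesis using True \<tau>'[of x] \<rho>_nonneg[of p x] by (simp add: v_def abs_mult)
    next
      case False
      then have "\<rho> p x = 0" using \<rho>_pos[OF that(2), of x] \<rho>_nonneg[of p x] by simp
      then show ?thesis by (simp add: v_def False)
    qed
    define A where "A p t = (LINT z:lev t|hausdorff1. v p z)" for p t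
    define A' where "A' t = (\<Sum>p\<in>D - Crit. A p t)" for t
    have "continuous_on {a..b} (A p)" if p: "p \<in> D - Crit" for p
    proof -
      have "v p z = 0" if "z \<in> \<Omega> - U0 p" for z
        using that \<rho>_pos[of p z] \<rho>_nonneg[of p z] p by (auto simp: v_def U_def)
      then have "continuous_on UNIV (A p)"
        unfolding A_def[abs_def] using p D(1) by (intro U0_cont[of p] vc) auto
      then show ?thesis by (rule continuous_on_subset) simp
    qed
    then have "continuous_on {a..b} A'" unfolding A'_def[abs_def] by (intro continuous_on_sum) auto
    moreover have "\<bar>(LINT z:lev t|hausdorff1. w z) - A' t\<bar> \<le> e" if t: "t \<in> {a..b}" for t
    proof -
      have "(LINT z:lev t|hausdorff1. w z) = (LINT z:lev t|hausdorff1. (\<Sum>p\<in>D. v p z))"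
        using v_sum lev_subset[OF t] by (intro set_lebesgue_integral_cong) auto
      also have "\<dots> = (\<Sum>p\<in>D. A p t)"
        unfolding A_def using set_integrable_lev[OF vc t]
        by (simp add: set_lebesgue_integral_def set_integrable_def sum_distrib_left)
      also have "\<dots> = A' t + (\<Sum>p\<in>D \<inter> Crit. A p t)"
        unfolding A'_def using D(2) by (metis Int_Diff_Un sum.Int_Diff add.commute)
      finally have eq: "(LINT z:lev t|hausdorff1. w z) - A' t = (\<Sum>p\<in>D \<inter> Crit. A p t)" by simp
      have Ap: "\<bar>A p t\<bar> \<le> e / N" if p: "p \<in> D \<inter> Crit" for p
      proof -
        have fin: "emeasure hausdorff1 (lev t \<inter> ball p (\<epsilon> p)) < \<infinity>"
          by (rule le_less_trans[OF emeasure_mono emeasure_lev_finite[OF t]]) auto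
        have "\<bar>A p t\<bar> \<le> (\<integral>z. norm (indicator (lev t) z *\<^sub>R v p z) \<partial>hausdorff1)"
          unfolding A_def set_lebesgue_integral_def real_norm_def[symmetric] by (rule integral_norm_bound)
        also have "\<dots> \<le> (\<integral>z. B * indicator (lev t \<inter> ball p (\<epsilon> p)) z \<partial>hausdorff1)"
        proof (rule integral_mono)
          show "integrable hausdorff1 (\<lambda>z. norm (indicator (lev t) z *\<^sub>R v p z))"
            using set_integrable_lev[OF vc t] unfolding set_integrable_def by (rule integrable_norm)
          show "integrable hausdorff1 (\<lambda>z. B * indicator (lev t \<inter> ball p (\<epsilon> p)) z)"
            using fin by (intro integrable_mult_right integrable_real_indicator) auto
          show "norm (indicator (lev t) z *\<^sub>R v p z) \<le> B * indicator (lev t \<inter> ball p (\<epsilon> p)) z" for z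
          proof (cases "z \<in> lev t")
            case True
            then have "z \<in> S" using lev_subset[OF t] by auto
            from v_bound[OF this, of p] show ?thesis using True p by (simp add: U_def indicator_inter_arith)
          qed (use B(1) in simp)
        qed
        also have "\<dots> = B * measure hausdorff1 (lev t \<inter> ball p (\<epsilon> p))" by simp
        also have "\<dots> \<le> B * (K p * \<epsilon> p)"
        proof (rule mult_left_mono[OF _ B(1)])
          have "emeasure hausdorff1 (lev t \<inter> ball p (\<epsilon> p)) = hausdorff1_outer (lev t \<inter> ball p (\<epsilon> p))"
            by (rule emeasure_hausdorff1) simp
          also have "\<dots> \<le> hausdorff1_outer (ball p (\<epsilon> p) \<inter> f -` {t})"
            by (rule hausdorff1_outer_mono) auto
          also have "\<dots> \<le> ennreal (K p * \<epsilon> p)" using p \<epsilon> by (intro rK(3)) auto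
          finally show "measure hausdorff1 (lev t \<inter> ball p (\<epsilon> p)) \<le> K p * \<epsilon> p"
            using p \<epsilon>(1)[of p] rK(2)[of p] by (auto simp: measure_def intro!: enn2real_leI mult_nonneg_nonneg)
        qed
        also have "\<dots> \<le> e / N" using p \<epsilon>(3) by auto
        finally show ?thesis .
      qed
      have "\<bar>\<Sum>p\<in>D \<inter> Crit. A p t\<bar> \<le> (\<Sum>p\<in>D \<inter> Crit. \<bar>A p t\<bar>)" by (rule sum_abs)
      also have "\<dots> \<le> (\<Sum>p\<in>D \<inter> Crit. e / N)" by (rule sum_mono[OF Ap])
      also have "\<dots> \<le> real (card Crit) * (e / N)"
        using e N finite_Crit by (simp add: card_mono divide_right_mono mult_right_mono)
      also have "\<dots> \<le> N * (e / N)" using e N by (intro mult_right_mono) (auto simp: N_def)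
      also have "\<dots> = e" using N by simp
      finally show ?thesis by (simp only: eq)
    qed
    ultimately show "\<exists>A'. continuous_on {a..b} A' \<and> (\<forall>t\<in>{a..b}. \<bar>(LINT z:lev t|hausdorff1. w z) - A' t\<bar> \<le> e)"
      by blast
  qed
qed

end

section \<open>The coarea formula on a compact strip\<close>

text \<open>
  Dyadic decomposition: on the annulus between the radii \<open>r/2\<^sup>k\<^sup>+\<^sup>1\<close> and \<open>r/2\<^sup>k\<close> the integrand is at most
  \<open>2\<^sup>k\<^sup>+\<^sup>1/r\<close>, and the disc of the outer radius has area proportional to \<open>r\<^sup>2/4\<^sup>k\<close>; the products form a
  convergent geometric series.
\<close>

lemma nn_integral_inverse_dist_ball:
  fixes p :: "real^2"
  shows "(\<integral>\<^sup>+x. ennreal (indicator (ball p r) x / norm (x - p)) \<partial>lborel) < \<infinity>"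
proof (cases "0 < r")
  case False
  then have e: "ball p r = {}" by simp
  show ?thesis unfolding e by simp
next
  case r: True
  define c where "c k = 2 ^ Suc k / r" for k :: nat
  define q where "q k = r / 2 ^ k" for k :: nat
  have q: "0 < q k" "c k * q k = 2" "1 / q (Suc k) = c k" for k using r by (auto simp: q_def c_def)
  have term_le: "F k \<le> (\<Sum>k. F k)" for F :: "nat \<Rightarrow> ennreal" and k
    using sum_le_suminf[of F "{k}"] by (simp add: summableI)
  have cpos: "0 \<le> c k" for k using r by (simp add: c_def)
  have "ennreal (indicator (ball p r) x / norm (x - p)) \<le> (\<Sum>k. ennreal (c k) * indicator (ball p (q k)) x)" for x
  proof (cases "x \<in> ball p r \<and> x \<noteq> p")
    case True
    then have d: "0 < norm (x - p)" "norm (x - p) < r" by (auto simp: dist_norm norm_minus_commute)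
    have "\<exists>n. q n \<le> norm (x - p)"
    proof -
      obtain n where "r / norm (x - p) < 2 ^ n" using real_arch_pow[of 2] by auto
      then show ?thesis using d by (intro exI[of _ n]) (simp add: q_def field_simps)
    qed
    then have L: "q (LEAST n. q n \<le> norm (x - p)) \<le> norm (x - p)" by (rule LeastI_ex)
    have "(LEAST n. q n \<le> norm (x - p)) \<noteq> 0"
      using L d by (metis div_by_1 not_le power_0 q_def)
    then obtain k where k: "(LEAST n. q n \<le> norm (x - p)) = Suc k" using not0_implies_Suc by blast
    have "q (Suc k) \<le> norm (x - p)" using L k by simp
    moreover have "\<not> q k \<le> norm (x - p)" using k not_less_Least[of k "\<lambda>n. q n \<le> norm (x - p)"] by simp
    ultimately have *: "1 / norm (x - p) \<le> c k" "x \<in> ball p (q k)"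
      using q(3)[of k] q(1)[of "Suc k"] by (auto simp: dist_norm norm_minus_commute frac_le simp flip: q(3))
    have "ennreal (indicator (ball p r) x / norm (x - p)) \<le> ennreal (c k) * indicator (ball p (q k)) x"
      using True * by (simp add: ennreal_leI)
    also have "\<dots> \<le> (\<Sum>k. ennreal (c k) * indicator (ball p (q k)) x)" by (rule term_le)
    finally show ?thesis .
  qed (auto simp: indicator_def)
  then have "(\<integral>\<^sup>+x. ennreal (indicator (ball p r) x / norm (x - p)) \<partial>lborel)
      \<le> (\<integral>\<^sup>+x. (\<Sum>k. ennreal (c k) * indicator (ball p (q k)) x) \<partial>lborel)"
    by (intro nn_integral_mono)
  also have "\<dots> = (\<Sum>k. \<integral>\<^sup>+x. ennreal (c k) * indicator (ball p (q k)) x \<partial>lborel)"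
    by (rule nn_integral_suminf) (auto intro!: borel_measurable_times_ennreal borel_measurable_indicator)
  also have "\<dots> = (\<Sum>k. ennreal (c k) * emeasure lborel (ball p (q k)))"
    by (intro suminf_cong nn_integral_cmult_indicator) auto
  also have "\<dots> = (\<Sum>k. ennreal (2 * unit_ball_vol 2 * r * (1 / 2) ^ k))"
  proof (rule suminf_cong)
    fix k
    have "emeasure lborel (ball p (q k)) = ennreal (unit_ball_vol 2 * (q k)\<^sup>2)"
      using emeasure_ball[of "q k" p] q(1)[of k] by simp
    then have "ennreal (c k) * emeasure lborel (ball p (q k)) = ennreal (c k * (unit_ball_vol 2 * (q k)\<^sup>2))"
      using cpos by (simp add: ennreal_mult')
    also have "c k * (unit_ball_vol 2 * (q k)\<^sup>2) = (c k * q k) * unit_ball_vol 2 * q k"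
      by (simp add: power2_eq_square)
    also have "\<dots> = 2 * unit_ball_vol 2 * r * (1 / 2) ^ k"
      unfolding q(2) by (simp add: q_def power_one_over)
    finally show "ennreal (c k) * emeasure lborel (ball p (q k)) = ennreal (2 * unit_ball_vol 2 * r * (1 / 2) ^ k)" .
  qed
  also have "\<dots> < \<infinity>"
  proof -
    have "summable (\<lambda>k. 2 * unit_ball_vol 2 * r * (1 / 2 :: real) ^ k)"
      by (intro summable_mult summable_geometric) simp
    then have "(\<Sum>k. ennreal (2 * unit_ball_vol 2 * r * (1 / 2) ^ k)) = ennreal (\<Sum>k. 2 * unit_ball_vol 2 * r * (1 / 2) ^ k)"
      using r unit_ball_vol_nonneg[of 2] by (intro suminf_ennreal2) auto
    then show ?thesis by simp
  qed
  finally show ?thesis .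
qed

context strip
begin

lemma Crit_null: "Crit \<in> null_sets hausdorff1" "Crit \<in> null_sets lborel"
proof -
  have C: "Crit = (\<Union>p\<in>Crit. {p})" by auto
  have "hausdorff1_outer Crit \<le> (\<Sum>p\<in>Crit. hausdorff1_outer {p})"
    using hausdorff1_outer_finite_Union[OF finite_Crit, of "\<lambda>p. {p}"] C by simp
  then have "hausdorff1_outer Crit = 0" by (simp add: hausdorff1_outer_singleton)
  moreover have "Crit \<in> sets borel" using finite_Crit by (intro borel_closed finite_imp_closed)
  ultimately show "Crit \<in> null_sets hausdorff1" by (intro null_setsI) (auto simp: emeasure_hausdorff1)
  show "Crit \<in> null_sets lborel" using finite_Crit by (rule finite_imp_null_set_lborel)
qed

lemma coarea_strip:
  assumes \<phi>[measurable]: "\<phi> \<in> borel_measurable borel"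
  shows "(\<lambda>t. (\<integral>\<^sup>+z. \<phi> z * indicator (lev t) z \<partial>hausdorff1) * indicator {a..b} t) \<in> borel_measurable borel"
    and "(\<integral>\<^sup>+z. \<phi> z * ennreal (norm (G z)) * indicator S z \<partial>lborel) =
      (\<integral>\<^sup>+t. (\<integral>\<^sup>+z. \<phi> z * indicator (lev t) z \<partial>hausdorff1) * indicator {a..b} t \<partial>lborel)"
proof -
  have m: "(\<lambda>z. \<phi> z * indicator S z) \<in> borel_measurable borel" by measurable
  have eq: "(\<integral>\<^sup>+z. \<phi> z * indicator S z * indicator (regular \<inter> f -` {t}) z \<partial>hausdorff1) =
      (\<integral>\<^sup>+z. \<phi> z * indicator (lev t) z \<partial>hausdorff1) * indicator {a..b} t" for t
  proof (cases "t \<in> {a..b}")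
    case True
    have "(\<integral>\<^sup>+z. \<phi> z * indicator S z * indicator (regular \<inter> f -` {t}) z \<partial>hausdorff1) =
        (\<integral>\<^sup>+z. \<phi> z * indicator (lev t) z \<partial>hausdorff1)"
    proof (rule nn_integral_cong_AE)
      show "AE z in hausdorff1. \<phi> z * indicator S z * indicator (regular \<inter> f -` {t}) z = \<phi> z * indicator (lev t) z"
        using AE_not_in[OF Crit_null(1)]
        by eventually_elim (use True in \<open>auto simp: indicator_def regular_def Crit_def\<close>)
    qed
    then show ?thesis using True by simp
  next
    case False
    then have "\<phi> z * indicator S z * indicator (regular \<inter> f -` {t}) z = 0" for z by (auto simp: indicator_def)
    then show ?thesis using False by (simp only: nn_integral_const) simp
  qed
  show "(\<lambda>t. (\<integral>\<^sup>+z. \<phi> z * indicator (lev t) z \<partial>hausdorff1) * indicator {a..b} t) \<in> borel_measurable borel"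
    using coarea(1)[OF m] by (simp only: eq)
  have "(\<integral>\<^sup>+z. \<phi> z * ennreal (norm (G z)) * indicator S z \<partial>lborel) =
      (\<integral>\<^sup>+z. \<phi> z * indicator S z * ennreal (norm (G z)) * indicator regular z \<partial>lborel)"
    by (intro nn_integral_cong) (auto simp: indicator_def regular_def)
  then show "(\<integral>\<^sup>+z. \<phi> z * ennreal (norm (G z)) * indicator S z \<partial>lborel) =
      (\<integral>\<^sup>+t. (\<integral>\<^sup>+z. \<phi> z * indicator (lev t) z \<partial>hausdorff1) * indicator {a..b} t \<partial>lborel)"
    by (simp only: coarea(2)[OF m] eq)
qed

lemma set_integrable_S:
  fixes w :: "real^2 \<Rightarrow> real"
  shows "continuous_on \<Omega> w \<Longrightarrow> set_integrable lborel S w"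
  unfolding set_integrable_def
  by (rule borel_integrable_compact[OF compact_strip]) (auto intro: continuous_on_subset)

lemma coarea_continuous_nonneg:
  fixes w :: "real^2 \<Rightarrow> real"
  assumes w: "continuous_on \<Omega> w" and nn: "\<And>z. z \<in> \<Omega> \<Longrightarrow> 0 \<le> w z"
  shows "(LINT z:S|lborel. w z * norm (G z)) = (LINT t:{a..b}|lborel. LINT z:lev t|hausdorff1. w z)"
proof -
  have wG: "continuous_on \<Omega> (\<lambda>z. w z * norm (G z))" by (intro continuous_intros w continuous_on_G)
  have wGm: "(\<lambda>z. indicator S z *\<^sub>R (w z * norm (G z))) \<in> borel_measurable lborel"
    using borel_measurable_indicator_continuous[OF wG sets_S] by simp
  define \<phi> where "\<phi> z = ennreal (indicator \<Omega> z *\<^sub>R w z)" for z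
  have [measurable]: "\<phi> \<in> borel_measurable borel"
    unfolding \<phi>_def using borel_measurable_indicator_continuous[OF w, of \<Omega>] open_\<Omega> by auto
  define A where "A t = (LINT z:lev t|hausdorff1. w z)" for t
  have A_nonneg: "0 \<le> A t" for t
    unfolding A_def set_lebesgue_integral_def using nn by (intro integral_nonneg_AE AE_I2) (auto simp: indicator_def)
  have inner: "(\<integral>\<^sup>+z. \<phi> z * indicator (lev t) z \<partial>hausdorff1) = ennreal (A t)" if t: "t \<in> {a..b}" for t
  proof -
    have "(\<integral>\<^sup>+z. \<phi> z * indicator (lev t) z \<partial>hausdorff1) = (\<integral>\<^sup>+z. ennreal (indicator (lev t) z *\<^sub>R w z) \<partial>hausdorff1)"
      by (intro nn_integral_cong) (auto simp: \<phi>_def indicator_def)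
    also have "\<dots> = ennreal (A t)"
      unfolding A_def set_lebesgue_integral_def using nn set_integrable_lev[OF w t]
      by (intro nn_integral_eq_integral AE_I2) (auto simp: set_integrable_def indicator_def)
    finally show ?thesis .
  qed
  have Ac: "continuous_on {a..b} A" unfolding A_def by (rule continuous_level_integral[OF w])
  have "(LINT z:S|lborel. w z * norm (G z)) = enn2real (\<integral>\<^sup>+z. ennreal (indicator S z *\<^sub>R (w z * norm (G z))) \<partial>lborel)"
    unfolding set_lebesgue_integral_def using nn
    by (intro integral_eq_nn_integral wGm AE_I2) (auto simp: indicator_def)
  also have "(\<integral>\<^sup>+z. ennreal (indicator S z *\<^sub>R (w z * norm (G z))) \<partial>lborel) =
      (\<integral>\<^sup>+z. \<phi> z * ennreal (norm (G z)) * indicator S z \<partial>lborel)"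
    using nn by (intro nn_integral_cong) (auto simp: \<phi>_def indicator_def ennreal_mult)
  also have "\<dots> = (\<integral>\<^sup>+t. (\<integral>\<^sup>+z. \<phi> z * indicator (lev t) z \<partial>hausdorff1) * indicator {a..b} t \<partial>lborel)"
    by (rule coarea_strip) simp
  also have "\<dots> = (\<integral>\<^sup>+t. ennreal (indicator {a..b} t *\<^sub>R A t) \<partial>lborel)"
    using inner by (intro nn_integral_cong) (auto simp: indicator_def)
  also have "enn2real \<dots> = (LINT t:{a..b}|lborel. A t)"
    unfolding set_lebesgue_integral_def using A_nonneg borel_measurable_continuous_on_indicator[OF _ Ac]
    by (intro integral_eq_nn_integral[symmetric] AE_I2) auto
  finally show ?thesis by (simp add: A_def)
qed

theorem coarea_continuous:
  fixes w :: "real^2 \<Rightarrow> real"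
  assumes w: "continuous_on \<Omega> w"
  shows "(LINT z:S|lborel. w z * norm (G z)) = (LINT t:{a..b}|lborel. LINT z:lev t|hausdorff1. w z)"
proof -
  define u v where "u z = max (w z) 0" and "v z = max (- w z) 0" for z
  have c: "continuous_on \<Omega> u" "continuous_on \<Omega> v" unfolding u_def[abs_def] v_def[abs_def] by (intro continuous_intros w)+
  have cG: "continuous_on \<Omega> (\<lambda>z. u z * norm (G z))" "continuous_on \<Omega> (\<lambda>z. v z * norm (G z))"
    by (intro continuous_intros c continuous_on_G)+
  have w_eq: "w z = u z - v z" for z by (auto simp: u_def v_def)
  have "(LINT z:S|lborel. w z * norm (G z)) = (LINT z:S|lborel. u z * norm (G z)) - (LINT z:S|lborel. v z * norm (G z))"
    unfolding w_eq left_diff_distrib by (intro set_integral_diff set_integrable_S cG)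
  also have "\<dots> = (LINT t:{a..b}|lborel. LINT z:lev t|hausdorff1. u z) - (LINT t:{a..b}|lborel. LINT z:lev t|hausdorff1. v z)"
    by (intro arg_cong2[where f = "(-)"] coarea_continuous_nonneg c) (auto simp: u_def v_def)
  also have "\<dots> = (LINT t:{a..b}|lborel. (LINT z:lev t|hausdorff1. u z) - (LINT z:lev t|hausdorff1. v z))"
    by (intro set_integral_diff(2)[symmetric] borel_integrable_atLeastAtMost' continuous_level_integral c)
  also have "\<dots> = (LINT t:{a..b}|lborel. LINT z:lev t|hausdorff1. w z)"
    unfolding w_eq by (intro set_lebesgue_integral_cong) (auto simp: set_integral_diff set_integrable_lev c)
  finally show ?thesis .
qed

lemma level_length_eq: "level_length \<Omega> f t = (LINT z:lev t|hausdorff1. 1)"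
  by (simp add: level_length_def set_lebesgue_integral_def)

lemma continuous_on_level_length: "continuous_on {a..b} (level_length \<Omega> f)"
  unfolding level_length_eq[abs_def] by (rule continuous_level_integral) (rule continuous_on_const)

lemma emeasure_lev: "t \<in> {a..b} \<Longrightarrow> emeasure hausdorff1 (lev t) = ennreal (level_length \<Omega> f t)"
  using emeasure_lev_finite[of t] by (auto simp: level_length_def measure_def)

lemma level_length_nonneg: "0 \<le> level_length \<Omega> f t" by (simp add: level_length_def)

lemma integral_continuous_level:
  fixes h :: "real \<Rightarrow> real"
  assumes "continuous_on UNIV h"
  shows "(LINT z:S|lborel. h (f z) * norm (G z)) = (LINT t:{a..b}|lborel. h t * level_length \<Omega> f t)"
proof -
  have "continuous_on \<Omega> (\<lambda>z. h (f z))" by (rule continuous_on_compose2[OF assms continuous_on_f]) auto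
  then have "(LINT z:S|lborel. h (f z) * norm (G z)) = (LINT t:{a..b}|lborel. LINT z:lev t|hausdorff1. h (f z))"
    by (rule coarea_continuous)
  also have "\<dots> = (LINT t:{a..b}|lborel. h t * level_length \<Omega> f t)"
  proof -
    have "(LINT z:lev t|hausdorff1. h (f z)) = h t * level_length \<Omega> f t" for t
    proof -
      have "(LINT z:lev t|hausdorff1. h (f z)) = (LINT z:lev t|hausdorff1. h t)"
        by (intro set_lebesgue_integral_cong) auto
      then show ?thesis by (simp add: level_length_def set_lebesgue_integral_def)
    qed
    then show ?thesis by simp
  qed
  finally show ?thesis .
qed

lemma integrable_inverse_gradient: "set_integrable lborel S (\<lambda>z. 1 / norm (G z))"
proof -
  have crit: "\<exists>r>0. \<exists>c>0. \<forall>x\<in>ball p r. c * norm (x - p) \<le> norm (G x)" if "p \<in> Crit" for p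
  proof -
    from that have "p \<in> \<Omega>" "G p = 0" by (auto simp: Crit_def)
    from critical_level_bound[OF this nondegenerate[OF this]] show ?thesis by blast
  qed
  then obtain r c where rc: "\<And>p. p \<in> Crit \<Longrightarrow> 0 < r p" "\<And>p. p \<in> Crit \<Longrightarrow> 0 < c p"
    "\<And>p x. p \<in> Crit \<Longrightarrow> x \<in> ball p (r p) \<Longrightarrow> c p * norm (x - p) \<le> norm (G x)" by metis
  define T where "T = S - (\<Union>p\<in>Crit. ball p (r p))"
  have "compact T" unfolding T_def by (intro compact_diff compact_strip open_UN) auto
  have "continuous_on T (\<lambda>z. 1 / norm (G z))"
  proof (intro continuous_intros continuous_on_subset[OF continuous_on_G])
    show "\<forall>x\<in>T. norm (G x) \<noteq> 0" using rc(1) by (force simp: T_def Crit_def)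
  qed (auto simp: T_def)
  from compact_imp_bounded[OF compact_continuous_image[OF this \<open>compact T\<close>]]
  obtain M where M: "\<And>z. z \<in> T \<Longrightarrow> \<bar>1 / norm (G z)\<bar> \<le> M" by (auto simp: bounded_iff)
  define F where "F z = ennreal \<bar>M\<bar> * indicator S z + (\<Sum>p\<in>Crit. ennreal (1 / c p) * ennreal (indicator (ball p (r p)) z / norm (z - p)))" for z
  have le: "ennreal (indicator S z *\<^sub>R (1 / norm (G z))) \<le> F z" for z
  proof (cases "z \<in> S \<and> G z \<noteq> 0")
    case True
    show ?thesis
    proof (cases "z \<in> T")
      case True
      then have "ennreal (indicator S z *\<^sub>R (1 / norm (G z))) \<le> ennreal \<bar>M\<bar> * indicator S z"
        using M[OF True] by (auto simp: T_def intro!: ennreal_leI)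
      then show ?thesis unfolding F_def by (rule order_trans) simp
    next
      case False
      then obtain p where p: "p \<in> Crit" "z \<in> ball p (r p)" using True by (auto simp: T_def)
      then have zp: "0 < norm (z - p)" using True by (auto simp: Crit_def)
      have "1 / norm (G z) \<le> 1 / (c p * norm (z - p))"
        using rc(2)[OF p(1)] rc(3)[OF p] zp True by (intro divide_left_mono mult_pos_pos) auto
      then have "ennreal (indicator S z *\<^sub>R (1 / norm (G z))) \<le> ennreal (1 / c p * (indicator (ball p (r p)) z / norm (z - p)))"
        using True p by (auto intro!: ennreal_leI)
      also have "\<dots> = ennreal (1 / c p) * ennreal (indicator (ball p (r p)) z / norm (z - p))"
        using rc(2)[OF p(1)] by (intro ennreal_mult) auto
      also have "\<dots> \<le> (\<Sum>p\<in>Crit. ennreal (1 / c p) * ennreal (indicator (ball p (r p)) z / norm (z - p)))"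
        using p(1) finite_Crit by (intro member_le_sum) auto
      also have "\<dots> \<le> F z" by (simp add: F_def)
      finally show ?thesis .
    qed
  qed (auto simp: indicator_def)
  have [measurable]: "(\<lambda>z. indicator S z *\<^sub>R norm (G z)) \<in> borel_measurable borel"
    by (intro borel_measurable_indicator_continuous continuous_on_norm continuous_on_G) auto
  have "(\<lambda>z. 1 / (indicator S z *\<^sub>R norm (G z))) \<in> borel_measurable borel" by measurable
  moreover have "1 / (indicator S z *\<^sub>R norm (G z)) = indicator S z *\<^sub>R (1 / norm (G z))" for z by (auto simp: indicator_def)
  ultimately have meas: "(\<lambda>z. indicator S z *\<^sub>R (1 / norm (G z))) \<in> borel_measurable lborel" by simp
  have "(\<integral>\<^sup>+z. ennreal (norm (indicator S z *\<^sub>R (1 / norm (G z)))) \<partial>lborel) \<le> (\<integral>\<^sup>+z. F z \<partial>lborel)"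
    using le by (intro nn_integral_mono) auto
  also have "\<dots> = ennreal \<bar>M\<bar> * emeasure lborel S +
      (\<Sum>p\<in>Crit. ennreal (1 / c p) * (\<integral>\<^sup>+z. ennreal (indicator (ball p (r p)) z / norm (z - p)) \<partial>lborel))"
  proof -
    have m[measurable]: "(\<lambda>z. indicator (ball p (r p)) z / norm (z - p) :: real) \<in> borel_measurable borel" for p
      by (intro borel_measurable_divide borel_measurable_indicator) auto
    have "(\<integral>\<^sup>+z. ennreal (1 / c p) * ennreal (indicator (ball p (r p)) z / norm (z - p)) \<partial>lborel) =
        ennreal (1 / c p) * (\<integral>\<^sup>+z. ennreal (indicator (ball p (r p)) z / norm (z - p)) \<partial>lborel)" for p
      by (rule nn_integral_cmult) (simp add: m)
    then show ?thesis
      unfolding F_def by (subst nn_integral_add) (simp_all add: nn_integral_sum nn_integral_cmult_indicator m)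
  qed
  also have "\<dots> < \<infinity>"
    using nn_integral_inverse_dist_ball finite_Crit emeasure_bounded_finite[OF compact_imp_bounded[OF compact_strip]]
    by (simp add: ennreal_mult_less_top ennreal_add_less_top less_top[symmetric] ennreal_mult_eq_top_iff)
  finally show ?thesis using meas unfolding set_integrable_def by (rule integrableI_bounded[rotated])
qed

end

section \<open>Curvature of the level curves\<close>

lemma hessian_form_le:
  fixes H :: "real^2^2" and g :: "real^2"
  defines "C \<equiv> \<bar>H $ 1 $ 1\<bar> + \<bar>H $ 1 $ 2\<bar> + \<bar>H $ 2 $ 1\<bar> + \<bar>H $ 2 $ 2\<bar>"
  shows "\<bar>g \<bullet> (H *v g)\<bar> \<le> C * (g \<bullet> g)" "\<bar>H $ 1 $ 1 + H $ 2 $ 2\<bar> \<le> C"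
proof -
  have le: "\<bar>g $ k * (a * g $ l)\<bar> \<le> \<bar>a\<bar> * (g \<bullet> g)" for a k l
  proof -
    have "\<bar>g $ k * (a * g $ l)\<bar> = \<bar>a\<bar> * (\<bar>g $ k\<bar> * \<bar>g $ l\<bar>)" by (simp add: abs_mult)
    also have "\<dots> \<le> \<bar>a\<bar> * (norm g * norm g)"
      by (intro mult_left_mono mult_mono component_le_norm_cart) auto
    finally show ?thesis by (simp add: dot_square_norm power2_eq_square)
  qed
  have "g \<bullet> (H *v g) = g $ 1 * (H $ 1 $ 1 * g $ 1) + g $ 1 * (H $ 1 $ 2 * g $ 2) +
      g $ 2 * (H $ 2 $ 1 * g $ 1) + g $ 2 * (H $ 2 $ 2 * g $ 2)"
    by (simp add: inner_vec_def sum_2 matrix_vector_mult_def algebra_simps)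
  then have "\<bar>g \<bullet> (H *v g)\<bar> \<le> \<bar>H $ 1 $ 1\<bar> * (g \<bullet> g) + \<bar>H $ 1 $ 2\<bar> * (g \<bullet> g) + \<bar>H $ 2 $ 1\<bar> * (g \<bullet> g) + \<bar>H $ 2 $ 2\<bar> * (g \<bullet> g)"
    using le[of 1 "H $ 1 $ 1" 1] le[of 1 "H $ 1 $ 2" 2] le[of 2 "H $ 2 $ 1" 1] le[of 2 "H $ 2 $ 2" 2] by linarith
  then show "\<bar>g \<bullet> (H *v g)\<bar> \<le> C * (g \<bullet> g)" by (simp add: C_def distrib_right)
  show "\<bar>H $ 1 $ 1 + H $ 2 $ 2\<bar> \<le> C" by (simp add: C_def)
qed

context C2_function
begin

text \<open>
  The case \<open>\<epsilon> = 0\<close> differentiates the tangent field at regular points; positive \<open>\<epsilon>\<close> gives fields that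
  are differentiable at critical points as well.
\<close>

lemma has_derivative_normalized_gradient:
  assumes x: "x \<in> \<Omega>" and N: "N = (\<lambda>z. sqrt (G z \<bullet> G z + \<epsilon>))" and pos: "0 < G x \<bullet> G x + \<epsilon>"
  shows "((\<lambda>z. G z $ k / N z) has_derivative
    (\<lambda>h. (hessian f x *v h) $ k / N x - G x $ k * (G x \<bullet> (hessian f x *v h)) / (N x) ^ 3)) (at x)"
proof -
  have Nx: "0 < N x" using pos by (simp add: N)
  have "((\<lambda>z. G z \<bullet> G z + \<epsilon>) has_derivative (\<lambda>h. 2 * (G x \<bullet> (hessian f x *v h)))) (at x)"
    by (rule derivative_eq_intros has_derivative_G[OF x] refl)+ (auto simp: inner_commute)
  moreover have "(sqrt has_real_derivative inverse (sqrt (G x \<bullet> G x + \<epsilon>)) / 2) (at (G x \<bullet> G x + \<epsilon>))"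
    by (rule DERIV_real_sqrt[OF pos])
  ultimately have "((\<lambda>z. sqrt (G z \<bullet> G z + \<epsilon>)) has_derivative
      (\<lambda>h. inverse (sqrt (G x \<bullet> G x + \<epsilon>)) / 2 * (2 * (G x \<bullet> (hessian f x *v h))))) (at x)"
    unfolding has_field_derivative_def by (rule has_derivative_compose)
  then have dN: "(N has_derivative (\<lambda>h. (G x \<bullet> (hessian f x *v h)) / N x)) (at x)"
    by (simp add: N field_simps)
  show ?thesis
    by (rule has_derivative_eq_rhs[OF has_derivative_divide'[OF has_derivative_G_nth[OF x] dN]])
      (use Nx in \<open>auto simp: field_simps power3_eq_cube\<close>)
qed

text \<open>
  With \<open>H\<close> the Hessian, this is \<open>(tr H |\<nabla>f|\<^sup>2 - \<nabla>f \<bullet> H \<nabla>f)/|\<nabla>f|\<^sup>3\<close>, which expands to the classical formula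
  \<open>(f\<^sub>x\<^sub>x f\<^sub>y\<^sup>2 - 2 f\<^sub>x\<^sub>y f\<^sub>x f\<^sub>y + f\<^sub>y\<^sub>y f\<^sub>x\<^sup>2)/|\<nabla>f|\<^sup>3\<close> and is the divergence of \<open>\<nabla>f/|\<nabla>f|\<close>.  At critical points
  division by zero makes it \<open>0\<close>.
\<close>

definition curv :: "real^2 \<Rightarrow> real" where
  "curv x = ((hessian f x $ 1 $ 1 + hessian f x $ 2 $ 2) * (G x \<bullet> G x) - G x \<bullet> (hessian f x *v G x)) / norm (G x) ^ 3"

lemma level_tangent_nth:
  "level_tangent f x $ 1 = - (G x $ 2 / norm (G x))" "level_tangent f x $ 2 = G x $ 1 / norm (G x)"
  by (simp_all add: level_tangent_def level_normal_def divide_inverse mult.commute)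

lemma level_normal_nth: "level_normal f x $ k = - (G x $ k / norm (G x))"
  by (simp add: level_normal_def divide_inverse mult.commute)

text \<open>
  The derivative of the tangent field along itself is the acceleration of the unit speed level curve.
  Writing the unit normal as \<open>(p,q)\<close>, everything reduces to the relation \<open>p\<^sup>2 + q\<^sup>2 = 1\<close>.
\<close>

lemma level_tangent_derivative:
  assumes x: "x \<in> regular"
  shows "\<exists>D. (level_tangent f has_derivative D) (at x) \<and> D (level_tangent f x) = curv x *\<^sub>R level_normal f x"
proof -
  have xO: "x \<in> \<Omega>" and g0: "G x \<noteq> 0" using x by (auto simp: regular_def)
  define N where "N = (\<lambda>z. sqrt (G z \<bullet> G z + 0))"
  have Nn: "N z = norm (G z)" for z by (simp add: N_def norm_eq_sqrt_inner)
  have pos: "0 < G x \<bullet> G x + 0" using g0 by simp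
  define H where "H = hessian f x"
  define D' where "D' k h = (H *v h) $ k / N x - G x $ k * (G x \<bullet> (H *v h)) / (N x) ^ 3" for k h
  have dk: "((\<lambda>z. G z $ k / N z) has_derivative D' k) (at x)" for k
    using has_derivative_normalized_gradient[OF xO N_def pos, of k] by (simp add: D'_def[abs_def] H_def)
  define D where "D h = (vector [- D' 2 h, D' 1 h] :: real^2)" for h
  have "(level_tangent f has_derivative D) (at x)"
  proof (subst has_derivative_componentwise_within, rule ballI)
    fix e :: "real^2" assume "e \<in> Basis"
    then obtain k where e: "e = axis k 1" by (auto simp: Basis_vec_def)
    consider "k = 1" | "k = 2" using exhaust_2[of k] by blast
    then show "((\<lambda>z. level_tangent f z \<bullet> e) has_derivative (\<lambda>h. D h \<bullet> e)) (at x)"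
    proof cases
      case 1
      then show ?thesis using has_derivative_minus[OF dk[of 2]]
        by (simp add: e inner_axis level_tangent_nth D_def Nn)
    next
      case 2
      then show ?thesis using dk[of 1] by (simp add: e inner_axis level_tangent_nth D_def Nn)
    qed
  qed
  moreover have "D (level_tangent f x) = curv x *\<^sub>R level_normal f x"
  proof -
    define n where "n = N x"
    have n: "0 < n" "n = norm (G x)" using g0 by (auto simp: n_def Nn)
    define p q where "p = G x $ 1 / n" and "q = G x $ 2 / n"
    have pq: "G x $ 1 = n * p" "G x $ 2 = n * q" using n by (auto simp: p_def q_def)
    have "n\<^sup>2 = (G x $ 1)\<^sup>2 + (G x $ 2)\<^sup>2"
      unfolding n(2) power2_norm_eq_inner by (simp add: inner_vec_def sum_2 power2_eq_square)
    then have "n\<^sup>2 = (n * p)\<^sup>2 + (n * q)\<^sup>2" by (simp only: pq)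
    then have "n\<^sup>2 * (p\<^sup>2 + q\<^sup>2) = n\<^sup>2 * 1" by (simp add: power_mult_distrib algebra_simps)
    then have unit: "p\<^sup>2 + q\<^sup>2 = 1" using n(1) by (metis less_numeral_extra(3) mult_left_cancel power_not_zero)
    define T where "T = level_tangent f x"
    have T: "T $ 1 = - q" "T $ 2 = p"
      unfolding T_def level_tangent_nth by (simp_all add: p_def q_def n(2))
    define A B where "A = (H *v T) $ 1" and "B = (H *v T) $ 2"
    have AB: "A = H $ 1 $ 2 * p - H $ 1 $ 1 * q" "B = H $ 2 $ 2 * p - H $ 2 $ 1 * q"
      by (simp_all add: A_def B_def matrix_vector_mult_def sum_2 T)
    have D'1: "D' 1 T = (A - p * (p * A + q * B)) / n"
      using n(1) by (simp add: D'_def A_def[symmetric] B_def[symmetric] n_def[symmetric] inner_vec_def sum_2 pq field_simps power3_eq_cube)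
    have D'2: "D' 2 T = (B - q * (p * A + q * B)) / n"
      using n(1) by (simp add: D'_def A_def[symmetric] B_def[symmetric] n_def[symmetric] inner_vec_def sum_2 pq field_simps power3_eq_cube)
    have e1: "A - p * (p * A + q * B) = - q * (p * B - q * A)"
      using unit by algebra
    have e2: "B - q * (p * A + q * B) = p * (p * B - q * A)"
      using unit by algebra
    have "curv x = ((H $ 1 $ 1 + H $ 2 $ 2) * (n\<^sup>2 * (p\<^sup>2 + q\<^sup>2)) -
        n\<^sup>2 * (p * (H $ 1 $ 1 * p + H $ 1 $ 2 * q) + q * (H $ 2 $ 1 * p + H $ 2 $ 2 * q))) / n ^ 3"
      unfolding curv_def H_def[symmetric] n(2)[symmetric]
      by (simp add: inner_vec_def sum_2 matrix_vector_mult_def pq algebra_simps power2_eq_square)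
    also have "\<dots> = n\<^sup>2 * (p * B - q * A) / n ^ 3"
      by (simp add: AB algebra_simps power2_eq_square)
    also have "\<dots> = (p * B - q * A) / n"
      using n(1) by (simp add: power2_eq_square power3_eq_cube)
    finally have cv: "curv x = (p * B - q * A) / n" .
    have "D T $ k = (curv x *\<^sub>R level_normal f x) $ k" for k
    proof -
      consider "k = 1" | "k = 2" using exhaust_2[of k] by blast
      then show ?thesis
      proof cases
        case 1
        then show ?thesis by (simp add: D_def D'2 e2 level_normal_nth n(2)[symmetric] p_def[symmetric] cv)
      next
        case 2
        then show ?thesis by (simp add: D_def D'1 e1 level_normal_nth n(2)[symmetric] q_def[symmetric] cv)
      qed
    qed
    then show ?thesis by (simp add: vec_eq_iff T_def)
  qed
  ultimately show ?thesis by blast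
qed

text \<open>
  Reparametrising the graph of the level curve by arc length replaces the solution of a differential
  equation: the arc length function has positive derivative, so it has a differentiable inverse.
\<close>

lemma level_curve_exists:
  assumes p: "p \<in> regular"
  shows "\<exists>\<gamma> \<epsilon>. 0 < \<epsilon> \<and> \<gamma> 0 = p \<and>
    (\<forall>s\<in>{-\<epsilon><..<\<epsilon>}. f (\<gamma> s) = f p \<and> (\<gamma> has_vector_derivative level_tangent f (\<gamma> s)) (at s))"
proof -
  obtain i j \<sigma> c d e1 e2 t1 t2 where L: "level_chart \<Omega> f i j \<sigma> c d e1 e2 t1 t2"
    and pc: "p \<in> level_chart.chart_dom \<Omega> f i j \<sigma> c d e1 e2 t1 t2" using chart_exists[OF p] by blast
  interpret level_chart \<Omega> f i j \<sigma> c d e1 e2 t1 t2 by (rule L)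
  define t where "t = f p"
  have t: "t \<in> {t1..t2}" using pc by (auto simp: chart_dom_def t_def)
  define x0 where "x0 = p $ i"
  have x0: "c < x0" "x0 < d" using pc by (auto simp: chart_dom_def x0_def)
  have px0: "P (graph_pt t x0) = p"
  proof -
    obtain x where "x \<in> {c..d}" "p = P (graph_pt t x)" using level_in_chart[OF t pc] by (auto simp: t_def)
    then show ?thesis by (simp add: x0_def graph_pt clamp)
  qed
  define slope where "slope z = - (Fx z / Fy z)" for z
  have slope_cont: "continuous_on box slope"
    unfolding slope_def[abs_def] using Fy_pos by (intro continuous_intros continuous_on_FxFy) force
  have d_height: "((\<lambda>x. snd (graph_pt t x)) has_real_derivative slope (graph_pt t x)) (at x)" if x: "x \<in> {c<..<d}" for x
  proof -
    have "((\<lambda>x. snd (graph_pt t x)) has_derivative (\<lambda>h. slope (graph_pt t x) * h)) (at x within {c<..<d})"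
      unfolding has_derivative_within_alt
    proof (intro conjI allI impI)
      fix e :: real assume e: "0 < e"
      have x': "x \<in> {c..d}" using x by simp
      obtain \<delta> where \<delta>: "0 < \<delta>" "\<And>y z \<xi>. y \<in> {c..d} \<Longrightarrow> z \<in> {c..d} \<Longrightarrow> dist y x < \<delta> \<Longrightarrow> dist z x < \<delta> \<Longrightarrow>
          \<xi> \<in> closed_segment (graph_pt t y) (graph_pt t z) \<Longrightarrow> \<xi> \<in> box \<Longrightarrow>
          dist (slope \<xi>) (slope (graph_pt t x)) \<le> e"
        using near_graph[OF slope_cont x' e, of t] by blast
      have "norm (snd (graph_pt t y) - snd (graph_pt t x) - slope (graph_pt t x) * (y - x)) \<le> e * norm (y - x)"
        if y: "y \<in> {c<..<d}" "norm (y - x) < \<delta>" for y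
      proof -
        have y': "y \<in> {c..d}" using y by simp
        obtain \<xi> where \<xi>: "\<xi> \<in> closed_segment (graph_pt t x) (graph_pt t y)" "\<xi> \<in> box"
          "snd (graph_pt t y) - snd (graph_pt t x) = slope \<xi> * (y - x)"
          using dist_graph[OF x' y', of t] by (auto simp: slope_def)
        have "\<bar>slope \<xi> - slope (graph_pt t x)\<bar> \<le> e"
          using \<delta>(2)[OF x' y' _ _ \<xi>(1,2)] \<delta>(1) y by (simp add: dist_real_def)
        then have "\<bar>slope \<xi> - slope (graph_pt t x)\<bar> * \<bar>y - x\<bar> \<le> e * \<bar>y - x\<bar>" by (rule mult_right_mono) simp
        then show ?thesis unfolding \<xi>(3) by (simp add: abs_mult[symmetric] left_diff_distrib)
      qed
      then show "\<exists>\<delta>>0. \<forall>y\<in>{c<..<d}. norm (y - x) < \<delta> \<longrightarrow>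
          norm (snd (graph_pt t y) - snd (graph_pt t x) - slope (graph_pt t x) * (y - x)) \<le> e * norm (y - x)"
        using \<delta>(1) by blast
    qed (rule bounded_linear_mult_right)
    moreover have "at x within {c<..<d} = at x" by (rule at_within_open[OF x open_greaterThanLessThan])
    ultimately show ?thesis by (simp only: has_field_derivative_def)
  qed
  define \<beta> where "\<beta> x = P (graph_pt t x)" for x
  have d_\<beta>: "(\<beta> has_vector_derivative P (1, slope (graph_pt t x))) (at x)" if x: "x \<in> {c<..<d}" for x
  proof -
    have "((\<lambda>x. (x, snd (graph_pt t x))) has_vector_derivative (1, slope (graph_pt t x))) (at x)"
      using d_height[OF x] by (intro has_vector_derivative_Pair has_vector_derivative_id)
        (simp add: has_real_derivative_iff_has_vector_derivative)
    then have "((\<lambda>x. P (x, snd (graph_pt t x))) has_vector_derivative P (1, slope (graph_pt t x))) (at x)"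
      using linear_P by (intro bounded_linear.has_vector_derivative[of P]) (auto simp: linear_conv_bounded_linear)
    then show ?thesis
    proof (rule has_vector_derivative_transform_within_open[OF _ open_greaterThanLessThan x])
      fix y assume "y \<in> {c<..<d}"
      then have "fst (graph_pt t y) = y" by (simp add: graph_pt clamp)
      then show "P (y, snd (graph_pt t y)) = \<beta> y" unfolding \<beta>_def by (metis prod.collapse)
    qed
  qed
  (* +1 or -1 according as the graph, run through with increasing x, follows the tangent field or not *)
  define s0 where "s0 = (if i = 1 then - \<sigma> else \<sigma>)"
  have s0: "s0 = 1 \<or> s0 = -1" "s0 * s0 = 1" using \<sigma> by (auto simp: s0_def)
  have tangent: "level_tangent f (\<beta> x) = (s0 / stretch (graph_pt t x)) *\<^sub>R P (1, slope (graph_pt t x))" for x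
  proof -
    define z where "z = graph_pt t x"
    have z: "z \<in> box" unfolding z_def by (rule graph_pt)
    have Fy: "0 < Fy z" by (rule Fy_pos[OF z])
    have st: "0 < stretch z" using stretch_pos[of z] by linarith
    have Gi: "G (P z) $ i = Fx z" by (simp add: Fx_def)
    have Gj: "G (P z) $ j = \<sigma> * Fy z" by (simp add: Fy_def \<sigma>_square)
    have nG: "norm (G (P z)) = stretch z * Fy z" by (rule norm_G_P[OF z])
    have "level_tangent f (P z) = (s0 / stretch z) *\<^sub>R P (1, slope z)"
    proof (cases "i = 1")
      case True
      then have "j = 2" using ij exhaust_2[of j] by auto
      then show ?thesis
        using True Fy st Gi Gj nG ij P_nth[of "(1, slope z)"]
        by (simp add: vec2_eq_distinct[of 1 2] level_tangent_nth s0_def slope_def field_simps \<sigma>_square)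
    next
      case False
      then have "i = 2" "j = 1" using ij exhaust_2[of i] exhaust_2[of j] by auto
      then show ?thesis
        using Fy st Gi Gj nG ij P_nth[of "(1, slope z)"]
        by (simp add: vec2_eq_distinct[of 1 2] level_tangent_nth s0_def slope_def field_simps \<sigma>_square)
    qed
    then show ?thesis by (simp add: \<beta>_def z_def)
  qed
  define v where "v x = stretch (graph_pt t x)" for x
  have v1: "1 \<le> v x" for x by (simp add: v_def stretch_pos)
  have vc: "continuous_on {c..d} v" unfolding v_def[abs_def] by (rule continuous_on_graph_curve)
  define arc where "arc x = integral {c..x} v - integral {c..x0} v" for x
  have d_arc_within: "(arc has_real_derivative v x) (at x within {c..d})" if "x \<in> {c..d}" for x
    unfolding arc_def using integral_has_real_derivative[OF vc that] by (auto intro!: derivative_eq_intros)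
  then have d_arc: "(arc has_real_derivative v x) (at x)" if "x \<in> {c<..<d}" for x
    using that by (metis at_within_Icc_at atLeastAtMost_iff greaterThanLessThan_iff less_imp_le)
  have arcc: "continuous_on {c..d} arc"
    using d_arc_within by (meson DERIV_continuous continuous_on_eq_continuous_within)
  have arc_mono: "arc x < arc y" if "x \<in> {c..d}" "y \<in> {c..d}" "x < y" for x y
  proof (rule DERIV_pos_imp_increasing_open[OF that(3)])
    show "\<exists>l. DERIV arc z :> l \<and> 0 < l" if "x < z" "z < y" for z
      using d_arc[of z] v1[of z] that \<open>x \<in> {c..d}\<close> \<open>y \<in> {c..d}\<close> by (intro exI[of _ "v z"]) auto
    show "continuous_on {x..y} arc" using arcc that by (auto intro: continuous_on_subset)
  qed
  have inj: "inj_on arc {c..d}"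
    by (rule inj_onI) (metis arc_mono less_irrefl linorder_neqE_linordered_idom)
  define g where "g = inv_into {c..d} arc"
  have garc: "g (arc x) = x" if "x \<in> {c..d}" for x using that inj by (simp add: g_def)
  have gc: "continuous_on (arc ` {c..d}) g" by (rule continuous_on_inv[OF arcc]) (use garc in auto)
  have "arc x0 = 0" by (simp add: arc_def)
  then have l0: "arc c < 0" "0 < arc d" using arc_mono[of c x0] arc_mono[of x0 d] x0 by auto
  have surj: "\<exists>x\<in>{c<..<d}. arc x = s" if s: "arc c < s" "s < arc d" for s
  proof -
    obtain x where "c \<le> x" "x \<le> d" "arc x = s" using IVT'[OF _ _ _ arcc, of s] s cd by auto
    then show ?thesis using s by (intro bexI[of _ x]) (auto simp: less_le)
  qed
  have d_g: "(g has_real_derivative inverse (v (g s))) (at s)" "g s \<in> {c<..<d}" if s: "arc c < s" "s < arc d" for s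
  proof -
    obtain x where x: "x \<in> {c<..<d}" "arc x = s" using surj[OF s] by blast
    then have gs: "g s = x" using garc[of x] by auto
    then show "g s \<in> {c<..<d}" using x by simp
    have "{arc c<..<arc d} \<subseteq> arc ` {c..d}"
    proof
      fix s assume "s \<in> {arc c<..<arc d}"
      then obtain y where "y \<in> {c<..<d}" "arc y = s" using surj[of s] by auto
      then show "s \<in> arc ` {c..d}" by force
    qed
    then have "continuous_on {arc c<..<arc d} g" by (rule continuous_on_subset[OF gc])
    then have "isCont g s" using s by (simp add: continuous_on_eq_continuous_at)
    moreover have "arc (g y) = y" if y: "arc c < y" "y < arc d" for y
    proof -
      obtain x where "x \<in> {c<..<d}" "arc x = y" using surj[OF y] by blast
      then show ?thesis using garc[of x] by auto
    qed
    moreover have "v (g s) \<noteq> 0" using v1[of "g s"] by auto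
    moreover have "DERIV arc (g s) :> v (g s)" using d_arc[of "g s"] x gs by simp
    ultimately show "(g has_real_derivative inverse (v (g s))) (at s)"
      using s by (intro DERIV_inverse_function[where a = "arc c" and b = "arc d"]) auto
  qed
  (* largest symmetric interval of arc length parameters inside the chart *)
  define \<epsilon> where "\<epsilon> = min (- arc c) (arc d)"
  have \<epsilon>: "0 < \<epsilon>" using l0 by (simp add: \<epsilon>_def)
  define \<gamma> where "\<gamma> s = \<beta> (g (s0 * s))" for s
  have "\<gamma> 0 = p"
    using garc[of x0] x0 px0 \<open>arc x0 = 0\<close> by (simp add: \<gamma>_def \<beta>_def)
  moreover have "f (\<gamma> s) = f p" for s
    using t by (simp add: \<gamma>_def \<beta>_def graph_pt clamp t_def)
  moreover have "(\<gamma> has_vector_derivative level_tangent f (\<gamma> s)) (at s)" if s: "s \<in> {-\<epsilon><..<\<epsilon>}" for s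
  proof -
    have ss: "arc c < s0 * s" "s0 * s < arc d" using s s0(1) by (auto simp: \<epsilon>_def)
    have "((\<lambda>s. g (s0 * s)) has_real_derivative inverse (v (g (s0 * s))) * s0) (at s)"
      by (rule DERIV_chain2[where f = g and g = "\<lambda>s. s0 * s", OF d_g(1)[OF ss]]) (auto intro!: derivative_eq_intros)
    then have "((\<lambda>s. g (s0 * s)) has_vector_derivative (s0 / v (g (s0 * s)))) (at s)"
      by (simp add: has_real_derivative_iff_has_vector_derivative divide_inverse mult.commute)
    from vector_diff_chain_at[OF this d_\<beta>[OF d_g(2)[OF ss]]]
    show ?thesis unfolding \<gamma>_def tangent by (simp add: o_def v_def)
  qed
  ultimately show ?thesis using \<epsilon> by blast
qed

text \<open>
  The chain rule determines the derivative of the tangent field along any admissible curve, and an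
  admissible curve exists; so the description of the curvature singles out one value.
\<close>

theorem level_curvature_eq:
  assumes x: "x \<in> regular"
  shows "level_curvature f x = curv x"
  unfolding level_curvature_def
proof (rule the_equality)
  obtain D where D: "(level_tangent f has_derivative D) (at x)" "D (level_tangent f x) = curv x *\<^sub>R level_normal f x"
    using level_tangent_derivative[OF x] by blast
  have chain: "((\<lambda>s. level_tangent f (\<gamma> s)) has_vector_derivative curv x *\<^sub>R level_normal f x) (at 0)"
    if "\<gamma> 0 = x" "(\<gamma> has_vector_derivative level_tangent f (\<gamma> 0)) (at 0)" for \<gamma>
  proof -
    have "((\<lambda>s. level_tangent f (\<gamma> s)) has_derivative (\<lambda>h. D (h *\<^sub>R level_tangent f x))) (at 0)"
      using has_derivative_compose[of \<gamma> "\<lambda>h. h *\<^sub>R level_tangent f x" 0 UNIV "level_tangent f" D] that D(1)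
      by (simp add: has_vector_derivative_def)
    moreover have "D (h *\<^sub>R level_tangent f x) = h *\<^sub>R curv x *\<^sub>R level_normal f x" for h
      using linear_scale[OF has_derivative_linear[OF D(1)]] D(2) by simp
    ultimately show ?thesis by (simp add: has_vector_derivative_def)
  qed
  obtain \<gamma> \<epsilon> where \<gamma>: "0 < \<epsilon>" "\<gamma> 0 = x"
    "\<forall>s\<in>{-\<epsilon><..<\<epsilon>}. f (\<gamma> s) = f x \<and> (\<gamma> has_vector_derivative level_tangent f (\<gamma> s)) (at s)"
    using level_curve_exists[OF x] by blast
  moreover have "((\<lambda>s. level_tangent f (\<gamma> s)) has_vector_derivative curv x *\<^sub>R level_normal f x) (at 0)"
    using \<gamma> by (intro chain) auto
  ultimately show "\<exists>\<gamma> \<epsilon>. 0 < \<epsilon> \<and> \<gamma> 0 = x \<and>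
      (\<forall>s\<in>{-\<epsilon><..<\<epsilon>}. f (\<gamma> s) = f x \<and> (\<gamma> has_vector_derivative level_tangent f (\<gamma> s)) (at s)) \<and>
      ((\<lambda>s. level_tangent f (\<gamma> s)) has_vector_derivative curv x *\<^sub>R level_normal f x) (at 0)" by blast
  fix k assume "\<exists>\<gamma> \<epsilon>. 0 < \<epsilon> \<and> \<gamma> 0 = x \<and>
      (\<forall>s\<in>{-\<epsilon><..<\<epsilon>}. f (\<gamma> s) = f x \<and> (\<gamma> has_vector_derivative level_tangent f (\<gamma> s)) (at s)) \<and>
      ((\<lambda>s. level_tangent f (\<gamma> s)) has_vector_derivative k *\<^sub>R level_normal f x) (at 0)"
  then obtain \<gamma> \<epsilon> where k: "0 < (\<epsilon>::real)" "\<gamma> 0 = x"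
    "\<forall>s\<in>{-\<epsilon><..<\<epsilon>}. f (\<gamma> s) = f x \<and> (\<gamma> has_vector_derivative level_tangent f (\<gamma> s)) (at s)"
    "((\<lambda>s. level_tangent f (\<gamma> s)) has_vector_derivative k *\<^sub>R level_normal f x) (at 0)" by blast
  have "k *\<^sub>R level_normal f x = curv x *\<^sub>R level_normal f x"
    using k by (intro vector_derivative_unique_at[OF k(4)] chain) auto
  moreover have "level_normal f x \<noteq> 0" using x by (simp add: level_normal_def regular_def)
  ultimately show "k = curv x" by simp
qed

lemma continuous_on_curv: "continuous_on regular curv"
proof -
  have h: "continuous_on regular (\<lambda>x. hessian f x $ k $ l)" for k l
    by (intro continuous_on_component continuous_on_subset[OF continuous_on_hessian regular_subset])
  have g: "continuous_on regular (\<lambda>x. G x $ k)" for k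
    by (intro continuous_on_component continuous_on_subset[OF continuous_on_G regular_subset])
  have G: "continuous_on regular G" by (rule continuous_on_subset[OF continuous_on_G regular_subset])
  have eq: "curv x = ((hessian f x $ 1 $ 1 + hessian f x $ 2 $ 2) * (G x $ 1 * G x $ 1 + G x $ 2 * G x $ 2) -
      (G x $ 1 * (hessian f x $ 1 $ 1 * G x $ 1 + hessian f x $ 1 $ 2 * G x $ 2) +
       G x $ 2 * (hessian f x $ 2 $ 1 * G x $ 1 + hessian f x $ 2 $ 2 * G x $ 2))) / norm (G x) ^ 3" for x
    by (simp add: curv_def inner_vec_def matrix_vector_mult_def sum_2)
  show ?thesis
    unfolding eq
    by (intro continuous_on_divide continuous_on_diff continuous_on_add continuous_on_mult
        continuous_on_power continuous_on_norm h g G) (simp add: regular_def)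
qed

end

section \<open>The divergence theorem for the normalised gradient\<close>

lemma integral_translate:
  fixes V :: "'a::euclidean_space \<Rightarrow> real"
  assumes V: "integrable lborel V"
  shows "integrable lborel (\<lambda>x. V (x + h))" "(\<integral>x. V (x + h) \<partial>lborel) = (\<integral>x. V x \<partial>lborel)"
proof -
  have D: "distr lborel borel ((+) h) = lborel" by (rule lborel_distr_plus)
  have Vm: "V \<in> borel_measurable borel" using borel_measurable_integrable[OF V] by simp
  have "integrable (distr lborel borel ((+) h)) V" using V by (simp add: D)
  then have "integrable lborel (\<lambda>x. V (h + x))" by (subst (asm) integrable_distr_eq) (use Vm in auto)
  then show "integrable lborel (\<lambda>x. V (x + h))" by (simp add: add.commute)
  have "(\<integral>x. V x \<partial>distr lborel borel ((+) h)) = (\<integral>x. V (h + x) \<partial>lborel)"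
    by (subst integral_distr) (use Vm in auto)
  then show "(\<integral>x. V (x + h) \<partial>lborel) = (\<integral>x. V x \<partial>lborel)" by (simp add: D add.commute)
qed

text \<open>
  Difference quotients of \<open>V\<close> have integral zero because Lebesgue measure is translation invariant.
  They are uniformly bounded, vanish off a common ball, and converge to the directional derivative.
\<close>

lemma integral_derivative_zero:
  fixes V :: "'a::euclidean_space \<Rightarrow> real"
  assumes der: "\<And>x. (V has_derivative V' x) (at x)"
    and bound: "\<And>x h. \<bar>V' x h\<bar> \<le> B * norm h"
    and supp: "\<And>x. x \<notin> cball 0 R \<Longrightarrow> V x = 0"
  shows "integrable lborel (\<lambda>x. V' x e)" "(\<integral>x. V' x e \<partial>lborel) = 0"
proof -
  have cont: "continuous_on UNIV V"
    using der by (meson continuous_at_imp_continuous_on has_derivative_continuous)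
  have [measurable]: "V \<in> borel_measurable borel" by (rule borel_measurable_continuous_onI[OF cont])
  have "integrable lborel (\<lambda>x. indicator (cball 0 R) x *\<^sub>R V x)"
    by (rule borel_integrable_compact) (auto intro: continuous_on_subset[OF cont])
  moreover have "indicator (cball 0 R) x *\<^sub>R V x = V x" for x using supp[of x] by (auto simp: indicator_def)
  ultimately have int: "integrable lborel V" by (simp only:)
  have lip: "\<bar>V y - V x\<bar> \<le> B * norm (y - x)" for x y
  proof -
    have "norm (V y - V x) \<le> B * norm (y - x)"
    proof (rule differentiable_bound[of UNIV V V'])
      show "(V has_derivative V' x) (at x within UNIV)" for x using der by simp
      show "onorm (V' x) \<le> B" for x using bound by (intro onorm_le) (simp add: mult.commute)
    qed auto
    then show ?thesis by simp
  qed
  have B0: "0 \<le> B * norm e" using bound[of 0 e] abs_ge_zero order_trans by blast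
  define h where "h n = inverse (real (Suc n))" for n
  have h: "0 < h n" "h n \<le> 1" for n by (auto simp: h_def inverse_eq_divide)
  define q where "q n x = (V (x + h n *\<^sub>R e) - V x) / h n" for n x
  have q_int: "integrable lborel (q n)" "(\<integral>x. q n x \<partial>lborel) = 0" for n
    unfolding q_def using integral_translate[OF int, of "h n *\<^sub>R e"] int by simp_all
  have q_lim: "(\<lambda>n. q n x) \<longlonglongrightarrow> V' x e" for x
  proof -
    have "((\<lambda>s. V (x + s *\<^sub>R e)) has_derivative (\<lambda>s. V' x (s *\<^sub>R e))) (at 0)"
    proof (rule has_derivative_compose[of "\<lambda>s. x + s *\<^sub>R e"])
      show "((\<lambda>s. x + s *\<^sub>R e) has_derivative (\<lambda>s. s *\<^sub>R e)) (at 0)" by (auto intro!: derivative_eq_intros)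
    qed (use der in simp)
    moreover have "V' x (s *\<^sub>R e) = V' x e * s" for s
      using linear_scale[OF has_derivative_linear[OF der[of x]], of s e] by simp
    ultimately have "((\<lambda>s. V (x + s *\<^sub>R e)) has_real_derivative V' x e) (at 0)"
      by (simp only: has_field_derivative_def)
    then have L: "((\<lambda>s. (V (x + s *\<^sub>R e) - V x) / s) \<longlongrightarrow> V' x e) (at 0)"
      by (simp add: has_field_derivative_iff)
    have "filterlim h (at 0) sequentially"
    proof -
      have "h \<longlonglongrightarrow> 0" unfolding h_def[abs_def] by (rule LIMSEQ_inverse_real_of_nat)
      moreover have "h n \<noteq> 0" for n using h(1)[of n] by simp
      ultimately show ?thesis by (simp add: filterlim_at)
    qed
    from filterlim_compose[OF L this] show ?thesis by (simp add: q_def)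
  qed
  have q_bd: "norm (q n x) \<le> B * norm e * indicator (cball 0 (R + norm e)) x" for n x
  proof (cases "x \<in> cball 0 (R + norm e)")
    case True
    have "\<bar>V (x + h n *\<^sub>R e) - V x\<bar> \<le> B * (h n * norm e)" using lip[of "x + h n *\<^sub>R e" x] h(1)[of n] by simp
    then show ?thesis using True h(1)[of n] by (simp add: q_def field_simps)
  next
    case False
    then have nx: "R + norm e < norm x" by simp
    have "norm x \<le> norm (x + h n *\<^sub>R e) + h n * norm e"
      using norm_triangle_ineq4[of "x + h n *\<^sub>R e" "h n *\<^sub>R e"] h(1)[of n] by simp
    moreover have "h n * norm e \<le> 1 * norm e" using h(2)[of n] by (intro mult_right_mono) auto
    ultimately have "R < norm (x + h n *\<^sub>R e)" using nx by linarith
    moreover have "R < norm x" using nx norm_ge_zero[of e] by linarith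
    ultimately show ?thesis using False by (simp add: q_def supp)
  qed
  have meas: "(\<lambda>x. V' x e) \<in> borel_measurable lborel"
    by (rule borel_measurable_LIMSEQ_real[OF q_lim]) (use q_int in auto)
  have dom: "integrable lborel (\<lambda>x :: 'a. B * norm e * indicator (cball 0 (R + norm e)) x)"
    using emeasure_bounded_finite[OF bounded_cball[of "0 :: 'a" "R + norm e"]]
    by (intro integrable_mult_right integrable_real_indicator) auto
  have "(\<lambda>n. \<integral>x. q n x \<partial>lborel) \<longlonglongrightarrow> (\<integral>x. V' x e \<partial>lborel)"
    by (rule integral_dominated_convergence[OF meas _ dom AE_I2[OF q_lim] AE_I2[OF q_bd]]) (use q_int in auto)
  then show "(\<integral>x. V' x e \<partial>lborel) = 0" by (simp add: q_int(2) LIMSEQ_const_iff)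
  show "integrable lborel (\<lambda>x. V' x e)"
    by (rule integrable_dominated_convergence[OF meas _ dom AE_I2[OF q_lim] AE_I2[OF q_bd]]) (use q_int in auto)
qed

context strip
begin

definition laplacian :: "real^2 \<Rightarrow> real" where "laplacian z = hessian f z $ 1 $ 1 + hessian f z $ 2 $ 2"
definition hessian_quad :: "real^2 \<Rightarrow> real" where "hessian_quad z = G z \<bullet> (hessian f z *v G z)"
text \<open>
  A smooth substitute for \<open>|\<nabla>f|\<close> that has no zeros.
\<close>

definition reg_norm :: "real \<Rightarrow> real^2 \<Rightarrow> real" where "reg_norm \<epsilon> z = sqrt (G z \<bullet> G z + \<epsilon>)"

lemma continuous_on_hessian_nth: "continuous_on \<Omega> (\<lambda>x. hessian f x $ k $ l)"
  by (intro continuous_on_component continuous_on_hessian)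
lemma continuous_on_G_nth: "continuous_on \<Omega> (\<lambda>x. G x $ k)"
  by (intro continuous_on_component continuous_on_G)

lemma hessian_quad_eq: "hessian_quad z = G z $ 1 * (hessian f z $ 1 $ 1 * G z $ 1 + hessian f z $ 1 $ 2 * G z $ 2) +
       G z $ 2 * (hessian f z $ 2 $ 1 * G z $ 1 + hessian f z $ 2 $ 2 * G z $ 2)"
  by (simp add: hessian_quad_def inner_vec_def matrix_vector_mult_def sum_2)

lemma continuous_on_laplacian: "continuous_on \<Omega> laplacian"
  unfolding laplacian_def[abs_def] by (intro continuous_on_add continuous_on_hessian_nth)
lemma continuous_on_hessian_quad: "continuous_on \<Omega> hessian_quad"
  unfolding hessian_quad_eq[abs_def] by (intro continuous_on_add continuous_on_mult continuous_on_hessian_nth continuous_on_G_nth)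
lemma continuous_on_reg_norm: "continuous_on \<Omega> (reg_norm \<epsilon>)"
  unfolding reg_norm_def[abs_def] by (intro continuous_on_real_sqrt continuous_on_add continuous_on_inner continuous_on_G continuous_on_const)

lemma reg_norm_pos: "0 < \<epsilon> \<Longrightarrow> 0 < reg_norm \<epsilon> z" by (simp add: reg_norm_def add_nonneg_pos)
lemma reg_norm_ge: "0 \<le> \<epsilon> \<Longrightarrow> norm (G z) \<le> reg_norm \<epsilon> z" by (simp add: reg_norm_def norm_eq_sqrt_inner)
lemma curv_eq: "curv z = (laplacian z * (G z \<bullet> G z) - hessian_quad z) / norm (G z) ^ 3" by (simp add: curv_def laplacian_def hessian_quad_def)

text \<open>
  The field \<open>\<psi>(f) \<nabla>f/N\<close>, extended by zero, has compact support in \<open>S\<close>; its divergence, the sum over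
  \<open>k\<close> of the derivatives of the \<open>k\<close>-th component in the \<open>k\<close>-th direction, is the integrand.
\<close>

lemma regularized_flux:
  assumes \<psi>: "\<And>s. (\<psi> has_real_derivative \<psi>' s) (at s)" and \<psi>'c: "continuous_on UNIV \<psi>'"
    and \<psi>0: "\<And>s. s \<notin> {a..b} \<Longrightarrow> \<psi> s = 0" and \<psi>'0: "\<And>s. s \<notin> {a..b} \<Longrightarrow> \<psi>' s = 0" and \<epsilon>: "0 < \<epsilon>"
  shows "(LINT z:S|lborel. \<psi>' (f z) * (G z \<bullet> G z) / reg_norm \<epsilon> z +
    \<psi> (f z) * (laplacian z / reg_norm \<epsilon> z - hessian_quad z / reg_norm \<epsilon> z ^ 3)) = 0"
proof -
  define N where "N = reg_norm \<epsilon>"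
  have N: "0 < N z" for z using reg_norm_pos[OF \<epsilon>] by (simp add: N_def)
  define V where "V k z = (if z \<in> \<Omega> then \<psi> (f z) * (G z $ k / N z) else 0)" for k z
  define F where "F k z h = \<psi>' (f z) * (h \<bullet> G z) * (G z $ k / N z) +
      \<psi> (f z) * ((hessian f z *v h) $ k / N z - G z $ k * (G z \<bullet> (hessian f z *v h)) / N z ^ 3)" for k z h
  define V' where "V' k z h = (if z \<in> \<Omega> then F k z h else 0)" for k z h
  have V'_S: "V' k z h = 0" if "z \<notin> S" for k z h
    using that \<psi>0[of "f z"] \<psi>'0[of "f z"] by (auto simp: V'_def F_def)
  have V_S: "V k z = 0" if "z \<notin> S" for k z using that \<psi>0[of "f z"] by (auto simp: V_def)
  have der: "(V k has_derivative V' k z) (at z)" for k z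
  proof (cases "z \<in> \<Omega>")
    case True
    have 1: "((\<lambda>z. \<psi> (f z)) has_derivative (\<lambda>h. \<psi>' (f z) * (h \<bullet> G z))) (at z)"
      using has_derivative_compose[OF has_derivative_f[OF True] \<psi>[of "f z", unfolded has_field_derivative_def]] .
    have 2: "((\<lambda>z. G z $ k / N z) has_derivative
      (\<lambda>h. (hessian f z *v h) $ k / N z - G z $ k * (G z \<bullet> (hessian f z *v h)) / N z ^ 3)) (at z)"
      by (rule has_derivative_normalized_gradient[OF True, where \<epsilon> = \<epsilon>])
        (use \<epsilon> in \<open>auto simp: N_def reg_norm_def[abs_def] add_nonneg_pos\<close>)
    have "((\<lambda>z. \<psi> (f z) * (G z $ k / N z)) has_derivative F k z) (at z)"
      by (rule has_derivative_eq_rhs[OF has_derivative_mult[OF 1 2]]) (auto simp: F_def fun_eq_iff algebra_simps)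
    then have "(V k has_derivative F k z) (at z)"
      by (rule has_derivative_transform_within_open[OF _ open_\<Omega> True]) (simp add: V_def)
    then show ?thesis using True by (simp add: V'_def[abs_def])
  next
    case False
    then have z: "z \<in> - S" by auto
    have "open (- S)" by (rule open_Compl[OF compact_imp_closed[OF compact_strip]])
    then have "(V k has_derivative (\<lambda>h. 0)) (at z)"
      by (rule has_derivative_transform_within_open[OF has_derivative_const[of 0] _ z]) (auto simp: V_S)
    then show ?thesis using False by (simp add: V'_def[abs_def])
  qed
  have comp: "V' k z h = h $ 1 * V' k z (axis 1 1) + h $ 2 * V' k z (axis 2 1)" for k z h
  proof -
    have "h = h $ 1 *\<^sub>R axis 1 1 + h $ 2 *\<^sub>R axis 2 1" by (simp add: vec_eq_iff forall_2 axis_def)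
    then have "V' k z h = V' k z (h $ 1 *\<^sub>R axis 1 1 + h $ 2 *\<^sub>R axis 2 1)" by simp
    also have "\<dots> = h $ 1 * V' k z (axis 1 1) + h $ 2 * V' k z (axis 2 1)"
      using has_derivative_linear[OF der] by (simp add: linear_add linear_scale)
    finally show ?thesis .
  qed
  have \<psi>c: "continuous_on UNIV \<psi>" using \<psi> by (meson DERIV_continuous continuous_at_imp_continuous_on)
  have Nc: "continuous_on \<Omega> N" unfolding N_def by (rule continuous_on_reg_norm)
  have \<psi>f: "continuous_on \<Omega> (\<lambda>z. \<psi> (f z))" "continuous_on \<Omega> (\<lambda>z. \<psi>' (f z))"
    by (auto intro: continuous_on_compose2[OF \<psi>c continuous_on_f] continuous_on_compose2[OF \<psi>'c continuous_on_f])
  have Fc: "continuous_on \<Omega> (\<lambda>z. F k z (axis l 1))" for k l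
  proof -
    have eq: "F k z (axis l 1) = \<psi>' (f z) * G z $ l * (G z $ k / N z) +
      \<psi> (f z) * (hessian f z $ k $ l / N z - G z $ k * (G z $ 1 * hessian f z $ 1 $ l + G z $ 2 * hessian f z $ 2 $ l) / N z ^ 3)" for z
      by (simp add: F_def inner_axis') (simp add: inner_vec_def sum_2 matrix_vector_mult_basis column_def)
    show ?thesis
      unfolding eq
      by (intro continuous_on_add continuous_on_mult continuous_on_diff continuous_on_divide continuous_on_power
          \<psi>f Nc continuous_on_G_nth continuous_on_hessian_nth) (use N in \<open>auto simp: less_imp_neq[symmetric]\<close>)
  qed
  have bound: "\<exists>B. \<forall>z h. \<bar>V' k z h\<bar> \<le> B * norm h" for k
  proof -
    have bl: "\<exists>B\<ge>0. \<forall>z. \<bar>V' k z (axis l 1)\<bar> \<le> B" for l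
    proof -
      obtain B where B: "0 \<le> B" "\<And>z. z \<in> S \<Longrightarrow> \<bar>F k z (axis l 1)\<bar> \<le> B" using bounded_on_S[OF Fc] by blast
      have "\<bar>V' k z (axis l 1)\<bar> \<le> B" for z
        using B V'_S[of z k "axis l 1"] by (cases "z \<in> S") (auto simp: V'_def)
      then show ?thesis using B(1) by blast
    qed
    obtain B1 where B1: "0 \<le> B1" "\<And>z. \<bar>V' k z (axis 1 1)\<bar> \<le> B1" using bl by blast
    obtain B2 where B2: "0 \<le> B2" "\<And>z. \<bar>V' k z (axis 2 1)\<bar> \<le> B2" using bl by blast
    have "\<bar>V' k z h\<bar> \<le> (B1 + B2) * norm h" for z h
    proof -
      have "\<bar>V' k z h\<bar> \<le> \<bar>h $ 1\<bar> * \<bar>V' k z (axis 1 1)\<bar> + \<bar>h $ 2\<bar> * \<bar>V' k z (axis 2 1)\<bar>"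
        unfolding comp[of k z h] by (metis abs_mult abs_triangle_ineq)
      also have "\<dots> \<le> norm h * B1 + norm h * B2"
        by (intro add_mono mult_mono component_le_norm_cart B1 B2) auto
      finally show ?thesis by (simp add: algebra_simps)
    qed
    then show ?thesis by blast
  qed
  obtain R where R: "S \<subseteq> cball 0 R"
    using compact_imp_bounded[OF compact_strip] by (force simp: bounded_iff)
  have zero: "integrable lborel (\<lambda>z. V' k z (axis k 1))" "(\<integral>z. V' k z (axis k 1) \<partial>lborel) = 0" for k
  proof -
    obtain B where B: "\<And>z h. \<bar>V' k z h\<bar> \<le> B * norm h" using bound by blast
    have supp: "V k z = 0" if "z \<notin> cball 0 R" for z using V_S R that by blast
    show "integrable lborel (\<lambda>z. V' k z (axis k 1))" "(\<integral>z. V' k z (axis k 1) \<partial>lborel) = 0"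
      using integral_derivative_zero[OF der B supp] by auto
  qed
  have "V' 1 z (axis 1 1) + V' 2 z (axis 2 1) = indicator S z *\<^sub>R (\<psi>' (f z) * (G z \<bullet> G z) / N z +
      \<psi> (f z) * (laplacian z / N z - hessian_quad z / N z ^ 3))" for z
  proof (cases "z \<in> S")
    case True
    have axes: "axis (1 :: 2) (1 :: real) $ 2 = 0" "axis (2 :: 2) (1 :: real) $ 1 = 0" by (simp_all add: axis_def)
    have "F 1 z (axis 1 1) + F 2 z (axis 2 1) = \<psi>' (f z) * (G z \<bullet> G z) / N z + \<psi> (f z) * (laplacian z / N z - hessian_quad z / N z ^ 3)"
      using N[of z] axes by (simp add: F_def hessian_quad_eq laplacian_def inner_axis' inner_vec_def sum_2 matrix_vector_mult_basis column_def
          field_simps power3_eq_cube)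
    then show ?thesis using True by (simp add: V'_def)
  qed (simp add: V'_S)
  then have "(LINT z:S|lborel. \<psi>' (f z) * (G z \<bullet> G z) / N z + \<psi> (f z) * (laplacian z / N z - hessian_quad z / N z ^ 3)) =
      (\<integral>z. V' 1 z (axis 1 1) + V' 2 z (axis 2 1) \<partial>lborel)"
    by (simp only: set_lebesgue_integral_def)
  also have "\<dots> = 0" using zero by (subst Bochner_Integration.integral_add) auto
  finally show ?thesis by (simp add: N_def)
qed

lemma second_order_bound:
  obtains C where "0 \<le> C" "\<And>z. z \<in> S \<Longrightarrow> \<bar>laplacian z\<bar> \<le> C" "\<And>z. z \<in> S \<Longrightarrow> \<bar>hessian_quad z\<bar> \<le> C * (G z \<bullet> G z)"
proof -
  define c where "c z = \<bar>hessian f z $ 1 $ 1\<bar> + \<bar>hessian f z $ 1 $ 2\<bar> + \<bar>hessian f z $ 2 $ 1\<bar> + \<bar>hessian f z $ 2 $ 2\<bar>" for z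
  have "continuous_on \<Omega> c"
    unfolding c_def[abs_def] by (intro continuous_on_add continuous_on_rabs continuous_on_hessian_nth)
  then obtain C where C: "0 \<le> C" "\<And>z. z \<in> S \<Longrightarrow> \<bar>c z\<bar> \<le> C" using bounded_on_S by blast
  show ?thesis
  proof (rule that[OF C(1)])
    fix z assume z: "z \<in> S"
    show "\<bar>laplacian z\<bar> \<le> C" using hessian_form_le(2)[of "hessian f z"] C(2)[OF z] by (simp add: laplacian_def c_def)
    have "\<bar>hessian_quad z\<bar> \<le> c z * (G z \<bullet> G z)" unfolding hessian_quad_def c_def by (rule hessian_form_le(1))
    also have "\<dots> \<le> C * (G z \<bullet> G z)" using C(2)[OF z] by (intro mult_right_mono) auto
    finally show "\<bar>hessian_quad z\<bar> \<le> C * (G z \<bullet> G z)" .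
  qed
qed

text \<open>
  With \<open>n = |\<nabla>f|\<close> the left side is the curvature itself, so the bound serves both for the approximating
  integrands and for their limit.
\<close>

lemma regularized_curvature_bound:
  assumes C: "0 \<le> C" "\<bar>laplacian z\<bar> \<le> C" "\<bar>hessian_quad z\<bar> \<le> C * (G z \<bullet> G z)"
    and g: "G z \<noteq> 0" and n: "norm (G z) \<le> n"
  shows "\<bar>laplacian z / n - hessian_quad z / n ^ 3\<bar> \<le> 2 * C * (1 / norm (G z))"
proof -
  have np: "0 < norm (G z)" "0 < n" using g n by (auto intro: less_le_trans[of 0 "norm (G z)"])
  have i: "1 / n \<le> 1 / norm (G z)" using n np by (intro divide_left_mono) auto
  have sq: "G z \<bullet> G z \<le> n\<^sup>2" unfolding dot_square_norm using n by (intro power_mono) auto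
  have 1: "\<bar>laplacian z / n\<bar> \<le> C * (1 / norm (G z))"
  proof -
    have "\<bar>laplacian z / n\<bar> = \<bar>laplacian z\<bar> * (1 / n)" using np by simp
    also have "\<dots> \<le> C * (1 / norm (G z))" using C i np by (intro mult_mono) auto
    finally show ?thesis .
  qed
  have 2: "\<bar>hessian_quad z / n ^ 3\<bar> \<le> C * (1 / norm (G z))"
  proof -
    have "\<bar>hessian_quad z / n ^ 3\<bar> = \<bar>hessian_quad z\<bar> / n ^ 3" using np by simp
    also have "\<dots> \<le> C * n\<^sup>2 / n ^ 3"
      using C(3) mult_left_mono[OF sq C(1)] np by (intro divide_right_mono) auto
    also have "\<dots> = C * (1 / n)" using np by (simp add: power2_eq_square power3_eq_cube)
    also have "\<dots> \<le> C * (1 / norm (G z))" using C(1) i by (intro mult_left_mono)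
    finally show ?thesis .
  qed
  show ?thesis using 1 2 by linarith
qed

lemma curv_eq_regular: "G z \<noteq> 0 \<Longrightarrow> curv z = laplacian z / norm (G z) - hessian_quad z / norm (G z) ^ 3"
  by (simp add: curv_eq dot_square_norm diff_divide_distrib power2_eq_square power3_eq_cube)

lemma curv_bound: obtains C where "0 \<le> C" "\<And>z. z \<in> S \<Longrightarrow> \<bar>curv z\<bar> \<le> C * (1 / norm (G z))"
proof -
  obtain C where C: "0 \<le> C" "\<And>z. z \<in> S \<Longrightarrow> \<bar>laplacian z\<bar> \<le> C" "\<And>z. z \<in> S \<Longrightarrow> \<bar>hessian_quad z\<bar> \<le> C * (G z \<bullet> G z)"
    using second_order_bound by blast
  show ?thesis
  proof (rule that[of "2 * C"])
    fix z assume z: "z \<in> S"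
    show "\<bar>curv z\<bar> \<le> 2 * C * (1 / norm (G z))"
    proof (cases "G z = 0")
      case False
      from regularized_curvature_bound[OF C(1) C(2)[OF z] C(3)[OF z] False order_refl] show ?thesis
        unfolding curv_eq_regular[OF False] .
    qed (simp add: curv_def)
  qed (use C in simp)
qed

lemma borel_measurable_curv: "(\<lambda>z. indicator S z *\<^sub>R curv z) \<in> borel_measurable borel"
proof -
  have n: "(\<lambda>z. indicator S z *\<^sub>R (laplacian z * (G z \<bullet> G z) - hessian_quad z)) \<in> borel_measurable borel"
    by (intro borel_measurable_indicator_continuous continuous_on_diff continuous_on_mult continuous_on_inner
        continuous_on_laplacian continuous_on_hessian_quad continuous_on_G) auto
  have d: "(\<lambda>z. indicator S z *\<^sub>R norm (G z)) \<in> borel_measurable borel"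
    by (intro borel_measurable_indicator_continuous continuous_on_norm continuous_on_G) auto
  have "(\<lambda>z. (indicator S z *\<^sub>R (laplacian z * (G z \<bullet> G z) - hessian_quad z)) / (indicator S z *\<^sub>R norm (G z)) ^ 3) \<in> borel_measurable borel"
    by (intro borel_measurable_divide borel_measurable_power n d)
  moreover have "(indicator S z *\<^sub>R (laplacian z * (G z \<bullet> G z) - hessian_quad z)) / (indicator S z *\<^sub>R norm (G z)) ^ 3 = indicator S z *\<^sub>R curv z" for z
    by (simp add: indicator_def curv_eq)
  ultimately show ?thesis by (simp only:)
qed

lemma set_integrable_curv: "set_integrable lborel S curv"
proof -
  obtain C where C: "0 \<le> C" "\<And>z. z \<in> S \<Longrightarrow> \<bar>curv z\<bar> \<le> C * (1 / norm (G z))" using curv_bound by blast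
  have "integrable lborel (\<lambda>z. C * (indicator S z *\<^sub>R (1 / norm (G z))))"
    using integrable_inverse_gradient unfolding set_integrable_def by (rule integrable_mult_right)
  then show ?thesis
    unfolding set_integrable_def
  proof (rule Bochner_Integration.integrable_bound)
    show "AE z in lborel. norm (indicator S z *\<^sub>R curv z) \<le> norm (C * (indicator S z *\<^sub>R (1 / norm (G z))))"
      using C by (intro AE_I2) (auto simp: indicator_def)
  qed (use borel_measurable_curv in simp)
qed

text \<open>
  Integration by parts against \<open>\<psi>\<close>: the regularised identity passes to the limit under the integrable
  bound \<open>|\<psi>'(f)| |\<nabla>f| + 2 B C/|\<nabla>f|\<close>, and the coarea formula converts the term with \<open>\<psi>'\<close>.
\<close>

lemma curvature_flux:
  assumes \<psi>: "\<And>s. (\<psi> has_real_derivative \<psi>' s) (at s)" and \<psi>'c: "continuous_on UNIV \<psi>'"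
    and \<psi>0: "\<And>s. s \<notin> {a..b} \<Longrightarrow> \<psi> s = 0" and \<psi>'0: "\<And>s. s \<notin> {a..b} \<Longrightarrow> \<psi>' s = 0"
  shows "(LINT z:S|lborel. \<psi> (f z) * curv z) = - (LINT t:{a..b}|lborel. \<psi>' t * level_length \<Omega> f t)"
proof -
  have \<psi>c: "continuous_on UNIV \<psi>" using \<psi> by (meson DERIV_continuous continuous_at_imp_continuous_on)
  have \<psi>f: "continuous_on \<Omega> (\<lambda>z. \<psi> (f z))" "continuous_on \<Omega> (\<lambda>z. \<psi>' (f z))"
    by (auto intro: continuous_on_compose2[OF \<psi>c continuous_on_f] continuous_on_compose2[OF \<psi>'c continuous_on_f])
  have \<psi>G: "continuous_on \<Omega> (\<lambda>z. \<psi>' (f z) * norm (G z))" by (intro continuous_on_mult continuous_on_norm \<psi>f continuous_on_G)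
  obtain B where B: "0 \<le> B" "\<And>z. z \<in> S \<Longrightarrow> \<bar>\<psi> (f z)\<bar> \<le> B" using bounded_on_S[OF \<psi>f(1)] by blast
  obtain C where C: "0 \<le> C" "\<And>z. z \<in> S \<Longrightarrow> \<bar>laplacian z\<bar> \<le> C" "\<And>z. z \<in> S \<Longrightarrow> \<bar>hessian_quad z\<bar> \<le> C * (G z \<bullet> G z)"
    using second_order_bound by blast
  define \<epsilon> where "\<epsilon> n = inverse (real (Suc n))" for n
  have \<epsilon>: "0 < \<epsilon> n" for n by (simp add: \<epsilon>_def)
  have \<epsilon>0: "\<epsilon> \<longlonglongrightarrow> 0" unfolding \<epsilon>_def[abs_def] by (rule LIMSEQ_inverse_real_of_nat)
  define N where "N n = reg_norm (\<epsilon> n)" for n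
  have N: "0 < N n z" "norm (G z) \<le> N n z" for n z
    using reg_norm_pos[OF \<epsilon>] reg_norm_ge[OF less_imp_le[OF \<epsilon>]] by (auto simp: N_def)
  have N_lim: "(\<lambda>n. N n z) \<longlonglongrightarrow> norm (G z)" for z
  proof -
    have "(\<lambda>n. sqrt (G z \<bullet> G z + \<epsilon> n)) \<longlonglongrightarrow> sqrt (G z \<bullet> G z + 0)" by (intro tendsto_intros \<epsilon>0)
    then show ?thesis by (simp add: N_def reg_norm_def norm_eq_sqrt_inner)
  qed
  define F where "F n z = \<psi>' (f z) * (G z \<bullet> G z) / N n z + \<psi> (f z) * (laplacian z / N n z - hessian_quad z / N n z ^ 3)" for n z
  define F0 where "F0 z = \<psi>' (f z) * norm (G z) + \<psi> (f z) * curv z" for z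
  have Fc: "continuous_on \<Omega> (F n)" for n
    unfolding F_def[abs_def] N_def
    by (intro continuous_on_add continuous_on_mult continuous_on_diff continuous_on_divide continuous_on_power
        continuous_on_inner \<psi>f continuous_on_G continuous_on_laplacian continuous_on_hessian_quad continuous_on_reg_norm)
      (use N in \<open>auto simp: less_imp_neq[symmetric] N_def\<close>)
  define dom where "dom z = \<bar>\<psi>' (f z) * norm (G z)\<bar> + B * (2 * C * (1 / norm (G z)))" for z
  have dom_int: "integrable lborel (\<lambda>z. indicator S z *\<^sub>R dom z)"
  proof -
    have "set_integrable lborel S (\<lambda>z. \<bar>\<psi>' (f z) * norm (G z)\<bar>)"
      by (intro set_integrable_S continuous_on_rabs \<psi>G)
    moreover have "set_integrable lborel S (\<lambda>z. B * (2 * C * (1 / norm (G z))))"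
      by (intro set_integrable_mult_right integrable_inverse_gradient)
    ultimately have "set_integrable lborel S dom" unfolding dom_def[abs_def] by (rule set_integral_add)
    then show ?thesis by (simp only: set_integrable_def)
  qed
  have F_int: "set_integrable lborel S (F n)" for n by (rule set_integrable_S[OF Fc])
  have F0_int: "set_integrable lborel S (\<lambda>z. \<psi>' (f z) * norm (G z))" "set_integrable lborel S (\<lambda>z. \<psi> (f z) * curv z)"
  proof -
    show "set_integrable lborel S (\<lambda>z. \<psi>' (f z) * norm (G z))" by (rule set_integrable_S[OF \<psi>G])
    have m: "(\<lambda>z. (indicator S z *\<^sub>R \<psi> (f z)) * (indicator S z *\<^sub>R curv z)) \<in> borel_measurable borel"
      by (intro borel_measurable_times borel_measurable_indicator_continuous \<psi>f borel_measurable_curv) auto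
    have "integrable lborel (\<lambda>z. B * (indicator S z *\<^sub>R curv z))"
      using set_integrable_curv unfolding set_integrable_def by (rule integrable_mult_right)
    then have "integrable lborel (\<lambda>z. (indicator S z *\<^sub>R \<psi> (f z)) * (indicator S z *\<^sub>R curv z))"
    proof (rule Bochner_Integration.integrable_bound)
      show "AE z in lborel. norm ((indicator S z *\<^sub>R \<psi> (f z)) * (indicator S z *\<^sub>R curv z)) \<le> norm (B * (indicator S z *\<^sub>R curv z))"
      proof (rule AE_I2)
        fix z
        show "norm ((indicator S z *\<^sub>R \<psi> (f z)) * (indicator S z *\<^sub>R curv z)) \<le> norm (B * (indicator S z *\<^sub>R curv z))"
          using B by (cases "z \<in> S") (auto simp: abs_mult intro!: mult_right_mono)
      qed
    qed (use m in simp)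
    moreover have "(indicator S z *\<^sub>R \<psi> (f z)) * (indicator S z *\<^sub>R curv z) = indicator S z *\<^sub>R (\<psi> (f z) * curv z)" for z
      by (simp add: indicator_def)
    ultimately show "set_integrable lborel S (\<lambda>z. \<psi> (f z) * curv z)" unfolding set_integrable_def by (simp only:)
  qed
  have AEr: "AE z in lborel. z \<notin> Crit" by (rule AE_not_in[OF Crit_null(2)])
  have "(\<lambda>n. \<integral>z. indicator S z *\<^sub>R F n z \<partial>lborel) \<longlonglongrightarrow> (\<integral>z. indicator S z *\<^sub>R F0 z \<partial>lborel)"
  proof (rule integral_dominated_convergence[OF _ _ dom_int])
    show "(\<lambda>z. indicator S z *\<^sub>R F0 z) \<in> borel_measurable lborel"
      using set_integral_add(1)[OF F0_int] unfolding F0_def set_integrable_def by (rule borel_measurable_integrable)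
    show "(\<lambda>z. indicator S z *\<^sub>R F n z) \<in> borel_measurable lborel" for n
      using F_int unfolding set_integrable_def by (rule borel_measurable_integrable)
    show "AE z in lborel. (\<lambda>n. indicator S z *\<^sub>R F n z) \<longlonglongrightarrow> indicator S z *\<^sub>R F0 z"
      using AEr
    proof eventually_elim
      case (elim z)
      show ?case
      proof (cases "z \<in> S")
        case True
        then have g: "G z \<noteq> 0" using elim by (simp add: Crit_def)
        have "(\<lambda>n. F n z) \<longlonglongrightarrow> \<psi>' (f z) * (G z \<bullet> G z) / norm (G z) + \<psi> (f z) * (laplacian z / norm (G z) - hessian_quad z / norm (G z) ^ 3)"
          unfolding F_def using g by (intro tendsto_intros N_lim) auto
        moreover have "\<psi>' (f z) * (G z \<bullet> G z) / norm (G z) = \<psi>' (f z) * norm (G z)"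
          using g by (simp add: dot_square_norm power2_eq_square)
        ultimately show ?thesis using True by (simp add: F0_def curv_eq_regular[OF g])
      qed simp
    qed
    show "AE z in lborel. norm (indicator S z *\<^sub>R F n z) \<le> indicator S z *\<^sub>R dom z" for n
      using AEr
    proof eventually_elim
      case (elim z)
      show ?case
      proof (cases "z \<in> S")
        case True
        then have g: "G z \<noteq> 0" using elim by (simp add: Crit_def)
        have "\<bar>\<psi>' (f z) * (G z \<bullet> G z) / N n z\<bar> = \<bar>\<psi>' (f z) * norm (G z)\<bar> * (norm (G z) / N n z)"
          using N(1)[of n z] N(2)[of z n] by (simp add: dot_square_norm power2_eq_square abs_mult)
        also have "\<dots> \<le> \<bar>\<psi>' (f z) * norm (G z)\<bar> * 1"
          using N(1)[of n z] N(2)[of z n] g by (intro mult_left_mono) auto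
        finally have 1: "\<bar>\<psi>' (f z) * (G z \<bullet> G z) / N n z\<bar> \<le> \<bar>\<psi>' (f z) * norm (G z)\<bar>" by simp
        have 2: "\<bar>\<psi> (f z) * (laplacian z / N n z - hessian_quad z / N n z ^ 3)\<bar> \<le> B * (2 * C * (1 / norm (G z)))"
          unfolding abs_mult using B True regularized_curvature_bound[OF C(1) C(2)[OF True] C(3)[OF True] g N(2)]
          by (intro mult_mono) auto
        have "\<bar>F n z\<bar> \<le> dom z" unfolding F_def dom_def using 1 2 by linarith
        then show ?thesis using True by simp
      qed simp
    qed
  qed
  moreover have "(\<integral>z. indicator S z *\<^sub>R F n z \<partial>lborel) = 0" for n
    using regularized_flux[OF \<psi> \<psi>'c \<psi>0 \<psi>'0 \<epsilon>[of n]] by (simp add: F_def N_def set_lebesgue_integral_def)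
  ultimately have "(\<integral>z. indicator S z *\<^sub>R F0 z \<partial>lborel) = 0" by (simp add: LIMSEQ_const_iff)
  then have "(LINT z:S|lborel. \<psi>' (f z) * norm (G z) + \<psi> (f z) * curv z) = 0"
    by (simp only: set_lebesgue_integral_def F0_def)
  then have "(LINT z:S|lborel. \<psi>' (f z) * norm (G z)) + (LINT z:S|lborel. \<psi> (f z) * curv z) = 0"
    using set_integral_add(2)[OF F0_int] by simp
  moreover have "(LINT z:S|lborel. \<psi>' (f z) * norm (G z)) = (LINT t:{a..b}|lborel. \<psi>' t * level_length \<Omega> f t)"
    by (rule integral_continuous_level[OF \<psi>'c])
  ultimately show ?thesis by linarith
qed

end

section \<open>Length as a total curvature\<close>

text \<open>
  Piecewise quadratic functions give a step of class \<open>C\<^sup>1\<close>: \<open>smooth_step\<close> rises from \<open>0\<close> at \<open>0\<close> to \<open>1\<close> at \<open>1\<close>,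
  and its derivative is the triangle \<open>tent\<close>.
\<close>

definition pos_sq :: "real \<Rightarrow> real" where "pos_sq u = (max 0 u)\<^sup>2"
definition smooth_step :: "real \<Rightarrow> real" where
  "smooth_step u = 2 * pos_sq u - 4 * pos_sq (u - 1/2) + 2 * pos_sq (u - 1)"
definition tent :: "real \<Rightarrow> real" where
  "tent u = 4 * max 0 u - 8 * max 0 (u - 1/2) + 4 * max 0 (u - 1)"

lemma pos_sq_deriv: "(pos_sq has_real_derivative 2 * max 0 u) (at u)"
proof (cases u "0 :: real" rule: linorder_cases)
  case less
  have "((\<lambda>_. 0) has_real_derivative 0) (at u)" by simp
  then have "(pos_sq has_real_derivative 0) (at u)"
    by (rule has_field_derivative_transform_within_open[where S = "{..<0}"]) (use less in \<open>auto simp: pos_sq_def\<close>)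
  then show ?thesis using less by simp
next
  case greater
  have "((\<lambda>u. u\<^sup>2) has_real_derivative 2 * u) (at u)" by (auto intro!: derivative_eq_intros)
  then have "(pos_sq has_real_derivative 2 * u) (at u)"
    by (rule has_field_derivative_transform_within_open[where S = "{0<..}"]) (use greater in \<open>auto simp: pos_sq_def\<close>)
  then show ?thesis using greater by simp
next
  case equal
  have "((\<lambda>h. (pos_sq (0 + h) - pos_sq 0) / h) \<longlongrightarrow> 0) (at 0)"
  proof (rule Lim_null_comparison)
    show "\<forall>\<^sub>F h in at 0. norm ((pos_sq (0 + h) - pos_sq 0) / h) \<le> \<bar>h\<bar>"
      by (rule always_eventually) (auto simp: pos_sq_def max_def power2_eq_square)
    show "((\<lambda>h :: real. \<bar>h\<bar>) \<longlongrightarrow> 0) (at 0)" by (intro tendsto_rabs_zero tendsto_ident_at)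
  qed
  then show ?thesis using equal by (simp add: DERIV_def)
qed

lemma smooth_step_deriv: "(smooth_step has_real_derivative tent u) (at u)"
proof -
  have shift: "((\<lambda>u. pos_sq (u - k)) has_real_derivative 2 * max 0 (u - k)) (at u)" for k
    by (rule DERIV_cong[OF DERIV_chain2[where f = pos_sq and g = "\<lambda>u. u - k" and Db = 1, OF pos_sq_deriv]])
      (auto intro!: derivative_eq_intros)
  show ?thesis
    unfolding smooth_step_def[abs_def] tent_def
    by (rule derivative_eq_intros shift pos_sq_deriv refl)+ simp
qed

lemma continuous_on_tent: "continuous_on A tent"
  unfolding tent_def[abs_def] by (intro continuous_intros)

lemma tent: "0 \<le> tent u" "u \<le> 0 \<Longrightarrow> tent u = 0" "1 \<le> u \<Longrightarrow> tent u = 0"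
  by (auto simp: tent_def max_def)

lemma smooth_step: "u \<le> 0 \<Longrightarrow> smooth_step u = 0" "1 \<le> u \<Longrightarrow> smooth_step u = 1"
  "0 \<le> smooth_step u" "smooth_step u \<le> 1"
proof -
  show z: "u \<le> 0 \<Longrightarrow> smooth_step u = 0" for u by (simp add: smooth_step_def pos_sq_def)
  show o: "smooth_step u = 1" if "1 \<le> u" for u
  proof -
    have "max 0 u = u" "max 0 (u - 1/2) = u - 1/2" "max 0 (u - 1) = u - 1" using that by auto
    then have "smooth_step u = 2 * u\<^sup>2 - 4 * (u - 1/2)\<^sup>2 + 2 * (u - 1)\<^sup>2"
      by (simp only: smooth_step_def pos_sq_def)
    also have "\<dots> = 1" by (simp add: power2_eq_square algebra_simps)
    finally show ?thesis .
  qed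
  have mono: "smooth_step x \<le> smooth_step y" if "x \<le> y" for x y
  proof (rule DERIV_nonneg_imp_nondecreasing[OF that])
    show "\<exists>l. (smooth_step has_real_derivative l) (at z) \<and> 0 \<le> l" for z
      using smooth_step_deriv tent(1) by blast
  qed
  show "0 \<le> smooth_step u" using mono[of "min 0 u" u] z[of "min 0 u"] by simp
  show "smooth_step u \<le> 1" using mono[of u "max 1 u"] o[of "max 1 u"] by simp
qed

lemma integral_concentrated:
  fixes L \<beta> :: "real \<Rightarrow> real"
  assumes L: "continuous_on {a..b} L" and \<beta>: "continuous_on {a..b} \<beta>" "\<And>s. 0 \<le> \<beta> s"
    and one: "integral {a..b} \<beta> = 1" and near: "\<And>s. s \<in> {a..b} \<Longrightarrow> \<beta> s \<noteq> 0 \<Longrightarrow> \<bar>L s - l\<bar> \<le> e"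
  shows "\<bar>integral {a..b} (\<lambda>s. \<beta> s * L s) - l\<bar> \<le> e"
proof -
  have i: "\<beta> integrable_on {a..b}" "(\<lambda>s. \<beta> s * L s) integrable_on {a..b}" "(\<lambda>s. \<beta> s * (L s - l)) integrable_on {a..b}"
    by (intro integrable_continuous_real continuous_intros L \<beta>)+
  have "integral {a..b} (\<lambda>s. \<beta> s * (L s - l)) = integral {a..b} (\<lambda>s. \<beta> s * L s) - integral {a..b} (\<lambda>s. \<beta> s * l)"
    using i integrable_on_mult_left[OF i(1), of l] by (simp add: right_diff_distrib integral_diff)
  also have "integral {a..b} (\<lambda>s. \<beta> s * l) = l" using one by simp
  finally have eq: "integral {a..b} (\<lambda>s. \<beta> s * L s) - l = integral {a..b} (\<lambda>s. \<beta> s * (L s - l))" by simp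
  have "norm (integral {a..b} (\<lambda>s. \<beta> s * (L s - l))) \<le> integral {a..b} (\<lambda>s. \<beta> s * e)"
  proof (rule integral_norm_bound_integral[OF i(3) integrable_on_mult_left[OF i(1)]])
    fix s assume s: "s \<in> {a..b}"
    show "norm (\<beta> s * (L s - l)) \<le> \<beta> s * e"
    proof (cases "\<beta> s = 0")
      case False
      then show ?thesis using near[OF s False] \<beta>(2)[of s] by (simp add: abs_mult mult_left_mono)
    qed simp
  qed
  also have "integral {a..b} (\<lambda>s. \<beta> s * e) = e" using one by simp
  finally show ?thesis unfolding eq by simp
qed

lemma C2_on_subset: "C2_on \<Omega> f \<Longrightarrow> A \<subseteq> \<Omega> \<Longrightarrow> C2_on A f"
  by (auto simp: C2_on_def intro: continuous_on_subset)

context strip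
begin

lemma lev_null: "t \<in> {a..b} \<Longrightarrow> lev t \<in> null_sets lborel"
proof -
  assume t: "t \<in> {a..b}"
  have "regular \<inter> f -` {t} \<in> null_sets lborel" by (intro null_preimage_regular finite_imp_null_set_lborel) simp
  then have "Crit \<union> (regular \<inter> f -` {t}) \<in> null_sets lborel" using Crit_null(2) by (rule null_sets.Un[rotated])
  moreover have "lev t \<subseteq> Crit \<union> (regular \<inter> f -` {t})" using t by (auto simp: Crit_def regular_def)
  moreover have "lev t \<in> sets lborel" by simp
  ultimately show ?thesis using null_sets_subset by blast
qed

text \<open>
  Apply \<open>curvature_flux\<close> to a function \<open>\<psi>\<close> that climbs from \<open>0\<close> to \<open>1\<close> on a short interval after \<open>a\<close> and
  descends to \<open>0\<close> on a short interval before \<open>b\<close>.  Its derivative is the difference of two bumps of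
  integral one, so the right side tends to \<open>L(b) - L(a)\<close>; the left side tends to the integral of the
  curvature, since the levels \<open>a\<close> and \<open>b\<close> are null sets.
\<close>

lemma length_change: "level_length \<Omega> f b = level_length \<Omega> f a + (LINT z:S|lborel. curv z)"
proof (cases "a = b")
  case True
  have "lev a \<in> null_sets lborel" by (rule lev_null) (use ab in simp)
  from AE_not_in[OF this] have "AE z in lborel. indicator S z *\<^sub>R curv z = 0"
    by eventually_elim (use True in \<open>auto simp: indicator_def\<close>)
  then have "(LINT z:S|lborel. curv z) = 0"
    unfolding set_lebesgue_integral_def by (rule integral_eq_zero_AE)
  then show ?thesis using True by simp
next
  case False
  with ab have ab': "a < b" by simp
  let ?L = "level_length \<Omega> f"
  (* the summand 1 / (b - a) makes both transitions fit into [a,b] already for n = 0 *)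
  define m where "m n = real n + 1 / (b - a)" for n
  have m: "0 < m n" "real n \<le> m n" "1 \<le> m n * (b - a)" for n
    using ab' by (auto simp: m_def add_nonneg_pos distrib_right)
  define \<beta>a where "\<beta>a n s = m n * tent (m n * (s - a))" for n s
  define \<beta>b where "\<beta>b n s = m n * tent (m n * (s - b) + 1)" for n s
  define \<psi> where "\<psi> n s = smooth_step (m n * (s - a)) - smooth_step (m n * (s - b) + 1)" for n s
  have da: "((\<lambda>s. smooth_step (m n * (s - a))) has_real_derivative \<beta>a n s) (at s)" for n s
    unfolding \<beta>a_def
    by (rule DERIV_cong[OF DERIV_chain2[where f = smooth_step and g = "\<lambda>s. m n * (s - a)" and Db = "m n", OF smooth_step_deriv]])
      (auto intro!: derivative_eq_intros)
  have db: "((\<lambda>s. smooth_step (m n * (s - b) + 1)) has_real_derivative \<beta>b n s) (at s)" for n s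
    unfolding \<beta>b_def
    by (rule DERIV_cong[OF DERIV_chain2[where f = smooth_step and g = "\<lambda>s. m n * (s - b) + 1" and Db = "m n", OF smooth_step_deriv]])
      (auto intro!: derivative_eq_intros)
  have \<beta>c: "continuous_on A (\<beta>a n)" "continuous_on A (\<beta>b n)" for A n
    unfolding \<beta>a_def[abs_def] \<beta>b_def[abs_def]
    by (intro continuous_intros continuous_on_compose2[OF continuous_on_tent[of UNIV]]; simp)+
  have out: "\<psi> n s = 0 \<and> \<beta>a n s - \<beta>b n s = 0" if s: "s \<notin> {a..b}" for n s
  proof (cases "s < a")
    case True
    then have "m n * (s - a) \<le> 0" using m(1)[of n] by (simp add: mult_nonneg_nonpos)
    moreover have "m n * (s - b) \<le> m n * (a - b)" using True m(1)[of n] by (intro mult_left_mono) auto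
    then have "m n * (s - b) + 1 \<le> 0" using m(3)[of n] by (simp add: algebra_simps)
    ultimately show ?thesis by (simp add: \<psi>_def \<beta>a_def \<beta>b_def smooth_step tent)
  next
    case False
    then have "b < s" using s by auto
    then have "m n * (b - a) \<le> m n * (s - a)" "0 \<le> m n * (s - b)" using m(1)[of n] by auto
    then have "1 \<le> m n * (s - a)" "1 \<le> m n * (s - b) + 1" using m(3)[of n] by linarith+
    then show ?thesis by (simp add: \<psi>_def \<beta>a_def \<beta>b_def smooth_step tent)
  qed
  have flux: "(LINT z:S|lborel. \<psi> n (f z) * curv z) = integral {a..b} (\<lambda>s. \<beta>b n s * ?L s) - integral {a..b} (\<lambda>s. \<beta>a n s * ?L s)" for n
  proof -
    have "(LINT z:S|lborel. \<psi> n (f z) * curv z) = - (LINT t:{a..b}|lborel. (\<beta>a n t - \<beta>b n t) * ?L t)"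
    proof (rule curvature_flux)
      show "(\<psi> n has_real_derivative \<beta>a n s - \<beta>b n s) (at s)" for s
        unfolding \<psi>_def[abs_def] by (intro DERIV_diff da db)
    qed (use out in \<open>auto intro!: continuous_intros \<beta>c\<close>)
    also have "(LINT t:{a..b}|lborel. (\<beta>a n t - \<beta>b n t) * ?L t) = integral {a..b} (\<lambda>t. (\<beta>a n t - \<beta>b n t) * ?L t)"
      by (intro set_borel_integral_eq_integral(2) borel_integrable_atLeastAtMost' continuous_intros \<beta>c continuous_on_level_length)
    also have "\<dots> = integral {a..b} (\<lambda>s. \<beta>a n s * ?L s) - integral {a..b} (\<lambda>s. \<beta>b n s * ?L s)"
      unfolding left_diff_distrib
      by (intro integral_diff integrable_continuous_real continuous_intros \<beta>c continuous_on_level_length)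
    finally show ?thesis by simp
  qed
  have \<beta>_one: "integral {a..b} (\<beta>a n) = 1" "integral {a..b} (\<beta>b n) = 1" for n
  proof -
    have "(\<beta>a n has_integral smooth_step (m n * (b - a)) - smooth_step (m n * (a - a))) {a..b}"
      using ab da by (intro fundamental_theorem_of_calculus)
        (auto simp: has_real_derivative_iff_has_vector_derivative[symmetric] intro: has_field_derivative_at_within)
    then show "integral {a..b} (\<beta>a n) = 1" using m(3)[of n] by (simp add: integral_unique smooth_step)
    have "(\<beta>b n has_integral smooth_step (m n * (b - b) + 1) - smooth_step (m n * (a - b) + 1)) {a..b}"
      using ab db by (intro fundamental_theorem_of_calculus)
        (auto simp: has_real_derivative_iff_has_vector_derivative[symmetric] intro: has_field_derivative_at_within)
    moreover have "m n * (a - b) + 1 \<le> 0" using m(3)[of n] by (simp add: algebra_simps)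
    ultimately show "integral {a..b} (\<beta>b n) = 1" by (simp add: integral_unique smooth_step)
  qed
  have \<beta>_nonneg: "0 \<le> \<beta>a n s" "0 \<le> \<beta>b n s" for n s
    using m(1)[of n] by (auto simp: \<beta>a_def \<beta>b_def tent intro!: mult_nonneg_nonneg)
  have conc: "(\<lambda>n. integral {a..b} (\<lambda>s. \<beta> n s * ?L s)) \<longlonglongrightarrow> ?L c"
    if c: "c \<in> {a..b}" and \<beta>: "\<And>n. continuous_on {a..b} (\<beta> n)" "\<And>n s. 0 \<le> \<beta> n s" "\<And>n. integral {a..b} (\<beta> n) = 1"
      and supp: "\<And>n s. s \<in> {a..b} \<Longrightarrow> \<beta> n s \<noteq> 0 \<Longrightarrow> m n * \<bar>s - c\<bar> < 1" for c and \<beta> :: "nat \<Rightarrow> real \<Rightarrow> real"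
  proof (rule LIMSEQ_I)
    fix e :: real assume e: "0 < e"
    have e2: "0 < e / 2" using e by simp
    obtain \<delta> where \<delta>: "0 < \<delta>" "\<And>s. s \<in> {a..b} \<Longrightarrow> dist s c < \<delta> \<Longrightarrow> dist (?L s) (?L c) < e / 2"
      using continuous_on_level_length c e2 unfolding continuous_on_iff by blast
    obtain n0 :: nat where n0: "1 / \<delta> < real n0" using reals_Archimedean2 by blast
    have "\<bar>integral {a..b} (\<lambda>s. \<beta> n s * ?L s) - ?L c\<bar> \<le> e / 2" if n: "n0 \<le> n" for n
    proof (rule integral_concentrated[OF continuous_on_level_length \<beta>])
      fix s assume s: "s \<in> {a..b}" "\<beta> n s \<noteq> 0"
      have "1 / \<delta> < m n" using n0 n m(2)[of n] by linarith
      then have "1 < m n * \<delta>" using \<delta>(1) by (simp add: field_simps)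
      then have "m n * \<bar>s - c\<bar> < m n * \<delta>" using supp[OF s] by linarith
      then have "\<bar>s - c\<bar> < \<delta>" using m(1)[of n] by simp
      then show "\<bar>?L s - ?L c\<bar> \<le> e / 2" using \<delta>(2)[OF s(1)] by (simp add: dist_real_def)
    qed
    then show "\<exists>no. \<forall>n\<ge>no. norm (integral {a..b} (\<lambda>s. \<beta> n s * ?L s) - ?L c) < e"
      using e by (intro exI[of _ n0]) (auto intro: le_less_trans[of _ "e / 2"])
  qed
  have lim_a: "(\<lambda>n. integral {a..b} (\<lambda>s. \<beta>a n s * ?L s)) \<longlonglongrightarrow> ?L a"
  proof (rule conc)
    fix n s assume s: "s \<in> {a..b}" "\<beta>a n s \<noteq> 0"
    then have "m n * (s - a) < 1" using tent(3)[of "m n * (s - a)"] by (force simp: \<beta>a_def)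
    then show "m n * \<bar>s - a\<bar> < 1" using s by simp
  qed (use ab \<beta>c \<beta>_nonneg \<beta>_one in auto)
  have lim_b: "(\<lambda>n. integral {a..b} (\<lambda>s. \<beta>b n s * ?L s)) \<longlonglongrightarrow> ?L b"
  proof (rule conc)
    fix n s assume s: "s \<in> {a..b}" "\<beta>b n s \<noteq> 0"
    then have "0 < m n * (s - b) + 1" using tent(2)[of "m n * (s - b) + 1"] by (force simp: \<beta>b_def)
    then show "m n * \<bar>s - b\<bar> < 1" using s by (simp add: algebra_simps)
  qed (use ab \<beta>c \<beta>_nonneg \<beta>_one in auto)
  have \<psi>c: "continuous_on UNIV (\<psi> n)" for n
    unfolding \<psi>_def[abs_def] using da db by (intro continuous_on_diff) (meson DERIV_continuous continuous_at_imp_continuous_on)+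
  have \<psi>_bd: "\<bar>\<psi> n s\<bar> \<le> 1" for n s
    using smooth_step(3,4)[of "m n * (s - a)"] smooth_step(3,4)[of "m n * (s - b) + 1"] by (simp add: \<psi>_def abs_le_iff)
  have cint: "integrable lborel (\<lambda>z. indicator S z *\<^sub>R curv z)" using set_integrable_curv by (simp only: set_integrable_def)
  have "(\<lambda>n. \<integral>z. indicator S z *\<^sub>R (\<psi> n (f z) * curv z) \<partial>lborel) \<longlonglongrightarrow> (\<integral>z. indicator S z *\<^sub>R curv z \<partial>lborel)"
  proof (rule integral_dominated_convergence[OF _ _ integrable_norm[OF cint]])
    show "(\<lambda>z. indicator S z *\<^sub>R curv z) \<in> borel_measurable lborel" using borel_measurable_curv by simp
    show "(\<lambda>z. indicator S z *\<^sub>R (\<psi> n (f z) * curv z)) \<in> borel_measurable lborel" for n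
    proof -
      have "continuous_on \<Omega> (\<lambda>z. \<psi> n (f z))" by (rule continuous_on_compose2[OF \<psi>c continuous_on_f]) auto
      then have "(\<lambda>z. (indicator S z *\<^sub>R \<psi> n (f z)) * (indicator S z *\<^sub>R curv z)) \<in> borel_measurable borel"
        by (intro borel_measurable_times borel_measurable_indicator_continuous borel_measurable_curv) auto
      moreover have "(indicator S z *\<^sub>R \<psi> n (f z)) * (indicator S z *\<^sub>R curv z) = indicator S z *\<^sub>R (\<psi> n (f z) * curv z)" for z
        by (simp add: indicator_def)
      ultimately have "(\<lambda>z. indicator S z *\<^sub>R (\<psi> n (f z) * curv z)) \<in> borel_measurable borel" by (simp only:)
      then show ?thesis by (simp only: measurable_cong_sets[OF sets_lborel refl])
    qed
    show "AE z in lborel. norm (indicator S z *\<^sub>R (\<psi> n (f z) * curv z)) \<le> norm (indicator S z *\<^sub>R curv z)" for n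
      using \<psi>_bd by (intro AE_I2) (auto simp: indicator_def abs_mult intro!: mult_left_le_one_le)
    have "AE z in lborel. z \<notin> lev a" "AE z in lborel. z \<notin> lev b"
      by (rule AE_not_in, rule lev_null, use ab in simp)+
    then show "AE z in lborel. (\<lambda>n. indicator S z *\<^sub>R (\<psi> n (f z) * curv z)) \<longlonglongrightarrow> indicator S z *\<^sub>R curv z"
    proof eventually_elim
      case (elim z)
      show ?case
      proof (cases "z \<in> S")
        case True
        then have fz: "a < f z" "f z < b" using elim by (auto simp: less_le)
        obtain n1 :: nat where n1: "1 / (f z - a) < real n1" using reals_Archimedean2 by blast
        obtain n2 :: nat where n2: "1 / (b - f z) < real n2" using reals_Archimedean2 by blast
        have "\<psi> n (f z) = 1" if "max n1 n2 \<le> n" for n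
        proof -
          have "1 / (f z - a) < m n" "1 / (b - f z) < m n" using n1 n2 that m(2)[of n] by linarith+
          then have "1 \<le> m n * (f z - a)" "m n * (f z - b) + 1 \<le> 0" using fz by (simp_all add: field_simps)
          then show ?thesis by (simp add: \<psi>_def smooth_step)
        qed
        then have "\<forall>\<^sub>F n in sequentially. indicator S z *\<^sub>R (\<psi> n (f z) * curv z) = indicator S z *\<^sub>R curv z"
          unfolding eventually_sequentially by (intro exI[of _ "max n1 n2"]) auto
        then show ?thesis by (rule tendsto_eventually)
      qed simp
    qed
  qed
  then have "(\<lambda>n. integral {a..b} (\<lambda>s. \<beta>b n s * ?L s) - integral {a..b} (\<lambda>s. \<beta>a n s * ?L s)) \<longlonglongrightarrow> (LINT z:S|lborel. curv z)"
    by (simp only: flux[symmetric] set_lebesgue_integral_def)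
  moreover have "(\<lambda>n. integral {a..b} (\<lambda>s. \<beta>b n s * ?L s) - integral {a..b} (\<lambda>s. \<beta>a n s * ?L s)) \<longlonglongrightarrow> ?L b - ?L a"
    by (intro tendsto_diff lim_a lim_b)
  ultimately have "(LINT z:S|lborel. curv z) = ?L b - ?L a" by (rule LIMSEQ_unique)
  then show ?thesis by simp
qed

end

section \<open>Derivative of the length, general weights, improper integrals\<close>

context strip
begin

lemma sub_strip:
  assumes "a \<le> a'" "a' \<le> b'" "b' \<le> b"
  shows "strip \<Omega> f a' b'"
proof unfold_locales
  have "closedin (top_of_set S) (S \<inter> f -` {a'..b'})"
    by (rule continuous_closedin_preimage) (auto intro: continuous_on_subset[OF continuous_on_f])
  moreover have "S \<inter> f -` {a'..b'} = \<Omega> \<inter> f -` {a'..b'}" using assms by auto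
  ultimately show "compact (\<Omega> \<inter> f -` {a'..b'})" using compact_strip closedin_compact by metis
qed (use assms nondegenerate in auto)

lemma integral_level_length:
  "integral {a..b} (level_length \<Omega> f) = integral S (\<lambda>x. norm (G x))"
proof -
  have "integral S (\<lambda>x. norm (G x)) = (LINT z:S|lborel. 1 * norm (G z))"
    using set_borel_integral_eq_integral(2)[OF set_integrable_S[OF continuous_on_norm[OF continuous_on_G]]] by simp
  also have "\<dots> = (LINT t:{a..b}|lborel. LINT z:lev t|hausdorff1. 1)"
    by (rule coarea_continuous) (rule continuous_on_const)
  also have "\<dots> = (LINT t:{a..b}|lborel. level_length \<Omega> f t)" by (simp only: level_length_eq)
  also have "\<dots> = integral {a..b} (level_length \<Omega> f)"
    by (intro set_borel_integral_eq_integral(2) borel_integrable_atLeastAtMost' continuous_on_level_length)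
  finally show ?thesis by simp
qed

lemma absolutely_integrable_gradient: "(\<lambda>x. norm (G x)) absolutely_integrable_on S"
proof -
  have i: "set_integrable lborel S (\<lambda>x. norm (G x))"
    by (intro set_integrable_S continuous_on_norm continuous_on_G)
  then have "(\<lambda>x. indicator S x *\<^sub>R norm (G x)) \<in> borel_measurable lborel"
    unfolding set_integrable_def by (rule borel_measurable_integrable)
  then show ?thesis using i unfolding set_integrable_def by (simp only: integrable_completion)
qed

text \<open>
  A regular value has a neighbourhood of regular values.  On the strip over it, with the critical points
  removed from the domain, \<open>\<kappa>/|\<nabla>f|\<close> is continuous, so the coarea formula writes the increments of the
  length as integrals of a continuous function of the level.
\<close>

lemma level_length_deriv_regular:
  assumes t: "t \<in> {a..b}" and reg: "t \<notin> f ` critical_points \<Omega> f"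
  shows "set_integrable hausdorff1 (lev t) (\<lambda>x. level_curvature f x / norm (G x)) \<and>
    (level_length \<Omega> f has_real_derivative
      (LINT x:lev t|hausdorff1. level_curvature f x / norm (G x))) (at t within {a..b})"
proof -
  have "open (- (f ` Crit))" using finite_Crit by (intro open_Compl finite_imp_closed finite_imageI)
  moreover have "t \<in> - (f ` Crit)" using reg by (auto simp: Crit_eq)
  ultimately obtain \<delta> where \<delta>: "0 < \<delta>" "cball t \<delta> \<subseteq> - (f ` Crit)" using open_contains_cball by blast
  define a' b' where "a' = max a (t - \<delta>)" and "b' = min b (t + \<delta>)"
  have ab': "a \<le> a'" "a' \<le> t" "t \<le> b'" "b' \<le> b" using t \<delta> by (auto simp: a'_def b'_def)
  have sub: "{a'..b'} \<subseteq> cball t \<delta>" by (auto simp: a'_def b'_def dist_real_def)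
  have noC: "x \<in> regular" if "x \<in> \<Omega>" "f x \<in> {a'..b'}" for x
    using that \<delta>(2) sub ab' by (force simp: regular_def Crit_def)
  have lev_eq: "regular \<inter> f -` T = \<Omega> \<inter> f -` T" if "T \<subseteq> {a'..b'}" for T
    using that noC regular_subset by auto
  interpret A: strip \<Omega> f a' b' using ab' by (intro sub_strip) auto
  interpret R: strip regular f a' b'
  proof unfold_locales
    show "open regular" by (rule open_regular)
    show "C2_on regular f" using C2 regular_subset by (rule C2_on_subset)
    show "compact (regular \<inter> f -` {a'..b'})" using A.compact_strip by (simp add: lev_eq)
  qed (use ab' in \<open>auto simp: regular_def\<close>)
  define w where "w x = curv x / norm (G x)" for x
  have wc: "continuous_on regular w"
    unfolding w_def[abs_def]
    by (intro continuous_on_divide continuous_on_curv continuous_on_norm R.continuous_on_G) (simp add: regular_def)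
  have lev_t: "regular \<inter> f -` {t} = lev t" using ab' by (intro lev_eq) auto
  have w_eq: "level_curvature f x / norm (G x) = w x" if "x \<in> lev t" for x
    using that lev_t level_curvature_eq[of x] by (auto simp: w_def)
  define A where "A u = (LINT z:regular \<inter> f -` {u}|hausdorff1. w z)" for u
  have Ac: "continuous_on {a'..b'} A" unfolding A_def by (rule R.continuous_level_integral[OF wc])
  have L_eq: "level_length regular f u = level_length \<Omega> f u" if "u \<in> {a'..b'}" for u
    using that lev_eq[of "{u}"] by (simp add: level_length_def)
  have L: "level_length \<Omega> f u = level_length \<Omega> f a' + integral {a'..u} A" if u: "u \<in> {a'..b'}" for u
  proof -
    interpret U: strip regular f a' u using u by (intro R.sub_strip) auto
    have "level_length regular f u = level_length regular f a' + (LINT z:regular \<inter> f -` {a'..u}|lborel. curv z)"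
      by (rule U.length_change)
    also have "(LINT z:regular \<inter> f -` {a'..u}|lborel. curv z) = (LINT z:regular \<inter> f -` {a'..u}|lborel. w z * norm (G z))"
    proof (rule set_lebesgue_integral_cong)
      show "regular \<inter> f -` {a'..u} \<in> sets lborel" using U.sets_S by simp
    qed (auto simp: w_def regular_def)
    also have "\<dots> = (LINT s:{a'..u}|lborel. A s)" unfolding A_def by (rule U.coarea_continuous[OF wc])
    also have "\<dots> = integral {a'..u} A"
      using u by (intro set_borel_integral_eq_integral(2) borel_integrable_atLeastAtMost' continuous_on_subset[OF Ac]) auto
    finally show ?thesis using u ab' by (simp add: L_eq)
  qed
  have "((\<lambda>u. level_length \<Omega> f a' + integral {a'..u} A) has_real_derivative 0 + A t) (at t within {a'..b'})"
    using ab' by (intro DERIV_add DERIV_const integral_has_real_derivative[OF Ac]) auto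
  then have "((\<lambda>u. level_length \<Omega> f a' + integral {a'..u} A) has_real_derivative A t) (at t within {a'..b'})" by simp
  then have "(level_length \<Omega> f has_real_derivative A t) (at t within {a'..b'})"
  proof (rule has_field_derivative_transform_within[OF _ zero_less_one])
    show "t \<in> {a'..b'}" using ab' by simp
    show "level_length \<Omega> f a' + integral {a'..u} A = level_length \<Omega> f u" if "u \<in> {a'..b'}" for u
      using L[OF that] by simp
  qed
  moreover have "at t within {a..b} = at t within {a'..b'}"
  proof (rule at_within_nhd[of t "{t - \<delta><..<t + \<delta>}"])
    show "{a..b} \<inter> {t - \<delta><..<t + \<delta>} - {t} = {a'..b'} \<inter> {t - \<delta><..<t + \<delta>} - {t}"
      by (auto simp: a'_def b'_def)
  qed (use \<delta> in auto)
  ultimately have D: "(level_length \<Omega> f has_real_derivative A t) (at t within {a..b})" by simp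
  have "set_integrable hausdorff1 (lev t) w"
    using R.set_integrable_lev[OF wc, of t] ab' lev_t by simp
  then have i: "set_integrable hausdorff1 (lev t) (\<lambda>x. level_curvature f x / norm (G x))"
    unfolding set_integrable_def
    by (rule iffD1[OF Bochner_Integration.integrable_cong[OF refl], rotated]) (auto simp: indicator_def w_eq)
  have "A t = (LINT x:lev t|hausdorff1. level_curvature f x / norm (G x))"
    unfolding A_def lev_t by (intro set_lebesgue_integral_cong) (auto simp: w_eq)
  then show ?thesis using i D by simp
qed

text \<open>
  The coarea formula as an identity of measures on the line: weighting area by \<open>|\<nabla>f|\<close> and pushing it
  forward by \<open>f\<close> gives Lebesgue measure weighted by \<open>L\<close>.  In this form it applies to any Borel function
  of the level, whatever its sign.
\<close>

lemma density_eq: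
  "distr (density lborel (\<lambda>z. ennreal (norm (G z)) * indicator S z)) borel (\<lambda>z. indicator S z *\<^sub>R f z) =
   density lborel (\<lambda>t. ennreal (indicator {a..b} t *\<^sub>R level_length \<Omega> f t))"
proof (rule measure_eqI)
  define f' where "f' z = indicator S z *\<^sub>R f z" for z
  have f'[measurable]: "f' \<in> borel_measurable borel"
    unfolding f'_def[abs_def] by (intro borel_measurable_indicator_continuous continuous_on_f) auto
  have Gm: "(\<lambda>z. ennreal (norm (G z)) * indicator S z) \<in> borel_measurable borel"
  proof -
    have "(\<lambda>z. ennreal (indicator S z *\<^sub>R norm (G z))) \<in> borel_measurable borel"
      by (intro measurable_compose[OF _ measurable_ennreal] borel_measurable_indicator_continuous continuous_on_norm continuous_on_G) auto
    moreover have "ennreal (indicator S z *\<^sub>R norm (G z)) = ennreal (norm (G z)) * indicator S z" for z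
      by (simp add: indicator_def)
    ultimately show ?thesis by (simp only:)
  qed
  have Lm[measurable]: "(\<lambda>t. indicator {a..b} t *\<^sub>R level_length \<Omega> f t) \<in> borel_measurable borel"
    by (rule borel_measurable_continuous_on_indicator[OF _ continuous_on_level_length]) simp
  fix B assume "B \<in> sets (distr (density lborel (\<lambda>z. ennreal (norm (G z)) * indicator S z)) borel (\<lambda>z. indicator S z *\<^sub>R f z))"
  then have B: "B \<in> sets borel" by simp
  have B': "f' -` B \<in> sets borel" using measurable_sets_borel[OF f' B] .
  have "emeasure (distr (density lborel (\<lambda>z. ennreal (norm (G z)) * indicator S z)) borel f') B =
      emeasure (density lborel (\<lambda>z. ennreal (norm (G z)) * indicator S z)) (f' -` B)"
    using B f' by (subst emeasure_distr) auto
  also have "\<dots> = (\<integral>\<^sup>+z. ennreal (norm (G z)) * indicator S z * indicator (f' -` B) z \<partial>lborel)"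
    using Gm B' by (subst emeasure_density) auto
  also have "\<dots> = (\<integral>\<^sup>+z. indicator (f' -` B) z * ennreal (norm (G z)) * indicator S z \<partial>lborel)"
    by (simp add: mult_ac)
  also have "\<dots> = (\<integral>\<^sup>+t. (\<integral>\<^sup>+z. indicator (f' -` B) z * indicator (lev t) z \<partial>hausdorff1) * indicator {a..b} t \<partial>lborel)"
    by (rule coarea_strip) (use B' in simp)
  also have "\<dots> = (\<integral>\<^sup>+t. ennreal (indicator {a..b} t *\<^sub>R level_length \<Omega> f t) * indicator B t \<partial>lborel)"
  proof (rule nn_integral_cong)
    fix t
    show "(\<integral>\<^sup>+z. indicator (f' -` B) z * indicator (lev t) z \<partial>hausdorff1) * indicator {a..b} t =
        ennreal (indicator {a..b} t *\<^sub>R level_length \<Omega> f t) * indicator B t"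
    proof (cases "t \<in> {a..b}")
      case True
      have "(\<integral>\<^sup>+z. indicator (f' -` B) z * indicator (lev t) z \<partial>hausdorff1) = (\<integral>\<^sup>+z. indicator B t * indicator (lev t) z \<partial>hausdorff1)"
        using True by (intro nn_integral_cong) (auto simp: f'_def indicator_def)
      also have "\<dots> = indicator B t * emeasure hausdorff1 (lev t)"
        by (rule nn_integral_cmult_indicator) simp
      finally show ?thesis using True by (simp add: emeasure_lev mult.commute)
    qed simp
  qed
  also have "\<dots> = emeasure (density lborel (\<lambda>t. ennreal (indicator {a..b} t *\<^sub>R level_length \<Omega> f t))) B"
  proof (subst emeasure_density)
    show "(\<lambda>t. ennreal (indicator {a..b} t *\<^sub>R level_length \<Omega> f t)) \<in> borel_measurable lborel"
      using measurable_compose[OF Lm measurable_ennreal] by (simp only: measurable_cong_sets[OF sets_lborel refl])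
  qed (use B in auto)
  finally show "emeasure (distr (density lborel (\<lambda>z. ennreal (norm (G z)) * indicator S z)) borel (\<lambda>z. indicator S z *\<^sub>R f z)) B =
      emeasure (density lborel (\<lambda>t. ennreal (indicator {a..b} t *\<^sub>R level_length \<Omega> f t))) B"
    by (simp only: f'_def[abs_def])
qed simp

text \<open>
  The function \<open>h\<close> need not be Borel, so it is replaced by \<open>k = g/L\<close>, where \<open>g\<close> is a Borel function equal
  to \<open>h L\<close> almost everywhere.  The replacement changes nothing on \<open>S\<close> up to null sets: the levels where
  \<open>g\<close> and \<open>h L\<close> differ form a null set, and the levels with \<open>L = 0\<close> contribute no area by the coarea
  formula.
\<close>

lemma coarea_general:
  fixes h :: "real \<Rightarrow> real"
  assumes 1: "(\<lambda>x. h (f x) * norm (G x)) absolutely_integrable_on S"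
    and 2: "(\<lambda>t. h t * level_length \<Omega> f t) absolutely_integrable_on {a..b}"
  shows "integral S (\<lambda>x. h (f x) * norm (G x)) = integral {a..b} (\<lambda>t. h t * level_length \<Omega> f t)"
proof -
  let ?L = "\<lambda>t. indicator {a..b} t *\<^sub>R level_length \<Omega> f t"
  define f' where "f' z = indicator S z *\<^sub>R f z" for z
  have f'[measurable]: "f' \<in> borel_measurable borel"
    unfolding f'_def[abs_def] by (intro borel_measurable_indicator_continuous continuous_on_f) auto
  have Gm[measurable]: "(\<lambda>z. indicator S z *\<^sub>R norm (G z)) \<in> borel_measurable borel"
    by (intro borel_measurable_indicator_continuous continuous_on_norm continuous_on_G) auto
  have Lm[measurable]: "?L \<in> borel_measurable borel"
    by (rule borel_measurable_continuous_on_indicator[OF _ continuous_on_level_length]) simp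
  have hL: "(\<lambda>t. indicator {a..b} t *\<^sub>R (h t * level_length \<Omega> f t)) \<in> borel_measurable (completion lborel)"
    using 2 unfolding set_integrable_def by (rule borel_measurable_integrable)
  obtain g where g[measurable]: "g \<in> borel_measurable borel"
    and gAE: "AE t in lborel. indicator {a..b} t *\<^sub>R (h t * level_length \<Omega> f t) = g t"
    using completion_ex_borel_measurable_real[OF hL] by auto
  define k where "k t = (if ?L t = 0 then 0 else g t / ?L t)" for t
  have km[measurable]: "k \<in> borel_measurable borel" unfolding k_def by measurable
  obtain N where N: "N \<in> null_sets lborel" "{t. indicator {a..b} t *\<^sub>R (h t * level_length \<Omega> f t) \<noteq> g t} \<subseteq> N"
    using gAE by (auto elim!: AE_E simp: null_sets_def)
  define Z where "Z = {t \<in> {a..b}. level_length \<Omega> f t = 0}"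
  have Zm: "Z \<in> sets borel"
  proof -
    have "{a..b} \<inter> (?L -` {0} \<inter> space borel) \<in> sets borel" by (intro sets.Int measurable_sets[OF Lm]) auto
    moreover have "{a..b} \<inter> (?L -` {0} \<inter> space borel) = Z" by (auto simp: Z_def indicator_def)
    ultimately show ?thesis by simp
  qed
  have Zm': "f' -` Z \<in> sets borel" using measurable_sets_borel[OF f' Zm] .
  have "(\<integral>\<^sup>+z. indicator (f' -` Z) z * ennreal (norm (G z)) * indicator S z \<partial>lborel) =
     (\<integral>\<^sup>+t. (\<integral>\<^sup>+z. indicator (f' -` Z) z * indicator (lev t) z \<partial>hausdorff1) * indicator {a..b} t \<partial>lborel)"
    by (rule coarea_strip) (use Zm' in simp)
  also have "\<dots> = (\<integral>\<^sup>+t. 0 \<partial>(lborel :: real measure))"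
  proof (rule nn_integral_cong)
    fix t
    show "(\<integral>\<^sup>+z. indicator (f' -` Z) z * indicator (lev t) z \<partial>hausdorff1) * indicator {a..b} t = 0"
    proof (cases "t \<in> {a..b}")
      case True
      have "(\<integral>\<^sup>+z. indicator (f' -` Z) z * indicator (lev t) z \<partial>hausdorff1) = (\<integral>\<^sup>+z. indicator Z t * indicator (lev t) z \<partial>hausdorff1)"
        using True by (intro nn_integral_cong) (auto simp: f'_def indicator_def)
      also have "\<dots> = indicator Z t * emeasure hausdorff1 (lev t)"
        by (rule nn_integral_cmult_indicator) simp
      also have "\<dots> = 0" using emeasure_lev[OF True] by (auto simp: Z_def indicator_def)
      finally show ?thesis by simp
    qed simp
  qed
  also have "\<dots> = 0" by simp
  finally have "(\<integral>\<^sup>+z. indicator (f' -` Z) z * ennreal (norm (G z)) * indicator S z \<partial>lborel) = 0" .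
  moreover have "indicator (f' -` Z) z * ennreal (norm (G z)) * indicator S z =
      indicator (f' -` Z) z * ennreal (indicator S z *\<^sub>R norm (G z))" for z
    by (cases "z \<in> S") auto
  ultimately have z0: "(\<integral>\<^sup>+z. indicator (f' -` Z) z * ennreal (indicator S z *\<^sub>R norm (G z)) \<partial>lborel) = 0"
    by (simp only:)
  have Zae: "AE z in lborel. indicator (f' -` Z) z * ennreal (indicator S z *\<^sub>R norm (G z)) = 0"
  proof -
    have "(\<lambda>z. indicator (f' -` Z) z * ennreal (indicator S z *\<^sub>R norm (G z))) \<in> borel_measurable lborel"
      using borel_measurable_times_ennreal[OF borel_measurable_indicator[OF Zm'] measurable_compose[OF Gm measurable_ennreal]]
      by (simp only: measurable_cong_sets[OF sets_lborel refl])
    from iffD1[OF nn_integral_0_iff_AE[OF this] z0] show ?thesis .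
  qed
  have reg: "AE z in lborel. z \<notin> Crit" by (rule AE_not_in[OF Crit_null(2)])
  have Nae: "AE z in lborel. z \<notin> regular \<inter> f -` N" by (rule AE_not_in[OF null_preimage_regular[OF N(1)]])
  have eqAE: "AE z in lborel. indicator S z *\<^sub>R (h (f z) * norm (G z)) = (indicator S z *\<^sub>R norm (G z)) * k (f' z)"
    using Zae reg Nae
  proof eventually_elim
    case (elim z)
    show ?case
    proof (cases "z \<in> S")
      case True
      then have g0: "G z \<noteq> 0" using elim(2) by (simp add: Crit_def)
      then have "z \<in> regular" using True by (simp add: regular_def)
      then have fN: "f z \<notin> N" using elim(3) by simp
      have fz: "f' z = f z" "f z \<in> {a..b}" using True by (auto simp: f'_def)
      have "f z \<notin> Z" using elim(1) True g0 fz by (auto simp: indicator_def)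
      then have L0: "level_length \<Omega> f (f z) \<noteq> 0" using fz by (simp add: Z_def)
      have "f z \<notin> {t. indicator {a..b} t *\<^sub>R (h t * level_length \<Omega> f t) \<noteq> g t}" using fN N(2) by blast
      then have "g (f z) = h (f z) * level_length \<Omega> f (f z)" using fz(2) by simp
      then show ?thesis using L0 fz True by (simp add: k_def)
    qed simp
  qed
  have eqAE2: "AE t in lborel. indicator {a..b} t *\<^sub>R (h t * level_length \<Omega> f t) = ?L t * k t"
    using gAE by eventually_elim (auto simp: k_def indicator_def)
  have m1: "(\<lambda>z. (indicator S z *\<^sub>R norm (G z)) * k (f' z)) \<in> borel_measurable borel"
    by (intro borel_measurable_times Gm measurable_compose[OF f' km])
  have "integral S (\<lambda>x. h (f x) * norm (G x)) = (LINT x:S|lebesgue. h (f x) * norm (G x))"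
    by (rule set_lebesgue_integral_eq_integral(2)[OF 1, symmetric])
  also have "\<dots> = (\<integral>z. (indicator S z *\<^sub>R norm (G z)) * k (f' z) \<partial>completion lborel)"
    unfolding set_lebesgue_integral_def
  proof (rule integral_cong_AE)
    show "(\<lambda>z. indicator S z *\<^sub>R (h (f z) * norm (G z))) \<in> borel_measurable lebesgue"
      using 1 unfolding set_integrable_def by (rule borel_measurable_integrable)
    show "(\<lambda>z. (indicator S z *\<^sub>R norm (G z)) * k (f' z)) \<in> borel_measurable lebesgue"
      using m1 by (intro measurable_completion) simp
  qed (rule AE_completion[OF eqAE])
  also have "\<dots> = (\<integral>z. (indicator S z *\<^sub>R norm (G z)) * k (f' z) \<partial>lborel)"
    by (rule integral_completion) (use m1 in simp)
  also have "\<dots> = (\<integral>z. k (f' z) \<partial>density lborel (\<lambda>z. ennreal (indicator S z *\<^sub>R norm (G z))))"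
  proof (subst integral_density)
    show "(\<lambda>z. k (f' z)) \<in> borel_measurable lborel" using measurable_compose[OF f' km] by simp
    show "(\<lambda>z. indicator S z *\<^sub>R norm (G z)) \<in> borel_measurable lborel"
      using Gm by (simp only: measurable_cong_sets[OF sets_lborel refl])
  qed auto
  also have "(\<lambda>z. ennreal (indicator S z *\<^sub>R norm (G z))) = (\<lambda>z. ennreal (norm (G z)) * indicator S z)"
    by (auto simp: indicator_def fun_eq_iff)
  also have "(\<integral>z. k (f' z) \<partial>density lborel (\<lambda>z. ennreal (norm (G z)) * indicator S z)) =
      (\<integral>t. k t \<partial>distr (density lborel (\<lambda>z. ennreal (norm (G z)) * indicator S z)) borel f')"
    by (rule integral_distr[symmetric]) (use f' km in auto)
  also have "\<dots> = (\<integral>t. k t \<partial>density lborel (\<lambda>t. ennreal (?L t)))"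
    using density_eq by (simp only: f'_def[abs_def])
  also have "\<dots> = (\<integral>t. ?L t *\<^sub>R k t \<partial>lborel)"
  proof (rule integral_density)
    show "k \<in> borel_measurable lborel" using km by simp
    show "?L \<in> borel_measurable lborel" using Lm by (simp only: measurable_cong_sets[OF sets_lborel refl])
    show "AE t in lborel. 0 \<le> ?L t" using level_length_nonneg by (intro AE_I2) (auto simp: indicator_def)
  qed
  also have "\<dots> = (\<integral>t. ?L t * k t \<partial>completion lborel)"
    by (subst integral_completion) (use Lm km in auto)
  also have "\<dots> = (LINT t:{a..b}|lebesgue. h t * level_length \<Omega> f t)"
    unfolding set_lebesgue_integral_def
  proof (rule integral_cong_AE)
    show "(\<lambda>t. indicator {a..b} t *\<^sub>R (h t * level_length \<Omega> f t)) \<in> borel_measurable lebesgue" by (rule hL)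
    show "(\<lambda>t. ?L t * k t) \<in> borel_measurable lebesgue"
      using borel_measurable_times[OF Lm km] by (intro measurable_completion) simp
    show "AE t in lebesgue. ?L t * k t = indicator {a..b} t *\<^sub>R (h t * level_length \<Omega> f t)"
      using AE_completion[OF eqAE2] by eventually_elim (simp only:)
  qed
  also have "\<dots> = integral {a..b} (\<lambda>t. h t * level_length \<Omega> f t)"
    by (rule set_lebesgue_integral_eq_integral(2)[OF 2])
  finally show ?thesis .
qed

lemma negligible_frontier_S: "negligible (frontier S)"
proof -
  have cl: "closed S" by (rule compact_imp_closed[OF compact_strip])
  have "open (\<Omega> \<inter> f -` {a<..<b})"
    by (rule continuous_open_preimage[OF continuous_on_f open_\<Omega> open_greaterThanLessThan])
  then have "\<Omega> \<inter> f -` {a<..<b} \<subseteq> interior S" by (intro interior_maximal) auto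
  then have "frontier S \<subseteq> lev a \<union> lev b"
    using cl by (auto simp: frontier_def less_le)
  moreover have "lev a \<union> lev b \<in> null_sets lborel"
    using ab by (intro null_sets.Un lev_null) auto
  then have "negligible (lev a \<union> lev b)"
    unfolding negligible_iff_null_sets by (rule null_sets_completionI)
  ultimately show ?thesis by (rule negligible_subset[rotated])
qed

lemma has_Riemann_integral_level_curvature:
  assumes K: "closed K" "Jordan_measurable K" "K \<subseteq> S - critical_points \<Omega> f"
  shows "has_Riemann_integral (level_curvature f) (LINT z:K|lborel. curv z) K"
proof -
  have reg: "K \<subseteq> regular" using K(3) by (auto simp: regular_def critical_points_def)
  have comp: "compact K" using K(1,2) by (simp add: Jordan_measurable_def compact_eq_bounded_closed)
  have cc: "continuous_on K curv" by (rule continuous_on_subset[OF continuous_on_curv reg])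
  have eq: "level_curvature f z = curv z" if "z \<in> K" for z using that reg level_curvature_eq by blast
  have cl: "continuous_on K (level_curvature f)" by (rule continuous_on_eq[OF cc]) (simp add: eq)
  have i: "set_integrable lborel K curv"
    unfolding set_integrable_def by (rule borel_integrable_compact[OF comp cc])
  have "(curv has_integral (LINT z:K|lborel. curv z)) K"
    using set_borel_integral_eq_integral[OF i] by (simp add: has_integral_iff)
  then have "(level_curvature f has_integral (LINT z:K|lborel. curv z)) K"
    by (rule has_integral_eq[rotated]) (simp add: eq)
  moreover have "bounded (level_curvature f ` K)"
    by (rule compact_imp_bounded[OF compact_continuous_image[OF cl comp]])
  moreover have none: "{x \<in> K. \<not> continuous (at x within K) (level_curvature f)} = {}"
    using cl by (auto simp: continuous_on_eq_continuous_within)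
  ultimately show ?thesis using K(2) unfolding has_Riemann_integral_def none by simp
qed

text \<open>
  Remove discs of radius \<open>1/(n + 1)\<close> around the critical points.
\<close>

lemma Jordan_exhaustion_exists: "\<exists>K. Jordan_exhaustion S (critical_points \<Omega> f) K"
proof -
  define U where "U n = (\<Union>p\<in>Crit. ball p (inverse (real (Suc n))))" for n
  define K where "K n = S - U n" for n
  have openU: "open (U n)" for n by (auto simp: U_def)
  have cl: "closed S" by (rule compact_imp_closed[OF compact_strip])
  have "Jordan_exhaustion S (critical_points \<Omega> f) K"
    unfolding Jordan_exhaustion_def
  proof (intro conjI allI ballI)
    fix n
    show "closed (K n)" unfolding K_def using cl openU by (rule closed_Diff)
    have negU: "negligible (frontier (U n))"
      unfolding U_def using finite_Crit
    proof induction
      case (insert p C)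
      have "frontier (ball p (inverse (real (Suc n))) \<union> (\<Union>p\<in>C. ball p (inverse (real (Suc n))))) \<subseteq>
          frontier (ball p (inverse (real (Suc n)))) \<union> frontier (\<Union>p\<in>C. ball p (inverse (real (Suc n))))"
        by (rule frontier_Un_subset)
      moreover have "negligible (frontier (ball p (inverse (real (Suc n)))) \<union> frontier (\<Union>p\<in>C. ball p (inverse (real (Suc n)))))"
        by (rule negligible_Un[OF negligible_convex_frontier[OF convex_ball] insert.IH])
      ultimately have "negligible (frontier (ball p (inverse (real (Suc n))) \<union> (\<Union>p\<in>C. ball p (inverse (real (Suc n))))))"
        by (rule negligible_subset[rotated])
      then show ?case by (simp only: UN_insert)
    qed simp
    have "frontier (K n) \<subseteq> frontier S \<union> frontier (- U n)"
      unfolding K_def Diff_eq by (rule frontier_Int_subset)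
    moreover have "negligible (frontier S \<union> frontier (- U n))"
      using negU negligible_frontier_S by (simp add: frontier_complement)
    ultimately have "negligible (frontier (K n))" by (rule negligible_subset[rotated])
    moreover have "bounded (K n)"
      unfolding K_def by (rule bounded_subset[OF compact_imp_bounded[OF compact_strip]]) auto
    ultimately show "Jordan_measurable (K n)" by (simp add: Jordan_measurable_def)
    have "Crit \<subseteq> U n" unfolding U_def by force
    then show "K n \<subseteq> S - critical_points \<Omega> f" using Crit_eq by (auto simp: K_def)
    have "inverse (real (Suc (Suc n))) \<le> inverse (real (Suc n))" by (intro le_imp_inverse_le) auto
    then have "U (Suc n) \<subseteq> U n" unfolding U_def by (intro UN_mono subset_ball) auto
    then show "K n \<subseteq> K (Suc n)" by (auto simp: K_def)
  next
    fix x assume x: "x \<in> interior (S - critical_points \<Omega> f)"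
    then have xS: "x \<in> interior S" "x \<notin> Crit"
      using interior_mono[of "S - critical_points \<Omega> f" S] interior_subset[of "S - critical_points \<Omega> f"] Crit_eq by auto
    obtain d where d: "0 < d" "\<And>p. p \<in> Crit \<Longrightarrow> p \<noteq> x \<Longrightarrow> d \<le> dist x p"
      using finite_set_avoid[OF finite_Crit, of x] by auto
    obtain n where n: "inverse (real (Suc n)) < d" using reals_Archimedean[OF d(1)] by blast
    define V where "V = interior S \<inter> - (\<Union>p\<in>Crit. cball p (inverse (real (Suc n))))"
    have "open V" unfolding V_def using finite_Crit by (intro open_Int open_interior open_Compl closed_UN) auto
    moreover have "x \<in> V"
    proof -
      have "x \<notin> cball p (inverse (real (Suc n)))" if "p \<in> Crit" for p
      proof -
        have "p \<noteq> x" using that xS(2) by auto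
        then show ?thesis using d(2)[OF that] n by (simp add: dist_commute)
      qed
      then show ?thesis using xS(1) by (simp add: V_def)
    qed
    moreover have "U n \<subseteq> (\<Union>p\<in>Crit. cball p (inverse (real (Suc n))))"
      unfolding U_def by (intro UN_mono ball_subset_cball subset_refl)
    then have "V \<subseteq> K n" using interior_subset[of S] unfolding V_def K_def by blast
    ultimately have "x \<in> interior (K n)" using interior_maximal by blast
    then show "\<exists>n. x \<in> interior (K n)" by blast
  qed
  then show ?thesis by blast
qed

text \<open>
  Almost every point of \<open>S\<close> is interior to \<open>S\<close> and regular, hence eventually in the members of the
  sequence; the absolutely integrable curvature dominates.
\<close>

lemma integral_exhaustion:
  assumes K: "Jordan_exhaustion S (critical_points \<Omega> f) K"
  shows "(\<lambda>n. LINT z:K n|lborel. curv z) \<longlonglongrightarrow> (LINT z:S|lborel. curv z)"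
proof -
  have Kc: "closed (K n)" "K n \<subseteq> S - critical_points \<Omega> f" "K n \<subseteq> K (Suc n)" for n
    using K by (auto simp: Jordan_exhaustion_def)
  have Kint: "\<exists>n. x \<in> interior (K n)" if "x \<in> interior (S - critical_points \<Omega> f)" for x
    using K that by (auto simp: Jordan_exhaustion_def)
  have mono: "K m \<subseteq> K n" if "m \<le> n" for m n using lift_Suc_mono_le[of K] Kc(3) that by blast
  have cl: "closed S" by (rule compact_imp_closed[OF compact_strip])
  have "frontier S \<in> null_sets lborel"
  proof -
    have "frontier S \<in> null_sets (completion lborel)" using negligible_frontier_S by (simp add: negligible_iff_null_sets)
    moreover have "frontier S \<in> sets borel" by simp
    ultimately show ?thesis by (simp add: null_sets_def)
  qed
  then have 1: "AE z in lborel. z \<notin> frontier S" by (rule AE_not_in)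
  have 2: "AE z in lborel. z \<notin> Crit" by (rule AE_not_in[OF Crit_null(2)])
  have cint: "integrable lborel (\<lambda>z. indicator S z *\<^sub>R curv z)" using set_integrable_curv by (simp only: set_integrable_def)
  have KS: "indicator (K n) z *\<^sub>R curv z = indicator (K n) z *\<^sub>R (indicator S z *\<^sub>R curv z)" for n z
    using Kc(2)[of n] by (auto simp: indicator_def)
  show ?thesis
    unfolding set_lebesgue_integral_def
  proof (rule integral_dominated_convergence[OF _ _ integrable_norm[OF cint]])
    show "(\<lambda>z. indicator S z *\<^sub>R curv z) \<in> borel_measurable lborel" using borel_measurable_curv by simp
    have "(\<lambda>z. indicator (K n) z *\<^sub>R (indicator S z *\<^sub>R curv z)) \<in> borel_measurable borel" for n
      using Kc(1) by (intro borel_measurable_scaleR borel_measurable_indicator borel_measurable_curv) auto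
    then show "(\<lambda>z. indicator (K n) z *\<^sub>R curv z) \<in> borel_measurable lborel" for n
      by (simp only: KS[symmetric] measurable_cong_sets[OF sets_lborel refl])
    show "AE z in lborel. norm (indicator (K n) z *\<^sub>R curv z) \<le> norm (indicator S z *\<^sub>R curv z)" for n
      using Kc(2)[of n] by (intro AE_I2) (auto simp: indicator_def)
    show "AE z in lborel. (\<lambda>n. indicator (K n) z *\<^sub>R curv z) \<longlonglongrightarrow> indicator S z *\<^sub>R curv z"
      using 1 2
    proof eventually_elim
      case (elim z)
      show ?case
      proof (cases "z \<in> S")
        case True
        then have "z \<in> interior S \<inter> - Crit" using elim cl by (auto simp: frontier_def)
        moreover have "open (interior S \<inter> - Crit)" using finite_Crit by (intro open_Int open_interior open_Compl finite_imp_closed)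
        moreover have "interior S \<inter> - Crit \<subseteq> S - critical_points \<Omega> f" using interior_subset[of S] Crit_eq by auto
        ultimately have "z \<in> interior (S - critical_points \<Omega> f)" using interior_maximal by blast
        then obtain n0 where "z \<in> interior (K n0)" using Kint by blast
        then have n0: "z \<in> K n0" using interior_subset by blast
        have "\<forall>\<^sub>F n in sequentially. indicator (K n) z *\<^sub>R curv z = indicator S z *\<^sub>R curv z"
          unfolding eventually_sequentially using n0 mono True by (intro exI[of _ n0]) (auto simp: indicator_def)
        then show ?thesis by (rule tendsto_eventually)
      next
        case False
        then have "z \<notin> K n" for n using Kc(2)[of n] by auto
        then show ?thesis using False by simp
      qed
    qed
  qed
qed

lemma has_Riemann_integral_avoiding_curvature:
  "has_Riemann_integral_avoiding (critical_points \<Omega> f) (level_curvature f) (LINT z:S|lborel. curv z) S"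
proof (cases "S \<inter> critical_points \<Omega> f = {}")
  case True
  have "has_Riemann_integral (level_curvature f) (LINT z:S|lborel. curv z) S"
  proof (rule has_Riemann_integral_level_curvature)
    show "closed S" by (rule compact_imp_closed[OF compact_strip])
    show "Jordan_measurable S"
      using compact_imp_bounded[OF compact_strip] negligible_frontier_S by (simp add: Jordan_measurable_def)
  qed (use True in auto)
  then show ?thesis using True by (simp add: has_Riemann_integral_avoiding_def)
next
  case False
  have "\<exists>J. (\<forall>n. has_Riemann_integral (level_curvature f) (J n) (K n)) \<and> J \<longlonglongrightarrow> (LINT z:S|lborel. curv z)"
    if K: "Jordan_exhaustion S (critical_points \<Omega> f) K" for K
  proof (intro exI conjI allI)
    show "has_Riemann_integral (level_curvature f) (LINT z:K n|lborel. curv z) (K n)" for n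
      using K by (intro has_Riemann_integral_level_curvature) (auto simp: Jordan_exhaustion_def)
    show "(\<lambda>n. LINT z:K n|lborel. curv z) \<longlonglongrightarrow> (LINT z:S|lborel. curv z)" by (rule integral_exhaustion[OF K])
  qed
  then show ?thesis using False Jordan_exhaustion_exists by (simp add: has_Riemann_integral_avoiding_def)
qed

end

theorem theorem2:
  fixes \<Omega> :: "(real^2) set" and f :: "real^2 \<Rightarrow> real" and a b :: real
  assumes "open \<Omega>" and "connected \<Omega>"
    and "Morse_on \<Omega> f"
    and "a < b" and "a \<in> f ` \<Omega>" and "b \<in> f ` \<Omega>"
    and "compact (\<Omega> \<inter> f -` {a..b})"
  shows
    "(\<forall>t\<in>{a..b}. emeasure hausdorff1 (\<Omega> \<inter> f -` {t}) < \<infinity>) \<and>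
     (\<forall>h :: real \<Rightarrow> real.
        (\<lambda>x. h (f x) * norm (gradient f x)) absolutely_integrable_on (\<Omega> \<inter> f -` {a..b}) \<longrightarrow>
        (\<lambda>t. h t * level_length \<Omega> f t) absolutely_integrable_on {a..b} \<longrightarrow>
        integral (\<Omega> \<inter> f -` {a..b}) (\<lambda>x. h (f x) * norm (gradient f x)) =
        integral {a..b} (\<lambda>t. h t * level_length \<Omega> f t)) \<and>
     (\<forall>t\<in>{a..b}.
        level_length \<Omega> f absolutely_integrable_on {a..t} \<and>
        (\<lambda>x. norm (gradient f x)) absolutely_integrable_on (\<Omega> \<inter> f -` {a..t}) \<and>
        integral {a..t} (level_length \<Omega> f) =
        integral (\<Omega> \<inter> f -` {a..t}) (\<lambda>x. norm (gradient f x))) \<and>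
     (\<forall>t\<in>{a..b}.
        ((\<lambda>u. integral (\<Omega> \<inter> f -` {a..u}) (\<lambda>x. norm (gradient f x)))
          has_real_derivative level_length \<Omega> f t) (at t within {a..b})) \<and>
     (\<forall>t\<in>{a..b}. t \<notin> f ` critical_points \<Omega> f \<longrightarrow>
        set_integrable hausdorff1 (\<Omega> \<inter> f -` {t})
          (\<lambda>x. level_curvature f x / norm (gradient f x)) \<and>
        (level_length \<Omega> f has_real_derivative
          (LINT x:\<Omega> \<inter> f -` {t}|hausdorff1. level_curvature f x / norm (gradient f x)))
          (at t within {a..b})) \<and>
     (\<forall>t\<in>{a..b}. \<exists>I.
        has_Riemann_integral_avoiding (critical_points \<Omega> f) (level_curvature f) I
          (\<Omega> \<inter> f -` {a..t}) \<and>
        level_length \<Omega> f t = level_length \<Omega> f a + I)"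
proof -
  interpret strip \<Omega> f a b
    using assms by unfold_locales (auto simp: Morse_on_def critical_points_def)
  have below: "strip \<Omega> f a t" if "t \<in> {a..b}" for t using that by (intro sub_strip) auto
  have area: "integral {a..t} (level_length \<Omega> f) = integral (\<Omega> \<inter> f -` {a..t}) (\<lambda>x. norm (G x))"
    if "t \<in> {a..b}" for t by (rule strip.integral_level_length[OF below[OF that]])
  have deriv: "((\<lambda>u. integral (\<Omega> \<inter> f -` {a..u}) (\<lambda>x. norm (G x))) has_real_derivative level_length \<Omega> f t)
      (at t within {a..b})" if t: "t \<in> {a..b}" for t
    by (rule has_field_derivative_transform_within[OF integral_has_real_derivative[OF continuous_on_level_length t] zero_less_one t])
      (rule area)
  have integrable: "level_length \<Omega> f absolutely_integrable_on {a..t}" if "t \<in> {a..b}" for t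
    using that by (intro absolutely_integrable_continuous_real continuous_on_subset[OF continuous_on_level_length]) auto
  have curvature: "\<exists>I. has_Riemann_integral_avoiding (critical_points \<Omega> f) (level_curvature f) I (\<Omega> \<inter> f -` {a..t}) \<and>
      level_length \<Omega> f t = level_length \<Omega> f a + I" if t: "t \<in> {a..b}" for t
    using strip.has_Riemann_integral_avoiding_curvature[OF below[OF t]] strip.length_change[OF below[OF t]]
    by (intro exI conjI)
  show ?thesis
    using emeasure_lev_finite coarea_general integrable strip.absolutely_integrable_gradient[OF below] area deriv
      level_length_deriv_regular curvature
    by (intro conjI ballI allI impI) simp_all
qed

end
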